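(* Let $n,p\ge 1$ and $L\ge 2$ be integers, let $\nu>0$, let $\mathbf{x}_1,\dots,\mathbf{x}_n\in\mathbb{R}^p$ be fixed covariate vectors, and let $\boldsymbol{\Sigma}$ be a known $L\times L$ positive definite covariance matrix. Consider the Bayesian multinomial probit model in which $\boldsymbol{\beta}=(\boldsymbol{\beta}_1^\top,\dots,\boldsymbol{\beta}_{L-1}^\top)^\top$, with $\boldsymbol{\beta}_\ell\in\mathbb{R}^p$, has prior $\boldsymbol{\beta}\sim \mathrm{N}_{p(L-1)}(\mathbf{0},\nu^2\mathbf{I}_{p(L-1)})$, $\boldsymbol{\beta}_L=\mathbf{0}$, and, conditionally on $\boldsymbol{\beta}$, the responses $y_1,\dots,y_n\in\{1,\dots,L\}$ are independent with $$\Pr(y_i=\ell\mid\boldsymbol{\beta},\mathbf{x}_i)=\Pr\big(\mathbf{x}_i^\top\boldsymbol{\beta}_\ell+\varepsilon_{i\ell}>\mathbf{x}_i^\top\boldsymbol{\beta}_k+\varepsilon_{ik}\ \ \forall k\neq \ell\big),\qquad \ell=1,\dots,L,$$ where $(\varepsilon_{i1},\dots,\varepsilon_{iL})^\top\sim \mathrm{N}_L(\mathbf{0},\boldsymbol{\Sigma})$ independently over $i=1,\dots,n$ (and independently of $\boldsymbol{\beta}$). Let $\bar{\mathbf{X}}$ and $\boldsymbol{\Lambda}$ be the matrices built from the covariates, $\boldsymbol{\Sigma}$ and the observed responses $\mathbf{y}=(y_1,\dots,y_n)^\top$ as in the context. Then the posterior distribution of $\boldsymbol{\beta}$ given $\mathbf{y}$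 is $$(\boldsymbol{\beta}\mid\mathbf{y},\mathbf{X})\sim \mathrm{SUN}_{p(L-1),\,n(L-1)}\big(\mathbf{0},\boldsymbol{\Omega}_{\rm pst},\boldsymbol{\Delta}_{\rm pst},\mathbf{0},\boldsymbol{\Gamma}_{\rm pst}\big),$$ with $\boldsymbol{\Omega}_{\rm pst}=\nu^2\mathbf{I}_{p(L-1)}$, $\boldsymbol{\Delta}_{\rm pst}=\nu\,\bar{\mathbf{X}}^\top\mathbf{s}^{-1}$, and $\boldsymbol{\Gamma}_{\rm pst}$ the $n(L-1)\times n(L-1)$ correlation matrix $\boldsymbol{\Gamma}_{\rm pst}=\mathbf{s}^{-1}(\nu^2\bar{\mathbf{X}}\bar{\mathbf{X}}^\top+\boldsymbol{\Lambda})\mathbf{s}^{-1}$, where $\mathbf{s}=[(\nu^2\bar{\mathbf{X}}\bar{\mathbf{X}}^\top+\boldsymbol{\Lambda})\odot\mathbf{I}_{n(L-1)}]^{1/2}$.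
   Context: Notation: $\mathbf{I}_m$ is the $m\times m$ identity, $\odot$ the element-wise (Hadamard) product, $\otimes$ the Kronecker product, $\phi_q(\cdot;\mathbf{W})$ the density of $\mathrm{N}_q(\mathbf{0},\mathbf{W})$, and $\Phi_h(\mathbf{u};\mathbf{W})$ the cumulative distribution function of $\mathrm{N}_h(\mathbf{0},\mathbf{W})$ evaluated at $\mathbf{u}\in\mathbb{R}^h$. $\mathbf{X}$ denotes the collection of covariates $\mathbf{x}_1,\dots,\mathbf{x}_n$. Unified skew-normal (SUN) distribution: $\boldsymbol{\beta}\in\mathbb{R}^q$ has distribution $\mathrm{SUN}_{q,h}(\boldsymbol{\xi},\boldsymbol{\Omega},\boldsymbol{\Delta},\boldsymbol{\gamma},\boldsymbol{\Gamma})$ if it has density $$p(\boldsymbol{\beta})=\phi_q(\boldsymbol{\beta}-\boldsymbol{\xi};\boldsymbol{\Omega})\,\frac{\Phi_h\big[\boldsymbol{\gamma}+\boldsymbol{\Delta}^\top\bar{\boldsymbol{\Omega}}^{-1}\boldsymbol{\omega}^{-1}(\boldsymbol{\beta}-\boldsymbol{\xi});\ \boldsymbol{\Gamma}-\boldsymbol{\Delta}^\top\bar{\boldsymbol{\Omega}}^{-1}\boldsymbol{\Delta}\big]}{\Phi_h(\boldsymbol{\gamma};\boldsymbol{\Gamma})},$$ where $\boldsymbol{\omega}=(\boldsymbol{\Omega}\odot\mathbf{I}_q)^{1/2}$ is the diagonal scale matrix and $\bar{\boldsymbol{\Omega}}$ is the correlation matrix determined by $\boldsymbol{\Omega}=\boldsymbol{\omega}\bar{\boldsymbol{\Omega}}\boldsymbol{\omega}$.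 Matrices $\bar{\mathbf{X}}$ and $\boldsymbol{\Lambda}$: for $\ell=1,\dots,L$ let $\mathbf{v}_\ell\in\mathbb{R}^L$ be the vector with $1$ in position $\ell$ and $0$ elsewhere; let $\mathbf{V}_{[-\ell]}$ be the $(L-1)\times L$ matrix whose rows are $(\mathbf{v}_k-\mathbf{v}_\ell)^\top$, $k\ne\ell$ (stacked in increasing order of $k$); let $\bar{\mathbf{V}}_{[-\ell]}$ be the $(L-1)\times(L-1)$ matrix obtained from $\mathbf{V}_{[-\ell]}$ by removing its $L$-th column; and let $\mathbf{X}_{i[-\ell]}=-\bar{\mathbf{V}}_{[-\ell]}\otimes\mathbf{x}_i^\top$, of size $(L-1)\times p(L-1)$. Then $\bar{\mathbf{X}}$ is the $n(L-1)\times p(L-1)$ matrix obtained by stacking the row blocks $\bar{\mathbf{X}}_{[i]}=\mathbf{X}_{i[-y_i]}$, $i=1,\dots,n$, and $\boldsymbol{\Lambda}$ is the $n(L-1)\times n(L-1)$ block-diagonal matrix with diagonal blocks $\boldsymbol{\Lambda}_{[ii]}=\mathbf{V}_{[-y_i]}\boldsymbol{\Sigma}\mathbf{V}_{[-y_i]}^\top$, $i=1,\dots,n$. *)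

theory Defs
  imports
    "HOL-Probability.Probability"
    "Jordan_Normal_Form.Gauss_Jordan_Elimination"
    "Jordan_Normal_Form.Determinant"
begin

hide_const (open) Finite_Cartesian_Product.vec Finite_Cartesian_Product.row
  Finite_Cartesian_Product.column Finite_Cartesian_Product.rows Finite_Cartesian_Product.columns
  Finite_Cartesian_Product.mat Finite_Cartesian_Product.transpose Determinants.det
hide_type (open) Finite_Cartesian_Product.vec
no_notation vec_nth (infixl \<open>$\<close> 90)

text \<open>
  All indices (of vectors, matrices, observations and response categories) start at 0, so the
  categories are \<open>0, \<dots>, L - 1\<close> and the reference category is \<open>L - 1\<close>.
\<close>


subsection \<open>Matrices\<close>

text \<open>The inverse; unspecified for a singular matrix.\<close>

definition minv :: "real mat \<Rightarrow> real mat" where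
  "minv A = the (mat_inverse A)"

definition hadamard_mat :: "real mat \<Rightarrow> real mat \<Rightarrow> real mat" where
  "hadamard_mat A B = mat (dim_row A) (dim_col A) (\<lambda>(i, j). A $$ (i, j) * B $$ (i, j))"

definition kronecker_mat :: "real mat \<Rightarrow> real mat \<Rightarrow> real mat" where
  "kronecker_mat A B =
     mat (dim_row A * dim_row B) (dim_col A * dim_col B)
       (\<lambda>(i, j). A $$ (i div dim_row B, j div dim_col B) * B $$ (i mod dim_row B, j mod dim_col B))"

text \<open>
  The matrix \<open>(A \<odot> I)\<^sup>1\<^sup>/\<^sup>2\<close>. As \<open>A \<odot> I\<close> is diagonal, its square root is taken entrywise.
\<close>

definition scale_mat :: "real mat \<Rightarrow> real mat" where
  "scale_mat A = map_mat sqrt (hadamard_mat A (1\<^sub>m (dim_row A)))"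

text \<open>The solution \<open>R\<close> of \<open>A = \<omega> R \<omega>\<close> with \<open>\<omega> = scale_mat A\<close>.\<close>

definition corr_of_mat :: "real mat \<Rightarrow> real mat" where
  "corr_of_mat A = minv (scale_mat A) * A * minv (scale_mat A)"

definition pos_def_mat :: "nat \<Rightarrow> real mat \<Rightarrow> bool" where
  "pos_def_mat m A \<longleftrightarrow>
     A \<in> carrier_mat m m \<and> transpose_mat A = A \<and>
     (\<forall>v \<in> carrier_vec m. v \<noteq> 0\<^sub>v m \<longrightarrow> v \<bullet> (A *\<^sub>v v) > 0)"

text \<open>Correlation matrices are taken to be nonsingular, as needed for a Gaussian density.\<close>

definition correlation_mat :: "nat \<Rightarrow> real mat \<Rightarrow> bool" where
  "correlation_mat m R \<longleftrightarrow> pos_def_mat m R \<and> (\<forall>i<m. R $$ (i, i) = 1)"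


subsection \<open>Gaussian and unified skew-normal distributions\<close>

text \<open>Lebesgue measure on the Borel sets of \<open>carrier_vec m\<close>, transported from the product space.\<close>

definition lborel_vec :: "nat \<Rightarrow> real vec measure" where
  "lborel_vec m = embed_measure (\<Pi>\<^sub>M i\<in>{..<m}. lborel) (vec m)"

definition mvn_pdf :: "nat \<Rightarrow> real mat \<Rightarrow> real vec \<Rightarrow> real" where
  "mvn_pdf m W z = exp (- (z \<bullet> (minv W *\<^sub>v z)) / 2) / sqrt ((2 * pi) ^ m * det W)"

definition mvn_cdf :: "nat \<Rightarrow> real mat \<Rightarrow> real vec \<Rightarrow> real" where
  "mvn_cdf m W u =
     measure (density (lborel_vec m) (\<lambda>z. ennreal (mvn_pdf m W z)))
       {z \<in> carrier_vec m. \<forall>i<m. z $ i \<le> u $ i}"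

definition sun_pdf ::
  "nat \<Rightarrow> nat \<Rightarrow> real vec \<Rightarrow> real mat \<Rightarrow> real mat \<Rightarrow> real vec \<Rightarrow> real mat \<Rightarrow> real vec \<Rightarrow> real" where
  "sun_pdf q h \<xi> \<Omega> \<Delta> \<gamma> \<Gamma> b =
     mvn_pdf q \<Omega> (b - \<xi>) *
     mvn_cdf h (\<Gamma> - transpose_mat \<Delta> * minv (corr_of_mat \<Omega>) * \<Delta>)
       (\<gamma> + (transpose_mat \<Delta> * minv (corr_of_mat \<Omega>) * minv (scale_mat \<Omega>)) *\<^sub>v (b - \<xi>)) /
     mvn_cdf h \<Gamma> \<gamma>"

definition normal_distributed ::
  "'a measure \<Rightarrow> nat \<Rightarrow> ('a \<Rightarrow> real vec) \<Rightarrow> real mat \<Rightarrow> bool" where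
  "normal_distributed M m X W \<longleftrightarrow> distributed M (lborel_vec m) X (\<lambda>z. ennreal (mvn_pdf m W z))"

definition sun_distributed ::
  "'a measure \<Rightarrow> nat \<Rightarrow> nat \<Rightarrow> ('a \<Rightarrow> real vec) \<Rightarrow>
   real vec \<Rightarrow> real mat \<Rightarrow> real mat \<Rightarrow> real vec \<Rightarrow> real mat \<Rightarrow> bool" where
  "sun_distributed M q h X \<xi> \<Omega> \<Delta> \<gamma> \<Gamma> \<longleftrightarrow>
     distributed M (lborel_vec q) X (\<lambda>b. ennreal (sun_pdf q h \<xi> \<Omega> \<Delta> \<gamma> \<Gamma> b))"


subsection \<open>The multinomial probit model\<close>

text \<open>
  \<open>P(A | X)\<close> as a random variable on \<open>M\<close>: the sigma-algebra conditioned on is generated by \<open>X\<close>.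
\<close>

definition cprob_given :: "'a measure \<Rightarrow> nat \<Rightarrow> ('a \<Rightarrow> real vec) \<Rightarrow> 'a set \<Rightarrow> 'a \<Rightarrow> real" where
  "cprob_given M m X A =
     real_cond_exp M (vimage_algebra (space M) X (lborel_vec m)) (indicator A)"

text \<open>The block of \<open>b\<close> for category \<open>l\<close>, which is zero for the reference category.\<close>

definition coef_block :: "nat \<Rightarrow> nat \<Rightarrow> real vec \<Rightarrow> nat \<Rightarrow> real vec" where
  "coef_block p L b l = (if l < L - 1 then vec p (\<lambda>j. b $ (l * p + j)) else 0\<^sub>v p)"

definition utility :: "nat \<Rightarrow> nat \<Rightarrow> real vec \<Rightarrow> real vec \<Rightarrow> real vec \<Rightarrow> nat \<Rightarrow> real" where
  "utility p L x b e l = x \<bullet> coef_block p L b l + e $ l"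

definition V_mat :: "nat \<Rightarrow> nat \<Rightarrow> real mat" where
  "V_mat L l =
     mat_of_rows L (map (\<lambda>k. unit_vec L k - unit_vec L l) (filter (\<lambda>k. k \<noteq> l) [0..<L]))"

definition Vbar_mat :: "nat \<Rightarrow> nat \<Rightarrow> real mat" where
  "Vbar_mat L l = mat (L - 1) (L - 1) (\<lambda>(r, c). V_mat L l $$ (r, c))"

definition X_block :: "nat \<Rightarrow> real vec \<Rightarrow> nat \<Rightarrow> real mat" where
  "X_block L x l = kronecker_mat (- Vbar_mat L l) (mat_of_rows (dim_vec x) [x])"

definition Xbar_mat :: "nat \<Rightarrow> nat \<Rightarrow> nat \<Rightarrow> (nat \<Rightarrow> real vec) \<Rightarrow> (nat \<Rightarrow> nat) \<Rightarrow> real mat" where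
  "Xbar_mat n p L x y =
     mat_of_rows (p * (L - 1)) (concat (map (\<lambda>i. rows (X_block L (x i) (y i))) [0..<n]))"

definition Lambda_mat :: "nat \<Rightarrow> nat \<Rightarrow> real mat \<Rightarrow> (nat \<Rightarrow> nat) \<Rightarrow> real mat" where
  "Lambda_mat n L \<Sigma> y =
     diag_block_mat (map (\<lambda>i. V_mat L (y i) * \<Sigma> * transpose_mat (V_mat L (y i))) [0..<n])"

end

theory Submission
  imports Defs
begin

text \<open>
  Category \<open>l\<close> has the largest utility iff \<open>V_mat L l \<epsilon> < X_block L x l \<beta>\<close> componentwise. Given \<open>\<beta>\<close>, the
  probability of the observed responses is therefore a product of Gaussian distribution functions, which
  merge into \<open>\<Phi>\<^sub>h(Xb \<beta>; \<Lambda>)\<close> as \<open>\<Lambda>\<close> is block diagonal, and the posterior density is proportional to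
  \<open>\<phi>\<^sub>q(\<beta>; \<nu>\<^sup>2 I) \<Phi>\<^sub>h(Xb \<beta>; \<Lambda>)\<close>. With \<open>z \<sim> N(0, \<Lambda>)\<close> independent of \<open>\<beta>\<close>, its total mass is the probability
  of \<open>z - Xb \<beta> \<le> 0\<close>, that is \<open>\<Phi>\<^sub>h(0; \<nu>\<^sup>2 Xb Xb\<^sup>T + \<Lambda>)\<close>. Rescaling by \<open>s\<^sup>-\<^sup>1\<close> gives the SUN form. These
  steps rest on the fact that surjective linear images of Gaussian vectors are Gaussian, which holds because
  a complementary linear map can be chosen whose image is uncorrelated with the given one.
\<close>

subsection \<open>Positive definite matrices\<close>

text \<open>Linear changes of variables are carried out without Jacobian determinants.
  \<open>lborel_vec\<close> is characterized by its values on boxes, which yields its behaviour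
  under translation, reflection and concatenation; the constants that a linear substitution leaves
  open are then fixed by comparing total masses. This presupposes that Gaussian densities integrate
  to 1 in every dimension, which needs an argument of its own, by induction on the dimension.

  Conditional probabilities given the coefficients are random variables determined only almost
  everywhere, so no pointwise likelihood is given by the model. An explicit function of the
  coefficients is shown to be a version of the conditional probability of the observed responses,
  and is integrated against the prior. The total mass so obtained is the probability of these
  responses; it is positive, so the posterior is elementary conditioning on one event, expressed by
  \<open>uniform_measure\<close>.\<close>

lemma minv_eqI:
  assumes "A \<in> carrier_mat n n" "B \<in> carrier_mat n n" "A * B = 1\<^sub>m n"
  shows "minv A = B"
proof -
  have BA: "B * A = 1\<^sub>m n"
    using mat_mult_left_right_inverse[OF assms] .
  show ?thesis
  proof (cases "mat_inverse A")
    case None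
    then have "A \<notin> Units (ring_mat TYPE(real) n ())"
      by (rule mat_inverse(1)[OF assms(1)])
    with assms BA show ?thesis by (auto simp: Units_def ring_mat_def)
  next
    case (Some C)
    then have C: "C * A = 1\<^sub>m n" "C \<in> carrier_mat n n"
      using mat_inverse(2)[OF assms(1)] by auto
    have "C = B" using assoc_mult_mat[OF C(2) assms(1,2)] assms C by simp
    then show ?thesis using Some by (simp add: minv_def)
  qed
qed

text \<open>A trivial kernel is the criterion for invertibility that positive definite matrices and
  the coordinate change \<open>J\<close> of \<open>distr_mvn_mult_mat\<close> satisfy most
  directly.\<close>

lemma minv_inverse:
  assumes A: "A \<in> carrier_mat n n"
    and inj: "\<And>v. v \<in> carrier_vec n \<Longrightarrow> A *\<^sub>v v = 0\<^sub>v n \<Longrightarrow> v = 0\<^sub>v n"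
  shows "minv A \<in> carrier_mat n n" "A * minv A = 1\<^sub>m n" "minv A * A = 1\<^sub>m n"
proof -
  have "det A \<noteq> 0"
    using det_0_iff_vec_prod_zero[OF A] inj by auto
  from det_non_zero_imp_unit[OF A this, of "()"]
  obtain B where B: "B \<in> carrier_mat n n" "A * B = 1\<^sub>m n" "B * A = 1\<^sub>m n"
    by (auto simp: Units_def ring_mat_def)
  with minv_eqI[OF A B(1,2)] show "minv A \<in> carrier_mat n n" "A * minv A = 1\<^sub>m n" "minv A * A = 1\<^sub>m n"
    by auto
qed

lemma mult_mat_zero_vec:
  fixes A :: "real mat"
  assumes "A \<in> carrier_mat n m"
  shows "A *\<^sub>v 0\<^sub>v m = 0\<^sub>v n"
  using assms by (intro eq_vecI) auto

lemma zero_mat_mult_vec: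
  fixes v :: "real vec"
  assumes "v \<in> carrier_vec m"
  shows "0\<^sub>m n m *\<^sub>v v = 0\<^sub>v n"
  using assms by (intro eq_vecI) auto

lemma transpose_mat_smult: "transpose_mat (c \<cdot>\<^sub>m A) = c \<cdot>\<^sub>m transpose_mat A"
  by (intro eq_matI) auto

lemma smult_mat_mult_vec:
  fixes v :: "real vec"
  assumes "A \<in> carrier_mat n m" "v \<in> carrier_vec m"
  shows "(c \<cdot>\<^sub>m A) *\<^sub>v v = c \<cdot>\<^sub>v (A *\<^sub>v v)"
  using assms by (intro eq_vecI) auto

lemma mult_mat_uminus_vec:
  fixes v :: "real vec"
  assumes "A \<in> carrier_mat n m" "v \<in> carrier_vec m"
  shows "A *\<^sub>v (- v) = - (A *\<^sub>v v)"
  using assms by (intro eq_vecI) auto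

lemma pos_def_carrier: "pos_def_mat m A \<Longrightarrow> A \<in> carrier_mat m m"
  by (simp add: pos_def_mat_def)

lemma pos_def_symmetric: "pos_def_mat m A \<Longrightarrow> transpose_mat A = A"
  by (simp add: pos_def_mat_def)

lemma pos_def_minv:
  assumes "pos_def_mat m A"
  shows "minv A \<in> carrier_mat m m" "A * minv A = 1\<^sub>m m" "minv A * A = 1\<^sub>m m"
proof -
  have "v = 0\<^sub>v m" if v: "v \<in> carrier_vec m" and "A *\<^sub>v v = 0\<^sub>v m" for v
  proof (rule ccontr)
    assume "v \<noteq> 0\<^sub>v m"
    with assms v have "v \<bullet> (A *\<^sub>v v) > 0" by (auto simp: pos_def_mat_def)
    with that show False by simp
  qed
  with minv_inverse[OF pos_def_carrier[OF assms]]
  show "minv A \<in> carrier_mat m m" "A * minv A = 1\<^sub>m m" "minv A * A = 1\<^sub>m m"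
    by blast+
qed

lemma scalar_prod_mult_mat_vec:
  fixes A :: "real mat"
  assumes "A \<in> carrier_mat n m" "u \<in> carrier_vec n" "v \<in> carrier_vec m"
  shows "u \<bullet> (A *\<^sub>v v) = (transpose_mat A *\<^sub>v u) \<bullet> v"
  using assms transpose_vec_mult_scalar[of A n m v u] by simp

text \<open>The quadratic form at \<open>v\<close> is that of \<open>W\<close> at
  \<open>transpose_mat A *\<^sub>v v\<close>; injectivity of the transpose, that is, surjectivity of
  \<open>A\<close>, keeps this vector nonzero.\<close>

lemma pos_def_congruence:
  assumes W: "pos_def_mat m W" and A: "A \<in> carrier_mat k m"
    and inj: "\<And>v. v \<in> carrier_vec k \<Longrightarrow> transpose_mat A *\<^sub>v v = 0\<^sub>v m \<Longrightarrow> v = 0\<^sub>v k"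
  shows "pos_def_mat k (A * W * transpose_mat A)"
  unfolding pos_def_mat_def
proof (intro conjI ballI impI)
  note Wc = pos_def_carrier[OF W]
  show "A * W * transpose_mat A \<in> carrier_mat k k" using A Wc by auto
  show "transpose_mat (A * W * transpose_mat A) = A * W * transpose_mat A"
    using A Wc pos_def_symmetric[OF W] transpose_mult[of "A * W" k m "transpose_mat A" k]
      transpose_mult[OF A Wc] assoc_mult_mat[of A k m W m "transpose_mat A" k] by simp
  fix v :: "real vec" assume v: "v \<in> carrier_vec k" "v \<noteq> 0\<^sub>v k"
  define w where "w = transpose_mat A *\<^sub>v v"
  have w: "w \<in> carrier_vec m" "w \<noteq> 0\<^sub>v m" using v inj A by (auto simp: w_def)
  have "v \<bullet> (A * W * transpose_mat A *\<^sub>v v) = v \<bullet> (A *\<^sub>v (W *\<^sub>v w))"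
    using A Wc v by (simp add: w_def assoc_mult_mat_vec[of _ k m _ k] assoc_mult_mat_vec[of _ k m _ m])
  also have "\<dots> = w \<bullet> (W *\<^sub>v w)"
    using A Wc v w(1) by (simp add: w_def[symmetric] scalar_prod_mult_mat_vec[of _ k m])
  also have "\<dots> > 0" using W w by (auto simp: pos_def_mat_def)
  finally show "v \<bullet> (A * W * transpose_mat A *\<^sub>v v) > 0" .
qed

text \<open>Congruence of \<open>W\<close> by its own inverse:
  \<open>minv W = minv W * W * minv W\<close>, once \<open>minv W\<close> is known to be
  symmetric.\<close>

lemma pos_def_minv_pos_def:
  assumes W: "pos_def_mat m W"
  shows "pos_def_mat m (minv W)"
proof -
  note Wc = pos_def_carrier[OF W] and Wi = pos_def_minv[OF W]
  have t: "transpose_mat (minv W) = minv W"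
    using minv_eqI[OF Wc, of "transpose_mat (minv W)"] Wi Wc pos_def_symmetric[OF W]
      transpose_mult[of "minv W" m m W m] by simp
  have "v = 0\<^sub>v m" if v: "v \<in> carrier_vec m" "minv W *\<^sub>v v = 0\<^sub>v m" for v
  proof -
    have "v = (W * minv W) *\<^sub>v v" using Wi v by simp
    also have "\<dots> = W *\<^sub>v 0\<^sub>v m" using assoc_mult_mat_vec[OF Wc Wi(1) v(1)] v(2) by simp
    finally show ?thesis using mult_mat_zero_vec[OF Wc] by simp
  qed
  with pos_def_congruence[OF W Wi(1)] t have "pos_def_mat m (minv W * W * minv W)" by auto
  then show ?thesis using Wi by simp
qed

lemma pos_def_four_block:
  assumes D: "pos_def_mat k D" and E: "pos_def_mat r E"
  shows "pos_def_mat (k + r) (four_block_mat D (0\<^sub>m k r) (0\<^sub>m r k) E)"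
  unfolding pos_def_mat_def
proof (intro conjI ballI impI)
  note Dc = pos_def_carrier[OF D] and Ec = pos_def_carrier[OF E]
  let ?F = "four_block_mat D (0\<^sub>m k r) (0\<^sub>m r k) E"
  show "?F \<in> carrier_mat (k + r) (k + r)" using Dc Ec by simp
  show "transpose_mat ?F = ?F"
    using Dc Ec transpose_four_block_mat[OF Dc zero_carrier_mat zero_carrier_mat Ec]
    by (simp add: pos_def_symmetric[OF D] pos_def_symmetric[OF E] zero_transpose_mat)
  fix v :: "real vec" assume v: "v \<in> carrier_vec (k + r)" "v \<noteq> 0\<^sub>v (k + r)"
  define a b where "a = vec_first v k" and "b = vec_last v r"
  have ab: "v = a @\<^sub>v b" "a \<in> carrier_vec k" "b \<in> carrier_vec r"
    using v by (auto simp: a_def b_def)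
  have "v \<bullet> (?F *\<^sub>v v) = a \<bullet> (D *\<^sub>v a) + b \<bullet> (E *\<^sub>v b)"
    unfolding ab(1) using ab(2,3) Dc Ec
    by (simp add: zero_mat_mult_vec four_block_mat_mult_vec[OF Dc zero_carrier_mat zero_carrier_mat Ec] scalar_prod_append[of _ k _ r])
  moreover have "a \<noteq> 0\<^sub>v k \<or> b \<noteq> 0\<^sub>v r" using v(2) ab by (auto simp: )
  moreover have "a \<bullet> (D *\<^sub>v a) \<ge> 0" "a \<noteq> 0\<^sub>v k \<Longrightarrow> a \<bullet> (D *\<^sub>v a) > 0"
    using D ab Dc by (cases "a = 0\<^sub>v k"; force simp: pos_def_mat_def less_imp_le)+
  moreover have "b \<bullet> (E *\<^sub>v b) \<ge> 0" "b \<noteq> 0\<^sub>v r \<Longrightarrow> b \<bullet> (E *\<^sub>v b) > 0"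
    using E ab Ec by (cases "b = 0\<^sub>v r"; force simp: pos_def_mat_def less_imp_le)+
  ultimately show "v \<bullet> (?F *\<^sub>v v) > 0" by auto
qed

lemma minv_four_block:
  assumes D: "D \<in> carrier_mat k k" "D' \<in> carrier_mat k k" "D * D' = 1\<^sub>m k"
    and E: "E \<in> carrier_mat r r" "E' \<in> carrier_mat r r" "E * E' = 1\<^sub>m r"
  shows "minv (four_block_mat D (0\<^sub>m k r) (0\<^sub>m r k) E) = four_block_mat D' (0\<^sub>m k r) (0\<^sub>m r k) E'"
proof (rule minv_eqI[of _ "k + r"])
  show "four_block_mat D (0\<^sub>m k r) (0\<^sub>m r k) E * four_block_mat D' (0\<^sub>m k r) (0\<^sub>m r k) E' = 1\<^sub>m (k + r)"
    using assms
    by (simp add: mult_four_block_mat[OF D(1) zero_carrier_mat zero_carrier_mat E(1) D(2) zero_carrier_mat zero_carrier_mat E(2)]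
       left_add_zero_mat[of _ k k] right_add_zero_mat[of _ k k])
qed (use assms in auto)

lemma det_four_block_diag:
  fixes D E :: "real mat"
  assumes D: "D \<in> carrier_mat k k" and E: "E \<in> carrier_mat r r"
  shows "det (four_block_mat D (0\<^sub>m k r) (0\<^sub>m r k) E) = det D * det E"
  using assms by (intro det_four_block_mat_lower_left_zero) auto

lemma scalar_prod_self_pos:
  fixes v :: "real vec"
  assumes "v \<in> carrier_vec n" "v \<noteq> 0\<^sub>v n"
  shows "v \<bullet> v > 0"
proof -
  obtain i where i: "i < n" "v $ i \<noteq> 0" using assms by (metis eq_vecI carrier_vecD index_zero_vec)
  have "0 < (\<Sum>i<n. v $ i * v $ i)" using i by (intro sum_pos2[of _ i]) (auto simp: zero_less_mult_iff)
  then show ?thesis using assms by (simp add: scalar_prod_def atLeast0LessThan)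
qed

lemma pos_def_one: "pos_def_mat n (1\<^sub>m n)"
  by (auto simp: pos_def_mat_def scalar_prod_self_pos)

lemma pos_def_smult:
  assumes "c > 0" "pos_def_mat n A"
  shows "pos_def_mat n (c \<cdot>\<^sub>m A)"
  unfolding pos_def_mat_def
proof (intro conjI ballI impI)
  show "c \<cdot>\<^sub>m A \<in> carrier_mat n n" "transpose_mat (c \<cdot>\<^sub>m A) = c \<cdot>\<^sub>m A"
    using assms by (auto simp: pos_def_mat_def transpose_mat_smult)
  fix v :: "real vec" assume v: "v \<in> carrier_vec n" "v \<noteq> 0\<^sub>v n"
  have "v \<bullet> ((c \<cdot>\<^sub>m A) *\<^sub>v v) = c * (v \<bullet> (A *\<^sub>v v))"
    using assms v by (auto simp: pos_def_mat_def smult_mat_mult_vec scalar_prod_smult_distrib[of _ n])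
  also have "\<dots> > 0" using assms v by (auto simp: pos_def_mat_def)
  finally show "v \<bullet> ((c \<cdot>\<^sub>m A) *\<^sub>v v) > 0" .
qed

text \<open>
  Writing \<open>z\<close> in the coordinates \<open>u = A z\<close> and \<open>t\<close> along \<open>ker A\<close> decorrelates the quadratic form.
\<close>

lemma quadratic_form_split:
  fixes u t :: "real vec"
  assumes W: "pos_def_mat m W" and A: "A \<in> carrier_mat k m" and N: "N \<in> carrier_mat m r"
    and AN: "A * N = 0\<^sub>m k r" and D: "pos_def_mat k (A * W * transpose_mat A)"
    and u: "u \<in> carrier_vec k" and t: "t \<in> carrier_vec r"
  defines "z \<equiv> (W * transpose_mat A * minv (A * W * transpose_mat A)) *\<^sub>v u + N *\<^sub>v t"
  shows "A *\<^sub>v z = u"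
    and "z \<bullet> (minv W *\<^sub>v z) =
      u \<bullet> (minv (A * W * transpose_mat A) *\<^sub>v u) + t \<bullet> ((transpose_mat N * minv W * N) *\<^sub>v t)"
proof -
  let ?D = "A * W * transpose_mat A"
  note Wc = pos_def_carrier[OF W] and Wi = pos_def_minv[OF W] and Di = pos_def_minv[OF D]
  have Dc: "?D \<in> carrier_mat k k" using A Wc by simp
  define a where "a = minv ?D *\<^sub>v u"
  define g where "g = transpose_mat A *\<^sub>v a"
  define w where "w = N *\<^sub>v t"
  have a: "a \<in> carrier_vec k" using Di u by (auto simp: a_def)
  have g: "g \<in> carrier_vec m" using A a by (auto simp: g_def)
  have w: "w \<in> carrier_vec m" using N t by (auto simp: w_def)
  have Wg: "W *\<^sub>v g \<in> carrier_vec m" using Wc g by auto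
  have z: "z = W *\<^sub>v g + w"
    using A Wc Di u by (simp add: z_def g_def a_def w_def assoc_mult_mat_vec[of _ m k _ k] assoc_mult_mat_vec[of _ m m _ k])
  have "?D *\<^sub>v a = u"
    using assoc_mult_mat_vec[OF Dc Di(1) u] Di u by (simp add: a_def)
  moreover have "?D *\<^sub>v a = A *\<^sub>v (W *\<^sub>v g)"
    using A Wc a by (simp add: g_def assoc_mult_mat_vec[of _ k m _ k] assoc_mult_mat_vec[of _ k m _ m])
  ultimately have AWg: "A *\<^sub>v (W *\<^sub>v g) = u" by simp
  have Aw: "A *\<^sub>v w = 0\<^sub>v k"
    using assoc_mult_mat_vec[OF A N t] AN t zero_mat_mult_vec[OF t] by (simp add: w_def)
  show "A *\<^sub>v z = u"
    using A Wg w u by (simp add: z mult_add_distrib_mat_vec[of _ k m] AWg Aw)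
  have Wiz: "minv W *\<^sub>v z = g + minv W *\<^sub>v w"
    using assoc_mult_mat_vec[OF Wi(1) Wc g] Wi Wg w g by (simp add: z mult_add_distrib_mat_vec[of _ m m])
  have gy: "g \<bullet> y = a \<bullet> (A *\<^sub>v y)" if "y \<in> carrier_vec m" for y
    using scalar_prod_mult_mat_vec[OF A a that] by (simp add: g_def)
  have c: "minv W *\<^sub>v w \<in> carrier_vec m" using Wi w by auto
  \<comment> \<open>\<open>g\<close> lies in the range of \<open>transpose_mat A\<close> and
    \<open>w\<close> in the kernel of \<open>A\<close>, which makes them orthogonal; both cross
    terms of the expansion below equal this product.\<close>
  have gw: "g \<bullet> w = 0" using gy[OF w] Aw a by simp
  have "z \<bullet> (minv W *\<^sub>v z) = g \<bullet> (W *\<^sub>v g) + g \<bullet> w + (W *\<^sub>v g) \<bullet> (minv W *\<^sub>v w) + w \<bullet> (minv W *\<^sub>v w)"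
    unfolding Wiz unfolding z
    using Wg w g c add_scalar_prod_distrib[OF Wg w, of "g + minv W *\<^sub>v w"]
      scalar_prod_add_distrib[OF Wg g c] scalar_prod_add_distrib[OF w g c]
      comm_scalar_prod[OF Wg g] comm_scalar_prod[OF w g] by simp
  also have "g \<bullet> (W *\<^sub>v g) = u \<bullet> a" using gy[OF Wg] AWg a u by (simp add: comm_scalar_prod[of _ k])
  also have "(W *\<^sub>v g) \<bullet> (minv W *\<^sub>v w) = g \<bullet> (W *\<^sub>v (minv W *\<^sub>v w))"
    using scalar_prod_mult_mat_vec[OF Wc g c] pos_def_symmetric[OF W] by simp
  also have "W *\<^sub>v (minv W *\<^sub>v w) = w" using assoc_mult_mat_vec[OF Wc Wi(1) w] Wi w by simp
  also have "w \<bullet> (minv W *\<^sub>v w) = t \<bullet> ((transpose_mat N * minv W * N) *\<^sub>v t)"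
    using N Wi t c scalar_prod_mult_mat_vec[of "transpose_mat N" r m t "minv W *\<^sub>v w"]
    by (simp add: w_def assoc_mult_mat_vec[of _ r m _ r] assoc_mult_mat_vec[of _ r m _ m])
  finally show "z \<bullet> (minv W *\<^sub>v z) =
      u \<bullet> (minv ?D *\<^sub>v u) + t \<bullet> ((transpose_mat N * minv W * N) *\<^sub>v t)"
    by (simp add: a_def gw)
qed

text \<open>With no rows in the lower blocks, \<open>four_block_mat\<close> is the horizontal
  concatenation of \<open>B\<close> and \<open>N\<close>, the form in which \<open>J\<close> is
  built in \<open>distr_mvn_mult_mat\<close>.\<close>

lemma four_block_mult_append:
  fixes B N :: "real mat"
  assumes "B \<in> carrier_mat m k" "N \<in> carrier_mat m r" "u \<in> carrier_vec k" "t \<in> carrier_vec r"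
  shows "four_block_mat B N (0\<^sub>m 0 k) (0\<^sub>m 0 r) *\<^sub>v (u @\<^sub>v t) = B *\<^sub>v u + N *\<^sub>v t"
  using four_block_mat_mult_vec[OF assms(1,2) zero_carrier_mat zero_carrier_mat assms(3,4), of 0] assms
  by (simp, intro eq_vecI) auto

text \<open>Unit vectors recover the entries. This serves the block matrices of
  \<open>mvn_cdf_marginalize\<close>, whose action on vectors is easier to compute than their
  entries.\<close>

lemma mat_eq_mult_vecI:
  fixes A B :: "real mat"
  assumes A: "A \<in> carrier_mat n m" and B: "B \<in> carrier_mat n m"
    and eq: "\<And>v. v \<in> carrier_vec m \<Longrightarrow> A *\<^sub>v v = B *\<^sub>v v"
  shows "A = B"
proof (rule eq_matI)
  fix i j assume "i < dim_row B" "j < dim_col B"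
  then have ij: "i < n" "j < m" using B by auto
  have "(A *\<^sub>v unit_vec m j) $ i = (B *\<^sub>v unit_vec m j) $ i" using eq[of "unit_vec m j"] by simp
  moreover have "(C *\<^sub>v unit_vec m j) $ i = C $$ (i, j)" if "C \<in> carrier_mat n m" for C :: "real mat"
  proof -
    have "(C *\<^sub>v unit_vec m j) $ i = row C i \<bullet> unit_vec m j" using that ij by simp
    also have "\<dots> = row C i $ j" using that ij by (intro scalar_prod_right_unit) auto
    finally show ?thesis using that ij by simp
  qed
  ultimately show "A $$ (i, j) = B $$ (i, j)" using A B by simp
qed (use A B in auto)

lemma transpose_append_rows_mult_vec:
  fixes P Q :: "real mat"
  assumes P: "P \<in> carrier_mat k n" and Q: "Q \<in> carrier_mat r n" and u: "u \<in> carrier_vec k" and t: "t \<in> carrier_vec r"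
  shows "transpose_mat (P @\<^sub>r Q) *\<^sub>v (u @\<^sub>v t) = transpose_mat P *\<^sub>v u + transpose_mat Q *\<^sub>v t"
proof (rule eq_vecI)
  fix i assume "i < dim_vec (transpose_mat P *\<^sub>v u + transpose_mat Q *\<^sub>v t)"
  then have i: "i < n" using Q by simp
  have "col (P @\<^sub>r Q) i = col P i @\<^sub>v col Q i"
    using i P Q by (intro eq_vecI) (auto simp: append_rows_def)
  then show "(transpose_mat (P @\<^sub>r Q) *\<^sub>v (u @\<^sub>v t)) $ i = (transpose_mat P *\<^sub>v u + transpose_mat Q *\<^sub>v t) $ i"
    using i P Q u t scalar_prod_append[of "col P i" k "col Q i" r u t]
      carrier_matD[OF carrier_append_rows[OF P Q]] by simp
qed (use Q carrier_matD[OF carrier_append_rows[OF P Q]] in auto)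

lemma minv_minv:
  assumes "pos_def_mat m W"
  shows "minv (minv W) = W"
  using pos_def_minv[OF assms] pos_def_carrier[OF assms] by (intro minv_eqI) auto

subsection \<open>Diagonal matrices\<close>

text \<open>The diagonal is a function of the index, so that \<open>scale_mat\<close> and its
  inverse arise by taking \<open>sqrt\<close> and the reciprocal pointwise.\<close>

definition diag_of :: "nat \<Rightarrow> (nat \<Rightarrow> real) \<Rightarrow> real mat" where
  "diag_of n r = mat n n (\<lambda>(i, j). if i = j then r i else 0)"

lemma diag_of_carrier [simp]: "diag_of n r \<in> carrier_mat n n"
  and dim_diag_of [simp]: "dim_row (diag_of n r) = n" "dim_col (diag_of n r) = n"
  by (simp_all add: diag_of_def)

lemma transpose_diag_of [simp]: "transpose_mat (diag_of n r) = diag_of n r"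
  by (intro eq_matI) (auto simp: diag_of_def)

lemma diag_of_mult_vec:
  assumes "v \<in> carrier_vec n" "i < n"
  shows "(diag_of n r *\<^sub>v v) $ i = r i * v $ i"
proof -
  have "(diag_of n r *\<^sub>v v) $ i = (\<Sum>j\<in>{0..<n}. (if i = j then r i else 0) * v $ j)"
    using assms by (simp add: diag_of_def scalar_prod_def)
  also have "\<dots> = (\<Sum>j\<in>{0..<n}. if i = j then r i * v $ j else 0)"
    by (intro sum.cong) auto
  finally show ?thesis using assms by simp
qed

lemma diag_of_mult_left:
  assumes "A \<in> carrier_mat n m" "i < n" "j < m"
  shows "(diag_of n r * A) $$ (i, j) = r i * A $$ (i, j)"
proof -
  have "(diag_of n r * A) $$ (i, j) = (diag_of n r *\<^sub>v col A j) $ i"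
    using assms by simp
  also have "\<dots> = r i * A $$ (i, j)"
    using assms by (subst diag_of_mult_vec) auto
  finally show ?thesis .
qed

lemma diag_of_mult_right:
  assumes "A \<in> carrier_mat n m" "i < n" "j < m"
  shows "(A * diag_of m r) $$ (i, j) = A $$ (i, j) * r j"
proof -
  have "(A * diag_of m r) $$ (i, j) = transpose_mat (A * diag_of m r) $$ (j, i)"
    using assms by (simp add: diag_of_def)
  also have "transpose_mat (A * diag_of m r) = diag_of m r * transpose_mat A"
    using transpose_mult[OF assms(1) diag_of_carrier] by simp
  also have "(diag_of m r * transpose_mat A) $$ (j, i) = r j * transpose_mat A $$ (j, i)"
    by (rule diag_of_mult_left[OF _ assms(3,2)]) (use assms in simp)
  finally show ?thesis using assms by simp
qed

lemma diag_of_inverse: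
  assumes "\<And>i. i < n \<Longrightarrow> r i \<noteq> 0"
  shows "diag_of n r * diag_of n (\<lambda>i. 1 / r i) = 1\<^sub>m n"
    and "minv (diag_of n r) = diag_of n (\<lambda>i. 1 / r i)"
proof -
  show *: "diag_of n r * diag_of n (\<lambda>i. 1 / r i) = 1\<^sub>m n"
  proof (rule eq_matI)
    fix i j assume "i < dim_row (1\<^sub>m n :: real mat)" "j < dim_col (1\<^sub>m n :: real mat)"
    then have ij: "i < n" "j < n" by auto
    have "(diag_of n r * diag_of n (\<lambda>i. 1 / r i)) $$ (i, j) = r i * diag_of n (\<lambda>i. 1 / r i) $$ (i, j)"
      using ij by (rule diag_of_mult_left[OF diag_of_carrier])
    then show "(diag_of n r * diag_of n (\<lambda>i. 1 / r i)) $$ (i, j) = 1\<^sub>m n $$ (i, j)"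
      using assms ij by (simp add: diag_of_def)
  qed (simp_all add: diag_of_def)
  show "minv (diag_of n r) = diag_of n (\<lambda>i. 1 / r i)"
    by (rule minv_eqI[OF diag_of_carrier diag_of_carrier *])
qed

lemma scale_mat_eq_diag_of:
  assumes "A \<in> carrier_mat n n"
  shows "scale_mat A = diag_of n (\<lambda>i. sqrt (A $$ (i, i)))"
  using assms by (intro eq_matI) (auto simp: scale_mat_def hadamard_mat_def diag_of_def)

lemma diag_of_mult_vec_inj:
  assumes "\<And>i. i < n \<Longrightarrow> r i \<noteq> 0" "v \<in> carrier_vec n" "diag_of n r *\<^sub>v v = 0\<^sub>v n"
  shows "v = 0\<^sub>v n"
proof (rule eq_vecI)
  fix i assume "i < dim_vec (0\<^sub>v n :: real vec)"
  then have i: "i < n" by simp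
  have "r i * v $ i = (0\<^sub>v n) $ i" using diag_of_mult_vec[OF assms(2) i, of r] by (simp only: assms(3))
  then show "v $ i = 0\<^sub>v n $ i" using i assms(1) by simp
qed (use assms(2) in simp)

subsection \<open>Lebesgue measure on vectors\<close>

text \<open>Elements of the product space are extensional, hence equal as soon as they agree below
  \<open>m\<close>; on all functions \<open>vec m\<close> would not be injective.\<close>

lemma inj_on_vec_space_PiM: "inj_on (vec m) (space (\<Pi>\<^sub>M i\<in>{..<m}. (lborel :: real measure)))"
proof (rule inj_onI)
  fix f g :: "nat \<Rightarrow> real"
  assume fg: "f \<in> space (\<Pi>\<^sub>M i\<in>{..<m}. lborel)" "g \<in> space (\<Pi>\<^sub>M i\<in>{..<m}. lborel)" "vec m f = vec m g"
  show "f = g"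
  proof
    fix i show "f i = g i"
    proof (cases "i < m")
      case True
      with fg(3) show ?thesis by (metis index_vec)
    qed (use fg in \<open>auto simp: space_PiM PiE_def extensional_def\<close>)
  qed
qed

lemma space_lborel_vec [simp]: "space (lborel_vec m) = carrier_vec m"
proof -
  have "v \<in> vec m ` (\<Pi>\<^sub>E i\<in>{..<m}. UNIV)" if "v \<in> carrier_vec m" for v :: "real vec"
    using that by (intro image_eqI[of _ _ "restrict (($) v) {..<m}"]) auto
  then show ?thesis by (auto simp: lborel_vec_def space_embed_measure space_PiM)
qed

lemma measurable_vec_index:
  assumes "i < m"
  shows "(\<lambda>v. v $ i) \<in> borel_measurable (lborel_vec m)"
  unfolding lborel_vec_def
proof (rule measurable_embed_measure1)
  have "(\<lambda>x. x i) \<in> borel_measurable (\<Pi>\<^sub>M i\<in>{..<m}. (lborel :: real measure))"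
    using assms measurable_component_singleton[of i "{..<m}" "\<lambda>_. lborel"] by simp
  then show "(\<lambda>x. vec m x $ i) \<in> borel_measurable (\<Pi>\<^sub>M i\<in>{..<m}. lborel)"
    using assms by simp
qed

lemma measurable_vec_PiM: "vec m \<in> measurable (\<Pi>\<^sub>M i\<in>{..<m}. lborel) (lborel_vec m)"
  unfolding lborel_vec_def by (rule measurable_embed_measure2'[OF inj_on_vec_space_PiM])

text \<open>\<open>f\<close> is recovered from its tuple of coordinates by \<open>vec m\<close>, so
  it factors through the product space, where measurability is coordinatewise.\<close>

lemma measurable_lborel_vecI:
  assumes "\<And>x. x \<in> space N \<Longrightarrow> f x \<in> carrier_vec m"
    and meas: "\<And>i. i < m \<Longrightarrow> (\<lambda>x. f x $ i) \<in> borel_measurable N"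
  shows "f \<in> measurable N (lborel_vec m)"
proof -
  have "(\<lambda>x. \<lambda>i\<in>{..<m}. f x $ i) \<in> measurable N (\<Pi>\<^sub>M i\<in>{..<m}. lborel)"
    by (rule measurable_restrict) (simp add: meas)
  from measurable_compose[OF this measurable_vec_PiM]
  have "(\<lambda>x. vec m (\<lambda>i\<in>{..<m}. f x $ i)) \<in> measurable N (lborel_vec m)" .
  moreover have "vec m (\<lambda>i\<in>{..<m}. f x $ i) = f x" if "x \<in> space N" for x
    using assms(1)[OF that] by (intro eq_vecI) auto
  ultimately show ?thesis by (simp cong: measurable_cong)
qed

lemma measurable_lborel_vec_index:
  assumes "f \<in> measurable N (lborel_vec m)" "i < m"
  shows "(\<lambda>x. f x $ i) \<in> borel_measurable N"
  using measurable_compose[OF assms(1) measurable_vec_index[OF assms(2)]] .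

lemma measurable_lborel_vec_carrier:
  assumes "f \<in> measurable N (lborel_vec m)" "x \<in> space N"
  shows "f x \<in> carrier_vec m"
  using measurable_space[OF assms] by simp

lemma measurable_scalar_prod:
  fixes f g :: "'a \<Rightarrow> real vec"
  assumes f: "f \<in> measurable N (lborel_vec m)" and g: "g \<in> measurable N (lborel_vec m)"
  shows "(\<lambda>x. f x \<bullet> g x) \<in> borel_measurable N"
proof -
  have "(\<lambda>x. \<Sum>i\<in>{0..<m}. f x $ i * g x $ i) \<in> borel_measurable N"
    by (intro borel_measurable_sum borel_measurable_times measurable_lborel_vec_index[OF f]
        measurable_lborel_vec_index[OF g]) auto
  moreover have "f x \<bullet> g x = (\<Sum>i\<in>{0..<m}. f x $ i * g x $ i)" if "x \<in> space N" for x
    using measurable_lborel_vec_carrier[OF g that] by (auto simp: scalar_prod_def)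
  ultimately show ?thesis by (simp cong: measurable_cong)
qed

lemma measurable_const_vec:
  "v \<in> carrier_vec m \<Longrightarrow> (\<lambda>x. v) \<in> measurable N (lborel_vec m)"
  by (rule measurable_const) simp

lemma measurable_mult_mat_vec:
  assumes A: "A \<in> carrier_mat n m" and f: "f \<in> measurable N (lborel_vec m)"
  shows "(\<lambda>x. A *\<^sub>v f x) \<in> measurable N (lborel_vec n)"
proof (rule measurable_lborel_vecI)
  fix i assume "i < n"
  then have "(\<lambda>x. row A i \<bullet> f x) \<in> borel_measurable N"
    using A by (intro measurable_scalar_prod[OF _ f] measurable_const_vec) auto
  with \<open>i < n\<close> A show "(\<lambda>x. (A *\<^sub>v f x) $ i) \<in> borel_measurable N" by simp
qed (rule mult_mat_vec_carrier[OF A measurable_lborel_vec_carrier[OF f]])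

lemma measurable_add_vec:
  fixes f g :: "'a \<Rightarrow> real vec"
  assumes f: "f \<in> measurable N (lborel_vec m)" and g: "g \<in> measurable N (lborel_vec m)"
  shows "(\<lambda>x. f x + g x) \<in> measurable N (lborel_vec m)"
proof (rule measurable_lborel_vecI)
  fix i assume i: "i < m"
  have "(\<lambda>x. f x $ i + g x $ i) \<in> borel_measurable N"
    using i by (intro borel_measurable_add measurable_lborel_vec_index[OF f] measurable_lborel_vec_index[OF g])
  moreover have "(f x + g x) $ i = f x $ i + g x $ i" if "x \<in> space N" for x
    using i measurable_lborel_vec_carrier[OF g that] by simp
  ultimately show "(\<lambda>x. (f x + g x) $ i) \<in> borel_measurable N" by (simp cong: measurable_cong)
qed (use measurable_lborel_vec_carrier[OF f] measurable_lborel_vec_carrier[OF g] in auto)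

lemma measurable_uminus_vec:
  fixes f :: "'a \<Rightarrow> real vec"
  assumes f: "f \<in> measurable N (lborel_vec m)"
  shows "(\<lambda>x. - f x) \<in> measurable N (lborel_vec m)"
proof (rule measurable_lborel_vecI)
  fix i assume i: "i < m"
  have "(\<lambda>x. - (f x $ i)) \<in> borel_measurable N"
    using i by (intro borel_measurable_uminus measurable_lborel_vec_index[OF f])
  moreover have "(- f x) $ i = - (f x $ i)" if "x \<in> space N" for x
    using i measurable_lborel_vec_carrier[OF f that] by simp
  ultimately show "(\<lambda>x. (- f x) $ i) \<in> borel_measurable N" by (simp cong: measurable_cong)
qed (use measurable_lborel_vec_carrier[OF f] in auto)

lemma measurable_append_vec:
  fixes f g :: "'a \<Rightarrow> real vec"
  assumes f: "f \<in> measurable N (lborel_vec k)" and g: "g \<in> measurable N (lborel_vec r)"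
  shows "(\<lambda>x. f x @\<^sub>v g x) \<in> measurable N (lborel_vec (k + r))"
proof (rule measurable_lborel_vecI)
  fix i assume i: "i < k + r"
  have "(\<lambda>x. if i < k then f x $ i else g x $ (i - k)) \<in> borel_measurable N"
    using i measurable_lborel_vec_index[OF f] measurable_lborel_vec_index[OF g] by (cases "i < k") auto
  moreover have "(f x @\<^sub>v g x) $ i = (if i < k then f x $ i else g x $ (i - k))" if "x \<in> space N" for x
    using i measurable_lborel_vec_carrier[OF f that] measurable_lborel_vec_carrier[OF g that] by simp
  ultimately show "(\<lambda>x. (f x @\<^sub>v g x) $ i) \<in> borel_measurable N" by (simp cong: measurable_cong)
qed (use measurable_lborel_vec_carrier[OF f] measurable_lborel_vec_carrier[OF g] in auto)

lemma lborel_vec_eq_distr: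
  "lborel_vec m = distr (\<Pi>\<^sub>M i\<in>{..<m}. lborel) (lborel_vec m) (vec m)"
  using embed_measure_eq_distr'[OF inj_on_vec_space_PiM[of m]] by (simp add: lborel_vec_def)

lemma sets_box_lborel_vec:
  assumes "\<And>i. i < m \<Longrightarrow> A i \<in> sets borel"
  shows "{v \<in> carrier_vec m. \<forall>i<m. v $ i \<in> A i} \<in> sets (lborel_vec m)"
proof -
  have "{v \<in> space (lborel_vec m). \<forall>i\<in>{..<m}. v $ i \<in> A i} \<in> sets (lborel_vec m)"
  proof (rule sets.sets_Collect_finite_All)
    fix i assume "i \<in> {..<m}"
    with assms show "{v \<in> space (lborel_vec m). v $ i \<in> A i} \<in> sets (lborel_vec m)"
      using measurable_sets[OF measurable_vec_index, of i m "A i"] by (simp add: vimage_def Int_def conj_commute)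
  qed simp
  moreover have "{v \<in> carrier_vec m. \<forall>i<m. v $ i \<in> A i} = {v \<in> space (lborel_vec m). \<forall>i\<in>{..<m}. v $ i \<in> A i}"
    by auto
  ultimately show ?thesis by (simp only:)
qed

lemma emeasure_box_lborel_vec:
  assumes A: "\<And>i. i < m \<Longrightarrow> A i \<in> sets borel"
  shows "emeasure (lborel_vec m) {v \<in> carrier_vec m. \<forall>i<m. v $ i \<in> A i} = (\<Prod>i<m. emeasure lborel (A i))"
proof -
  interpret product_sigma_finite "\<lambda>_::nat. lborel :: real measure" ..
  have "vec m -` {v \<in> carrier_vec m. \<forall>i<m. v $ i \<in> A i} \<inter> space (\<Pi>\<^sub>M i\<in>{..<m}. lborel) = Pi\<^sub>E {..<m} A"
    by (auto simp: space_PiM PiE_def Pi_def)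
  moreover have "emeasure (lborel_vec m) {v \<in> carrier_vec m. \<forall>i<m. v $ i \<in> A i} =
      emeasure (\<Pi>\<^sub>M i\<in>{..<m}. lborel) (vec m -` {v \<in> carrier_vec m. \<forall>i<m. v $ i \<in> A i} \<inter> space (\<Pi>\<^sub>M i\<in>{..<m}. lborel))"
    by (rule emeasure_distr[OF measurable_vec_PiM sets_box_lborel_vec[OF A], folded lborel_vec_eq_distr])
  moreover have "emeasure (\<Pi>\<^sub>M i\<in>{..<m}. lborel) (Pi\<^sub>E {..<m} A) = (\<Prod>i<m. emeasure lborel (A i))"
    by (rule emeasure_PiM) (use A in auto)
  ultimately show ?thesis by simp
qed

text \<open>The coordinate map \<open>g\<close> carries \<open>P\<close> to a measure that agrees
  with the product of Lebesgue measures on boxes, hence equals it, and \<open>vec m\<close> undoes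
  \<open>g\<close>. The behaviour of \<open>lborel_vec\<close> under translation, reflection and
  concatenation is checked on boxes through this lemma.\<close>

lemma lborel_vec_eqI:
  assumes sets_P: "sets P = sets (lborel_vec m)"
    and box: "\<And>A. (\<And>i. i < m \<Longrightarrow> A i \<in> sets borel) \<Longrightarrow>
      emeasure P {v \<in> carrier_vec m. \<forall>i<m. v $ i \<in> A i} = (\<Prod>i<m. emeasure lborel (A i))"
  shows "P = lborel_vec m"
proof -
  interpret product_sigma_finite "\<lambda>_::nat. lborel :: real measure" ..
  let ?\<Pi> = "\<Pi>\<^sub>M i\<in>{..<m}. (lborel :: real measure)"
  define g where "g = (\<lambda>v :: real vec. \<lambda>i\<in>{..<m}. v $ i)"
  have space_P: "space P = carrier_vec m" using sets_eq_imp_space_eq[OF sets_P] by simp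
  have "g \<in> measurable (lborel_vec m) ?\<Pi>"
    unfolding g_def by (rule measurable_restrict) (simp add: measurable_vec_index)
  then have g: "g \<in> measurable P ?\<Pi>"
    by (simp add: measurable_cong_sets[OF sets_P refl])
  have vecP: "vec m \<in> measurable ?\<Pi> P"
    using measurable_vec_PiM by (simp add: measurable_cong_sets[OF refl sets_P])
  have "distr P ?\<Pi> g = ?\<Pi>"
  proof (rule PiM_eqI)
    fix A :: "nat \<Rightarrow> real set" assume A: "\<And>i. i \<in> {..<m} \<Longrightarrow> A i \<in> sets lborel"
    have "g -` Pi\<^sub>E {..<m} A \<inter> space P = {v \<in> carrier_vec m. \<forall>i<m. v $ i \<in> A i}"
      by (auto simp: g_def space_P PiE_def Pi_def)
    then show "emeasure (distr P ?\<Pi> g) (Pi\<^sub>E {..<m} A) = (\<Prod>i\<in>{..<m}. emeasure lborel (A i))"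
      using A box[of A] by (subst emeasure_distr[OF g]) (auto intro!: sets_PiM_I_finite)
  qed auto
  moreover have "distr (distr P ?\<Pi> g) P (vec m) = P"
  proof -
    have "(vec m \<circ> g) v = v" if "v \<in> space P" for v
      using that by (intro eq_vecI) (auto simp: g_def space_P)
    then have "distr P P (vec m \<circ> g) = distr P P (\<lambda>v. v)" by (intro distr_cong) auto
    then show ?thesis by (simp add: distr_distr[OF vecP g] distr_id)
  qed
  ultimately have "P = distr ?\<Pi> P (vec m)" by simp
  also have "\<dots> = distr ?\<Pi> (lborel_vec m) (vec m)" by (rule distr_cong) (simp_all add: sets_P)
  also have "\<dots> = lborel_vec m" by (rule lborel_vec_eq_distr[symmetric])
  finally show ?thesis .
qed

lemma sigma_finite_lborel_vec: "sigma_finite_measure (lborel_vec m)"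
proof
  define C where "C k = {v \<in> carrier_vec m. \<forall>i<m. v $ i \<in> {- real k..real k}}" for k :: nat
  have "\<exists>k. v \<in> C k" if v: "v \<in> carrier_vec m" for v
  proof -
    \<comment> \<open>The sum of absolute values bounds all coordinates at once, also for
      \<open>m = 0\<close>.\<close>
    obtain k :: nat where k: "(\<Sum>i<m. \<bar>v $ i\<bar>) \<le> real k" using real_arch_simple by blast
    have "\<bar>v $ i\<bar> \<le> real k" if "i < m" for i
      using member_le_sum[of i "{..<m}" "\<lambda>i. \<bar>v $ i\<bar>"] that k by auto
    with v show ?thesis by (intro exI[of _ k]) (force simp: C_def abs_le_iff)
  qed
  then have "\<Union> (range C) = space (lborel_vec m)" by (auto simp: C_def)
  moreover have "C k \<in> sets (lborel_vec m)" for k unfolding C_def by (rule sets_box_lborel_vec) auto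
  moreover have "emeasure (lborel_vec m) (C k) \<noteq> \<infinity>" for k
    unfolding C_def by (subst emeasure_box_lborel_vec) (auto simp: ennreal_power)
  ultimately show "\<exists>A. countable A \<and> A \<subseteq> sets (lborel_vec m) \<and> \<Union> A = space (lborel_vec m) \<and>
      (\<forall>a\<in>A. emeasure (lborel_vec m) a \<noteq> \<infinity>)"
    by (intro exI[of _ "range C"]) auto
qed

text \<open>A translation pulls boxes back to boxes, so invariance reduces to the real line in each
  coordinate.\<close>

lemma distr_lborel_vec_plus:
  assumes a: "a \<in> carrier_vec m"
  shows "distr (lborel_vec m) (lborel_vec m) (\<lambda>v. v + a) = lborel_vec m"
proof (rule lborel_vec_eqI)
  fix A :: "nat \<Rightarrow> real set" assume A: "\<And>i. i < m \<Longrightarrow> A i \<in> sets borel"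
  have shift: "emeasure lborel ((+) c -` B) = emeasure lborel B" if "B \<in> sets borel" for B :: "real set" and c
    using that emeasure_distr[of "(+) c" lborel borel B] by (simp add: lborel_distr_plus)
  have "emeasure (distr (lborel_vec m) (lborel_vec m) (\<lambda>v. v + a)) {v \<in> carrier_vec m. \<forall>i<m. v $ i \<in> A i} =
      emeasure (lborel_vec m) {v \<in> carrier_vec m. \<forall>i<m. v $ i \<in> (+) (a $ i) -` A i}"
  proof (subst emeasure_distr)
    show "(\<lambda>v. v + a) \<in> measurable (lborel_vec m) (lborel_vec m)"
      by (intro measurable_add_vec measurable_ident_sets[OF refl] measurable_const_vec a)
    show "{v \<in> carrier_vec m. \<forall>i<m. v $ i \<in> A i} \<in> sets (lborel_vec m)"
      by (rule sets_box_lborel_vec[OF A])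
    have "(\<lambda>v. v + a) -` {v \<in> carrier_vec m. \<forall>i<m. v $ i \<in> A i} \<inter> space (lborel_vec m) =
        {v \<in> carrier_vec m. \<forall>i<m. v $ i \<in> (+) (a $ i) -` A i}"
      using a by (auto simp: add.commute)
    then show "emeasure (lborel_vec m) ((\<lambda>v. v + a) -` {v \<in> carrier_vec m. \<forall>i<m. v $ i \<in> A i} \<inter> space (lborel_vec m)) =
        emeasure (lborel_vec m) {v \<in> carrier_vec m. \<forall>i<m. v $ i \<in> (+) (a $ i) -` A i}"
      by (rule arg_cong)
  qed
  also have "\<dots> = (\<Prod>i<m. emeasure lborel ((+) (a $ i) -` A i))"
    by (intro emeasure_box_lborel_vec measurable_sets_borel[of _ borel] A) auto
  also have "\<dots> = (\<Prod>i<m. emeasure lborel (A i))"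
    using A by (intro prod.cong) (auto simp: shift)
  finally show "emeasure (distr (lborel_vec m) (lborel_vec m) (\<lambda>v. v + a))
      {v \<in> carrier_vec m. \<forall>i<m. v $ i \<in> A i} = (\<Prod>i<m. emeasure lborel (A i))" .
qed simp

lemma distr_lborel_vec_uminus:
  "distr (lborel_vec m) (lborel_vec m) (\<lambda>v. - v) = lborel_vec m"
proof (rule lborel_vec_eqI)
  fix A :: "nat \<Rightarrow> real set" assume A: "\<And>i. i < m \<Longrightarrow> A i \<in> sets borel"
  have shift: "emeasure lborel (uminus -` B) = emeasure lborel B" if "B \<in> sets borel" for B :: "real set"
    using that emeasure_distr[of uminus lborel borel B] by (simp add: lborel_distr_uminus)
  have "emeasure (distr (lborel_vec m) (lborel_vec m) (\<lambda>v. - v)) {v \<in> carrier_vec m. \<forall>i<m. v $ i \<in> A i} =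
      emeasure (lborel_vec m) {v \<in> carrier_vec m. \<forall>i<m. v $ i \<in> uminus -` A i}"
  proof (subst emeasure_distr)
    show "(\<lambda>v. - v) \<in> measurable (lborel_vec m) (lborel_vec m)"
      by (intro measurable_uminus_vec measurable_ident_sets[OF refl])
    show "{v \<in> carrier_vec m. \<forall>i<m. v $ i \<in> A i} \<in> sets (lborel_vec m)"
      by (rule sets_box_lborel_vec[OF A])
    have "(\<lambda>v. - v) -` {v \<in> carrier_vec m. \<forall>i<m. v $ i \<in> A i} \<inter> space (lborel_vec m) =
        {v \<in> carrier_vec m. \<forall>i<m. v $ i \<in> uminus -` A i}"
      by auto
    then show "emeasure (lborel_vec m) ((\<lambda>v. - v) -` {v \<in> carrier_vec m. \<forall>i<m. v $ i \<in> A i} \<inter> space (lborel_vec m)) =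
        emeasure (lborel_vec m) {v \<in> carrier_vec m. \<forall>i<m. v $ i \<in> uminus -` A i}"
      by (rule arg_cong)
  qed
  also have "\<dots> = (\<Prod>i<m. emeasure lborel (uminus -` A i))"
    by (intro emeasure_box_lborel_vec measurable_sets_borel[of _ borel] A) auto
  also have "\<dots> = (\<Prod>i<m. emeasure lborel (A i))"
    using A by (intro prod.cong) (auto simp: shift)
  finally show "emeasure (distr (lborel_vec m) (lborel_vec m) (\<lambda>v. - v))
      {v \<in> carrier_vec m. \<forall>i<m. v $ i \<in> A i} = (\<Prod>i<m. emeasure lborel (A i))" .
qed simp

lemma measurable_append_vec_pair:
  "(\<lambda>(u, t). u @\<^sub>v t) \<in> measurable (lborel_vec k \<Otimes>\<^sub>M lborel_vec r) (lborel_vec (k + r))"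
  unfolding split_beta by (intro measurable_append_vec) auto

text \<open>The preimage of a box is a product of two boxes, formed by the first \<open>k\<close>
  sides and the remaining \<open>r\<close>. This identification makes Fubini available for
  concatenated vectors.\<close>

lemma distr_append_lborel_vec:
  "distr (lborel_vec k \<Otimes>\<^sub>M lborel_vec r) (lborel_vec (k + r)) (\<lambda>(u, t). u @\<^sub>v t) = lborel_vec (k + r)"
proof (rule lborel_vec_eqI)
  interpret sigma_finite_measure "lborel_vec r" by (rule sigma_finite_lborel_vec)
  fix A :: "nat \<Rightarrow> real set" assume A: "\<And>i. i < k + r \<Longrightarrow> A i \<in> sets borel"
  have "(\<lambda>(u, t). u @\<^sub>v t) -` {v \<in> carrier_vec (k + r). \<forall>i<k + r. v $ i \<in> A i} \<inter> space (lborel_vec k \<Otimes>\<^sub>M lborel_vec r) =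
    {v \<in> carrier_vec k. \<forall>i<k. v $ i \<in> A i} \<times> {v \<in> carrier_vec r. \<forall>i<r. v $ i \<in> A (k + i)}"
  proof safe
    fix u t :: "real vec" assume *: "(u, t) \<in> space (lborel_vec k \<Otimes>\<^sub>M lborel_vec r)" "\<forall>i<k + r. (u @\<^sub>v t) $ i \<in> A i"
    then show "u \<in> carrier_vec k" "t \<in> carrier_vec r" by (auto simp: space_pair_measure)
    fix i show "i < k \<Longrightarrow> u $ i \<in> A i" "i < r \<Longrightarrow> t $ i \<in> A (k + i)"
      using *(2)[rule_format, of i] *(2)[rule_format, of "k + i"] *(1) by (auto simp: space_pair_measure)
  qed (auto simp: space_pair_measure intro!: append_carrier_vec, metis add.commute add_diff_inverse_nat less_diff_conv2 not_le_imp_less)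
  note preimage = this
  have "emeasure (distr (lborel_vec k \<Otimes>\<^sub>M lborel_vec r) (lborel_vec (k + r)) (\<lambda>(u, t). u @\<^sub>v t))
      {v \<in> carrier_vec (k + r). \<forall>i<k + r. v $ i \<in> A i} =
    emeasure (lborel_vec k) {v \<in> carrier_vec k. \<forall>i<k. v $ i \<in> A i} *
    emeasure (lborel_vec r) {v \<in> carrier_vec r. \<forall>i<r. v $ i \<in> A (k + i)}"
    by (subst emeasure_distr[OF measurable_append_vec_pair sets_box_lborel_vec[OF A]], assumption, unfold preimage, rule emeasure_pair_measure_Times; rule sets_box_lborel_vec) (simp_all add: A)
  also have "\<dots> = (\<Prod>i<k. emeasure lborel (A i)) * (\<Prod>i<r. emeasure lborel (A (k + i)))"
    using A by (subst (1 2) emeasure_box_lborel_vec) auto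
  also have "(\<Prod>i<r. emeasure lborel (A (k + i))) = (\<Prod>i\<in>{k..<k + r}. emeasure lborel (A i))"
    by (rule prod.reindex_bij_witness[of _ "\<lambda>i. i - k" "\<lambda>i. k + i"]) auto
  also have "(\<Prod>i<k. emeasure lborel (A i)) * \<dots> = (\<Prod>i<k + r. emeasure lborel (A i))"
    by (subst prod.union_disjoint[symmetric]) (auto intro!: prod.cong)
  finally show "emeasure (distr (lborel_vec k \<Otimes>\<^sub>M lborel_vec r) (lborel_vec (k + r)) (\<lambda>(u, t). u @\<^sub>v t))
      {v \<in> carrier_vec (k + r). \<forall>i<k + r. v $ i \<in> A i} = (\<Prod>i<k + r. emeasure lborel (A i))" .
qed simp

lemma measurable_vec_1: "(\<lambda>x. vec 1 (\<lambda>_. x)) \<in> measurable lborel (lborel_vec 1)"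
  by (rule measurable_lborel_vecI) auto

lemma distr_lborel_vec_1: "distr lborel (lborel_vec 1) (\<lambda>x. vec 1 (\<lambda>_. x)) = lborel_vec 1"
proof (rule lborel_vec_eqI)
  fix A :: "nat \<Rightarrow> real set" assume A: "\<And>i. i < 1 \<Longrightarrow> A i \<in> sets borel"
  have "(\<lambda>x. vec 1 (\<lambda>_. x)) -` {v \<in> carrier_vec 1. \<forall>i<1. v $ i \<in> A i} \<inter> space lborel = A 0" by auto
  then show "emeasure (distr lborel (lborel_vec 1) (\<lambda>x. vec 1 (\<lambda>_. x))) {v \<in> carrier_vec 1. \<forall>i<1. v $ i \<in> A i} =
      (\<Prod>i<1. emeasure lborel (A i))"
    using emeasure_distr[OF measurable_vec_1 sets_box_lborel_vec[of 1 A, OF A]] by simp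
qed simp

lemma nn_integral_lborel_vec_plus:
  assumes "a \<in> carrier_vec m" "f \<in> borel_measurable (lborel_vec m)"
  shows "(\<integral>\<^sup>+v. f (v + a) \<partial>lborel_vec m) = (\<integral>\<^sup>+v. f v \<partial>lborel_vec m)"
  using assms
  by (subst (2) distr_lborel_vec_plus[symmetric, OF assms(1)], subst nn_integral_distr)
    (auto intro!: measurable_add_vec measurable_const_vec)

lemma nn_integral_lborel_vec_uminus:
  assumes "f \<in> borel_measurable (lborel_vec m)"
  shows "(\<integral>\<^sup>+v. f (- v) \<partial>lborel_vec m) = (\<integral>\<^sup>+v. f v \<partial>lborel_vec m)"
  using assms
  by (subst (2) distr_lborel_vec_uminus[symmetric], subst nn_integral_distr)
    (auto intro!: measurable_uminus_vec)

lemma nn_integral_lborel_vec_append: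
  assumes f: "f \<in> borel_measurable (lborel_vec (k + r))"
  shows "(\<integral>\<^sup>+v. f v \<partial>lborel_vec (k + r)) = (\<integral>\<^sup>+u. \<integral>\<^sup>+t. f (u @\<^sub>v t) \<partial>lborel_vec r \<partial>lborel_vec k)"
proof -
  interpret sigma_finite_measure "lborel_vec r" by (rule sigma_finite_lborel_vec)
  have "(\<integral>\<^sup>+v. f v \<partial>lborel_vec (k + r)) = (\<integral>\<^sup>+p. f (case p of (u, t) \<Rightarrow> u @\<^sub>v t) \<partial>(lborel_vec k \<Otimes>\<^sub>M lborel_vec r))"
    using f by (subst distr_append_lborel_vec[symmetric], subst nn_integral_distr[OF measurable_append_vec_pair]) auto
  also have "\<dots> = (\<integral>\<^sup>+u. \<integral>\<^sup>+t. f (u @\<^sub>v t) \<partial>lborel_vec r \<partial>lborel_vec k)"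
    using measurable_compose[OF measurable_append_vec_pair f] by (subst nn_integral_fst[symmetric]) auto
  finally show ?thesis .
qed

lemma nn_integral_lborel_vec_1:
  assumes "f \<in> borel_measurable (lborel_vec 1)"
  shows "(\<integral>\<^sup>+v. f v \<partial>lborel_vec 1) = (\<integral>\<^sup>+x. f (vec 1 (\<lambda>_. x)) \<partial>lborel)"
  using assms by (subst distr_lborel_vec_1[symmetric], subst nn_integral_distr[OF measurable_vec_1]) auto

text \<open>
  Substituting by an invertible matrix multiplies integrals by a constant, here eliminated by
  comparison with a second integrand. The proof uses only invariance under translations and \<open>v \<mapsto> - v\<close>:
  integrate \<open>f (J v) g (w + J v)\<close> over \<open>v\<close> and \<open>w\<close> in both orders.
\<close>

lemma nn_integral_linear_substitution:
  fixes f g :: "real vec \<Rightarrow> ennreal"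
  assumes J: "J \<in> carrier_mat m m" "J' \<in> carrier_mat m m" "J * J' = 1\<^sub>m m"
    and f[measurable]: "f \<in> borel_measurable (lborel_vec m)" and g[measurable]: "g \<in> borel_measurable (lborel_vec m)"
  shows "(\<integral>\<^sup>+v. f (J *\<^sub>v v) \<partial>lborel_vec m) * (\<integral>\<^sup>+v. g v \<partial>lborel_vec m) =
    (\<integral>\<^sup>+v. g (J *\<^sub>v v) \<partial>lborel_vec m) * (\<integral>\<^sup>+v. f v \<partial>lborel_vec m)"
proof -
  let ?l = "lborel_vec m"
  interpret sigma_finite_measure ?l by (rule sigma_finite_lborel_vec)
  interpret P: pair_sigma_finite ?l ?l ..
  have JJ: "J *\<^sub>v (J' *\<^sub>v w) = w" if "w \<in> carrier_vec m" for w
    using assoc_mult_mat_vec[OF J(1,2) that] J(3) that by simp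
  note vec_meas = measurable_mult_mat_vec[OF J(1)] measurable_add_vec measurable_uminus_vec
    measurable_const_vec measurable_fst measurable_snd measurable_ident_sets[OF refl]
  have "(\<integral>\<^sup>+v. f (J *\<^sub>v v) \<partial>?l) * (\<integral>\<^sup>+v. g v \<partial>?l) = (\<integral>\<^sup>+v. f (J *\<^sub>v v) * (\<integral>\<^sup>+w. g w \<partial>?l) \<partial>?l)"
    by (rule nn_integral_multc[symmetric]) (intro measurable_compose[OF _ f] vec_meas)
  also have "\<dots> = (\<integral>\<^sup>+v. (\<integral>\<^sup>+w. f (J *\<^sub>v v) * g (w + J *\<^sub>v v) \<partial>?l) \<partial>?l)"
  proof (rule nn_integral_cong)
    fix v assume "v \<in> space ?l"
    then have Jv: "J *\<^sub>v v \<in> carrier_vec m" using J by simp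
    have "(\<integral>\<^sup>+w. f (J *\<^sub>v v) * g (w + J *\<^sub>v v) \<partial>?l) = f (J *\<^sub>v v) * (\<integral>\<^sup>+w. g (w + J *\<^sub>v v) \<partial>?l)"
      by (rule nn_integral_cmult) (intro measurable_compose[OF _ g] vec_meas Jv)
    then show "f (J *\<^sub>v v) * (\<integral>\<^sup>+w. g w \<partial>?l) = (\<integral>\<^sup>+w. f (J *\<^sub>v v) * g (w + J *\<^sub>v v) \<partial>?l)"
      using nn_integral_lborel_vec_plus[OF Jv g] by simp
  qed
  also have "\<dots> = (\<integral>\<^sup>+w. (\<integral>\<^sup>+v. f (J *\<^sub>v v) * g (w + J *\<^sub>v v) \<partial>?l) \<partial>?l)"
    by (rule P.Fubini'[where f = "\<lambda>w v. f (J *\<^sub>v v) * g (w + J *\<^sub>v v)"])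
      (unfold split_beta, intro borel_measurable_times_ennreal measurable_compose[OF _ f] measurable_compose[OF _ g] vec_meas)
  also have "\<dots> = (\<integral>\<^sup>+w. (\<integral>\<^sup>+v. f (J *\<^sub>v v + - w) * g (J *\<^sub>v v) \<partial>?l) \<partial>?l)"
  proof (rule nn_integral_cong)
    fix w assume "w \<in> space ?l"
    then have w: "w \<in> carrier_vec m" by simp
    \<comment> \<open>Shifting \<open>v\<close> by \<open>- (J' *\<^sub>v w)\<close> moves the
      argument of \<open>g\<close> from \<open>w + J *\<^sub>v v\<close> to
      \<open>J *\<^sub>v v\<close>, because \<open>J'\<close> is a right inverse of
      \<open>J\<close>.\<close>
    have "(\<integral>\<^sup>+v. f (J *\<^sub>v v) * g (w + J *\<^sub>v v) \<partial>?l) =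
      (\<integral>\<^sup>+v. f (J *\<^sub>v (v + - (J' *\<^sub>v w))) * g (w + J *\<^sub>v (v + - (J' *\<^sub>v w))) \<partial>?l)"
      using w J by (intro nn_integral_lborel_vec_plus[symmetric] borel_measurable_times_ennreal
        measurable_compose[OF _ f] measurable_compose[OF _ g] vec_meas) auto
    also have "\<dots> = (\<integral>\<^sup>+v. f (J *\<^sub>v v + - w) * g (J *\<^sub>v v) \<partial>?l)"
    proof (rule nn_integral_cong)
      fix v assume "v \<in> space ?l"
      then have v: "v \<in> carrier_vec m" by simp
      have "J *\<^sub>v (- (J' *\<^sub>v w)) = - w"
        using mult_mat_uminus_vec[OF J(1), of "J' *\<^sub>v w"] JJ[OF w] J w by simp
      then have "J *\<^sub>v (v + - (J' *\<^sub>v w)) = J *\<^sub>v v + - w"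
        using v w J by (simp add: mult_add_distrib_mat_vec[of _ m m])
      moreover have "w + (J *\<^sub>v v + - w) = J *\<^sub>v v" using v w J by (intro eq_vecI) auto
      ultimately show "f (J *\<^sub>v (v + - (J' *\<^sub>v w))) * g (w + J *\<^sub>v (v + - (J' *\<^sub>v w))) =
        f (J *\<^sub>v v + - w) * g (J *\<^sub>v v)" by simp
    qed
    finally show "(\<integral>\<^sup>+v. f (J *\<^sub>v v) * g (w + J *\<^sub>v v) \<partial>?l) = (\<integral>\<^sup>+v. f (J *\<^sub>v v + - w) * g (J *\<^sub>v v) \<partial>?l)" .
  qed
  also have "\<dots> = (\<integral>\<^sup>+v. (\<integral>\<^sup>+w. f (J *\<^sub>v v + - w) * g (J *\<^sub>v v) \<partial>?l) \<partial>?l)"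
    by (rule P.Fubini'[symmetric, where f = "\<lambda>w v. f (J *\<^sub>v v + - w) * g (J *\<^sub>v v)"])
      (unfold split_beta, intro borel_measurable_times_ennreal measurable_compose[OF _ f] measurable_compose[OF _ g] vec_meas)
  also have "\<dots> = (\<integral>\<^sup>+v. (\<integral>\<^sup>+w. f w \<partial>?l) * g (J *\<^sub>v v) \<partial>?l)"
  proof (rule nn_integral_cong)
    fix v assume "v \<in> space ?l"
    then have Jv: "J *\<^sub>v v \<in> carrier_vec m" using J by simp
    have "(\<integral>\<^sup>+w. f (J *\<^sub>v v + - w) * g (J *\<^sub>v v) \<partial>?l) = (\<integral>\<^sup>+w. f (J *\<^sub>v v + - w) \<partial>?l) * g (J *\<^sub>v v)"
      by (rule nn_integral_multc) (intro measurable_compose[OF _ f] vec_meas Jv)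
    \<comment> \<open>Reflection and then translation remove \<open>J *\<^sub>v v\<close> from the
      argument of \<open>f\<close>, which separates the two integrals.\<close>
    also have "(\<integral>\<^sup>+w. f (J *\<^sub>v v + - w) \<partial>?l) = (\<integral>\<^sup>+w. f (J *\<^sub>v v + w) \<partial>?l)"
      by (rule nn_integral_lborel_vec_uminus) (intro measurable_compose[OF _ f] vec_meas Jv)
    also have "\<dots> = (\<integral>\<^sup>+w. f (w + J *\<^sub>v v) \<partial>?l)"
      using Jv by (intro nn_integral_cong) (simp add: comm_add_vec[of _ m])
    also have "\<dots> = (\<integral>\<^sup>+w. f w \<partial>?l)" by (rule nn_integral_lborel_vec_plus[OF Jv f])
    finally show "(\<integral>\<^sup>+w. f (J *\<^sub>v v + - w) * g (J *\<^sub>v v) \<partial>?l) = (\<integral>\<^sup>+w. f w \<partial>?l) * g (J *\<^sub>v v)" .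
  qed
  also have "\<dots> = (\<integral>\<^sup>+w. f w \<partial>?l) * (\<integral>\<^sup>+v. g (J *\<^sub>v v) \<partial>?l)"
    by (rule nn_integral_cmult) (intro measurable_compose[OF _ g] vec_meas)
  finally show ?thesis by (simp add: mult.commute)
qed

subsection \<open>Gaussian densities\<close>

lemma measurable_mvn_pdf:
  assumes "minv W \<in> carrier_mat m m"
  shows "mvn_pdf m W \<in> borel_measurable (lborel_vec m)"
proof -
  have "(\<lambda>z. z \<bullet> (minv W *\<^sub>v z)) \<in> borel_measurable (lborel_vec m)"
    by (intro measurable_scalar_prod[where m = m] measurable_mult_mat_vec[OF assms] measurable_ident_sets[OF refl])
  then have "(\<lambda>z. exp (- (z \<bullet> (minv W *\<^sub>v z)) / 2) / sqrt ((2 * pi) ^ m * det W)) \<in> borel_measurable (lborel_vec m)"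
    by measurable
  then show ?thesis by (simp add: mvn_pdf_def[abs_def])
qed

lemma mvn_pdf_pos: "det W > 0 \<Longrightarrow> mvn_pdf m W z > 0"
  by (simp add: mvn_pdf_def)

lemma emeasure_lborel_vec_0: "emeasure (lborel_vec 0) (carrier_vec 0) = 1"
  using emeasure_box_lborel_vec[of 0 "\<lambda>_. UNIV"] by simp

text \<open>The factor is the ratio of the normalizing constants, the powers of
  \<open>2 * pi\<close> cancelling as \<open>m = k + r\<close>. Only the values of the quadratic
  forms enter, so the lemma covers both coordinate changes and block-diagonal covariances.\<close>

lemma mvn_pdf_scaled_exp:
  assumes "det W > 0" "det D > 0" "det G > 0" "m = k + r"
    and quad: "z \<bullet> (minv W *\<^sub>v z) = u \<bullet> (minv D *\<^sub>v u) + t \<bullet> (minv G *\<^sub>v t)"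
  shows "mvn_pdf m W z = sqrt (det D * det G / det W) * (mvn_pdf k D u * mvn_pdf r G t)"
proof -
  have "sqrt ((2 * pi) ^ m * det W) * sqrt (det D * det G / det W) =
      sqrt ((2 * pi) ^ k * det D) * sqrt ((2 * pi) ^ r * det G)"
    using assms by (simp add: power_add mult_ac flip: real_sqrt_mult)
  moreover have "exp (- (z \<bullet> (minv W *\<^sub>v z)) / 2) =
      exp (- (u \<bullet> (minv D *\<^sub>v u)) / 2) * exp (- (t \<bullet> (minv G *\<^sub>v t)) / 2)"
    by (simp add: quad add_divide_distrib flip: exp_add)
  moreover have "sqrt ((2 * pi) ^ m * det W) > 0" "sqrt ((2 * pi) ^ k * det D) * sqrt ((2 * pi) ^ r * det G) > 0"
    using assms by (auto intro!: mult_pos_pos)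
  moreover have "x / a = c * (x1 / b1 * (x2 / b2))"
    if "a * c = b1 * b2" "x = x1 * x2" "a > 0" "b1 * b2 > 0" for x x1 x2 a b1 b2 c :: real
  proof -
    have "b1 * b2 \<noteq> 0" by (rule less_imp_neq[OF that(4), symmetric])
    then have "x / a = (b1 * b2) * (x / a) / (b1 * b2)" by (rule nonzero_mult_div_cancel_left[symmetric])
    also have "\<dots> = (a * c) * (x / a) / (b1 * b2)" using that(1) by simp
    also have "\<dots> = c * (x1 / b1 * (x2 / b2))" using that(2,3) by simp
    finally show ?thesis .
  qed
  ultimately show ?thesis unfolding mvn_pdf_def by blast
qed

text \<open>
  Integrating out the last coordinate first: given the others, it is Gaussian with variance \<open>1 / E\<close>,
  \<open>E\<close> being the last diagonal entry of \<open>W\<^sup>-\<^sup>1\<close>; by Cramer's rule \<open>E\<close> is the ratio of the determinants.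
\<close>

lemma mvn_pdf_normalized:
  assumes "pos_def_mat m W"
  shows "det W > 0 \<and> (\<integral>\<^sup>+z. ennreal (mvn_pdf m W z) \<partial>lborel_vec m) = 1"
  using assms
proof (induction m arbitrary: W)
  case 0
  have W: "W \<in> carrier_mat 0 0" by (rule pos_def_carrier[OF 0])
  have "det W = 1" using W by (simp add: det_dim_zero)
  moreover have "mvn_pdf 0 W z = 1" if "z \<in> carrier_vec 0" for z
    using that \<open>det W = 1\<close> by (simp add: mvn_pdf_def scalar_prod_def pos_def_minv(1)[OF 0] carrier_matD[OF pos_def_minv(1)[OF 0]])
  then have "(\<integral>\<^sup>+z. ennreal (mvn_pdf 0 W z) \<partial>lborel_vec 0) = (\<integral>\<^sup>+z. 1 \<partial>lborel_vec 0)"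
    by (intro nn_integral_cong) simp
  ultimately show ?case by (simp add: emeasure_lborel_vec_0)
next
  case (Suc m)
  note W = Suc.prems and Wc = pos_def_carrier[OF Suc.prems] and Wi = pos_def_minv[OF Suc.prems]
  \<comment> \<open>\<open>A\<close> forgets the last coordinate and \<open>N\<close> embeds it, so
    the column of \<open>N\<close> spans the kernel of \<open>A\<close>.\<close>
  define A :: "real mat" where "A = mat m (Suc m) (\<lambda>(i, j). if i = j then 1 else 0)"
  define N :: "real mat" where "N = mat (Suc m) 1 (\<lambda>(i, j). if i = m then 1 else 0)"
  have A: "A \<in> carrier_mat m (Suc m)" and N: "N \<in> carrier_mat (Suc m) 1" by (auto simp: A_def N_def)
  have rowA: "row A i = unit_vec (Suc m) i" if "i < m" for i
    using that by (intro eq_vecI) (auto simp: A_def unit_vec_def)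
  have colA: "col A i = unit_vec m i" if "i < m" for i
    using that by (intro eq_vecI) (auto simp: A_def unit_vec_def)
  have colN: "col N 0 = unit_vec (Suc m) m"
    by (intro eq_vecI) (auto simp: N_def unit_vec_def)
  have Az: "(A *\<^sub>v z) $ i = z $ i" if "z \<in> carrier_vec (Suc m)" "i < m" for z i
    using that A by (simp add: rowA)
  have AN: "A * N = 0\<^sub>m m 1"
    using A N by (intro eq_matI) (auto simp: rowA colN)
  define D where "D = A * W * transpose_mat A"
  \<comment> \<open>The covariance of the first \<open>m\<close> coordinates is the submatrix whose
    determinant is the cofactor at \<open>(m, m)\<close>; this links it to the adjugate
    below.\<close>
  have D: "D = mat_delete W m m"
  proof (rule eq_matI)
    fix i j assume "i < dim_row (mat_delete W m m)" "j < dim_col (mat_delete W m m)"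
    then have ij: "i < m" "j < m" using Wc by auto
    have "D $$ (i, j) = row (A * W) i \<bullet> row A j"
      unfolding D_def using ij A Wc by (subst index_mult_mat(1)) auto
    also have "\<dots> = (A * W) $$ (i, j)" using ij A Wc by (simp add: rowA)
    also have "\<dots> = W $$ (i, j)"
      using ij A Wc scalar_prod_left_unit[of "col W j" "Suc m" i]
      by (simp add: rowA col_carrier_vec[OF _ Wc])
    finally show "D $$ (i, j) = mat_delete W m m $$ (i, j)" using ij Wc by (simp add: mat_delete_def)
  qed (use Wc A in \<open>auto simp: D_def\<close>)
  have Dpd: "pos_def_mat m D"
    unfolding D_def
  proof (rule pos_def_congruence[OF W A])
    fix v :: "real vec" assume v: "v \<in> carrier_vec m" "transpose_mat A *\<^sub>v v = 0\<^sub>v (Suc m)"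
    show "v = 0\<^sub>v m"
    proof (rule eq_vecI)
      fix i assume "i < dim_vec (0\<^sub>v m :: real vec)"
      then have "i < m" by simp
      then have "(transpose_mat A *\<^sub>v v) $ i = v $ i" using A v(1) by (simp add: colA)
      with \<open>i < m\<close> show "v $ i = 0\<^sub>v m $ i" using v(2) by simp
    qed (use v in simp)
  qed
  define E where "E = minv W $$ (m, m)"
  have Emat: "transpose_mat N * minv W * N = mat 1 1 (\<lambda>_. E)"
  proof (rule eq_matI)
    fix i j assume "i < dim_row (mat 1 1 (\<lambda>_. E))" "j < dim_col (mat 1 1 (\<lambda>_. E))"
    then have ij: "i = 0" "j = 0" by auto
    have "(transpose_mat N * minv W * N) $$ (0, 0) = row (transpose_mat N * minv W) 0 \<bullet> unit_vec (Suc m) m"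
      using N Wi(1) by (subst index_mult_mat(1)) (auto simp: colN)
    also have "\<dots> = (transpose_mat N * minv W) $$ (0, m)"
      using N Wi(1) by (subst scalar_prod_right_unit) auto
    also have "\<dots> = unit_vec (Suc m) m \<bullet> col (minv W) m"
      using N Wi(1) by (subst index_mult_mat(1)) (auto simp: colN)
    also have "\<dots> = col (minv W) m $ m"
      by (rule scalar_prod_left_unit[OF col_carrier_vec[OF _ Wi(1)]]) auto
    also have "\<dots> = E" using Wi(1) by (simp add: E_def)
    finally show "(transpose_mat N * minv W * N) $$ (i, j) = mat 1 1 (\<lambda>_. E) $$ (i, j)" using ij by simp
  qed (use N in auto)
  have "unit_vec (Suc m) m \<bullet> (minv W *\<^sub>v unit_vec (Suc m) m) = (minv W *\<^sub>v unit_vec (Suc m) m) $ m"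
    by (rule scalar_prod_left_unit[OF mult_mat_vec_carrier[OF Wi(1)]]) auto
  also have "\<dots> = E" using Wi(1) by (simp add: E_def)
  finally have "unit_vec (Suc m) m \<bullet> (minv W *\<^sub>v unit_vec (Suc m) m) = E" .
  moreover have "unit_vec (Suc m) m \<noteq> (0\<^sub>v (Suc m) :: real vec)" by (simp add: unit_vec_nonzero)
  ultimately have E: "E > 0"
    using pos_def_minv_pos_def[OF W] unfolding pos_def_mat_def by (metis unit_vec_carrier)
  have IH: "det D > 0" "(\<integral>\<^sup>+z. ennreal (mvn_pdf m D z) \<partial>lborel_vec m) = 1"
    using Suc.IH[OF Dpd] by auto
  \<comment> \<open>The \<open>(m, m)\<close> entry of the adjugate is \<open>det D\<close>, the
    cofactor sign being \<open>(-1)^(m + m) = 1\<close>.\<close>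
  have "adj_mat W = (minv W * W) * adj_mat W" using Wi(3) adj_mat(1)[OF Wc] by simp
  also have "\<dots> = minv W * (det W \<cdot>\<^sub>m 1\<^sub>m (Suc m))"
    using assoc_mult_mat[OF Wi(1) Wc adj_mat(1)[OF Wc]] adj_mat(2)[OF Wc] by simp
  also have "\<dots> = det W \<cdot>\<^sub>m minv W"
    using Wi(1) mult_smult_distrib[OF Wi(1) one_carrier_mat] by simp
  finally have "adj_mat W $$ (m, m) = det W * E" using Wi(1) by (simp add: E_def)
  then have detD: "det D = det W * E" using Wc by (simp add: D adj_mat_def cofactor_def)
  then have detW: "det W > 0" using IH(1) E by (simp add: zero_less_mult_iff)

  define B where "B = W * transpose_mat A * minv D"
  have B: "B \<in> carrier_mat (Suc m) m" using pos_def_minv(1)[OF Dpd] Wc A by (simp add: B_def)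
  \<comment> \<open>\<open>c u\<close> is the conditional mean of the last coordinate given that the
    others are \<open>u\<close>.\<close>
  define c where "c u = vec 1 (\<lambda>_. (B *\<^sub>v u) $ m)" for u
  define G where "G = mat 1 1 (\<lambda>_. 1 / E)"
  have minvG: "minv G = mat 1 1 (\<lambda>_. E)"
    using E by (intro minv_eqI[of _ 1]) (auto simp: G_def scalar_prod_def intro!: eq_matI)
  have detG: "det G = 1 / E" by (simp add: G_def det_single)
  have z: "u @\<^sub>v (t + c u) = B *\<^sub>v u + N *\<^sub>v t" if u: "u \<in> carrier_vec m" and t: "t \<in> carrier_vec 1" for u t
  proof (rule eq_vecI)
    have "A *\<^sub>v (B *\<^sub>v u + N *\<^sub>v t) = u"
      using quadratic_form_split(1)[OF W A N AN Dpd[unfolded D_def] u t] by (simp add: B_def D_def)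
    moreover have Nm: "row N m \<bullet> t = t $ 0"
    proof -
      have "row N m = unit_vec 1 0" by (intro eq_vecI) (auto simp: N_def)
      then show ?thesis using t by simp
    qed
    fix i assume "i < dim_vec (B *\<^sub>v u + N *\<^sub>v t)"
    then have "i < m \<or> i = m" using N by auto
    ultimately show "(u @\<^sub>v (t + c u)) $ i = (B *\<^sub>v u + N *\<^sub>v t) $ i"
      using Az[of "B *\<^sub>v u + N *\<^sub>v t" i] u t N B Nm by (auto simp: c_def)
  qed (use u N B in \<open>auto simp: c_def\<close>)
  have pdf: "mvn_pdf (Suc m) W (u @\<^sub>v (t + c u)) = mvn_pdf m D u * mvn_pdf 1 G t"
    if u: "u \<in> carrier_vec m" and t: "t \<in> carrier_vec 1" for u t
  proof -
    have "mvn_pdf (Suc m) W (u @\<^sub>v (t + c u)) = sqrt (det D * det G / det W) * (mvn_pdf m D u * mvn_pdf 1 G t)"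
    proof (rule mvn_pdf_scaled_exp)
      show "(u @\<^sub>v (t + c u)) \<bullet> (minv W *\<^sub>v (u @\<^sub>v (t + c u))) = u \<bullet> (minv D *\<^sub>v u) + t \<bullet> (minv G *\<^sub>v t)"
        using quadratic_form_split(2)[OF W A N AN Dpd[unfolded D_def] u t]
        by (simp add: z[OF u t] B_def D_def minvG Emat[simplified])
    qed (use IH(1) detW E detG in auto)
    moreover have "det D * det G / det W = 1" using detD detG E detW by simp
    ultimately show ?thesis by simp
  qed
  have mG: "mvn_pdf 1 G \<in> borel_measurable (lborel_vec 1)"
    by (rule measurable_mvn_pdf) (simp add: minvG)
  have one_dim: "(\<integral>\<^sup>+t. ennreal (mvn_pdf 1 G t) \<partial>lborel_vec 1) = 1"
  proof -
    have "mvn_pdf 1 G (vec 1 (\<lambda>_. x)) = normal_density 0 (1 / sqrt E) x" for x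
      using E by (simp add: mvn_pdf_def minvG detG normal_density_def scalar_prod_def field_simps
          power2_eq_square real_sqrt_mult real_sqrt_divide)
    then have "(\<integral>\<^sup>+t. ennreal (mvn_pdf 1 G t) \<partial>lborel_vec 1) =
        (\<integral>\<^sup>+x. ennreal (normal_density 0 (1 / sqrt E) x) \<partial>lborel)"
      using mG by (subst nn_integral_lborel_vec_1) auto
    also have "\<dots> = 1"
      using prob_space.emeasure_space_1[OF prob_space_normal_density[of "1 / sqrt E" 0]] E
      by (simp add: emeasure_density)
    finally show ?thesis .
  qed
  have mW: "mvn_pdf (Suc m) W \<in> borel_measurable (lborel_vec (m + 1))"
    using measurable_mvn_pdf[OF Wi(1)] by simp
  have "(\<integral>\<^sup>+z. ennreal (mvn_pdf (Suc m) W z) \<partial>lborel_vec (m + 1)) =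
      (\<integral>\<^sup>+u. \<integral>\<^sup>+t. ennreal (mvn_pdf (Suc m) W (u @\<^sub>v t)) \<partial>lborel_vec 1 \<partial>lborel_vec m)"
    by (rule nn_integral_lborel_vec_append) (intro measurable_compose[OF mW measurable_ennreal])
  also have "\<dots> = (\<integral>\<^sup>+u. ennreal (mvn_pdf m D u) \<partial>lborel_vec m)"
  proof (rule nn_integral_cong)
    fix u assume "u \<in> space (lborel_vec m)"
    then have u: "u \<in> carrier_vec m" by simp
    \<comment> \<open>For fixed \<open>u\<close> the conditional mean is removed by translation
      invariance of the inner integral.\<close>
    have "(\<integral>\<^sup>+t. ennreal (mvn_pdf (Suc m) W (u @\<^sub>v t)) \<partial>lborel_vec 1) =
        (\<integral>\<^sup>+t. ennreal (mvn_pdf (Suc m) W (u @\<^sub>v (t + c u))) \<partial>lborel_vec 1)"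
      using u by (intro nn_integral_lborel_vec_plus[symmetric] measurable_compose[OF _ measurable_ennreal]
          measurable_compose[OF _ mW] measurable_append_vec measurable_const_vec measurable_ident_sets[OF refl])
        (auto simp: c_def)
    also have "\<dots> = (\<integral>\<^sup>+t. ennreal (mvn_pdf m D u) * ennreal (mvn_pdf 1 G t) \<partial>lborel_vec 1)"
    proof (rule nn_integral_cong)
      fix t assume "t \<in> space (lborel_vec 1)"
      then show "ennreal (mvn_pdf (Suc m) W (u @\<^sub>v (t + c u))) = ennreal (mvn_pdf m D u) * ennreal (mvn_pdf 1 G t)"
        using pdf[OF u, of t] mvn_pdf_pos[OF IH(1), of m u] by (simp add: ennreal_mult' less_imp_le)
    qed
    also have "\<dots> = ennreal (mvn_pdf m D u)"
      using mG one_dim by (subst nn_integral_cmult) auto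
    finally show "(\<integral>\<^sup>+t. ennreal (mvn_pdf (Suc m) W (u @\<^sub>v t)) \<partial>lborel_vec 1) = ennreal (mvn_pdf m D u)" .
  qed
  finally show ?case using IH(2) detW by simp
qed

lemmas det_pos_def_pos = mvn_pdf_normalized[THEN conjunct1]
lemmas nn_integral_mvn_pdf = mvn_pdf_normalized[THEN conjunct2]

subsection \<open>Linear images of Gaussian distributions\<close>

lemma measurable_ennreal_mvn_pdf:
  assumes "pos_def_mat m W"
  shows "(\<lambda>z. ennreal (mvn_pdf m W z)) \<in> borel_measurable (lborel_vec m)"
  by (intro measurable_compose[OF measurable_mvn_pdf measurable_ennreal] pos_def_minv assms)

lemma mvn_pdf_pos_def_pos: "pos_def_mat m W \<Longrightarrow> mvn_pdf k W z > 0"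
  by (intro mvn_pdf_pos det_pos_def_pos)

definition mvn :: "nat \<Rightarrow> real mat \<Rightarrow> real vec measure" where
  "mvn m W = density (lborel_vec m) (\<lambda>z. ennreal (mvn_pdf m W z))"

lemma space_mvn [simp]: "space (mvn m W) = carrier_vec m"
  by (simp add: mvn_def)

lemma sets_mvn [simp]: "sets (mvn m W) = sets (lborel_vec m)"
  by (simp add: mvn_def)

lemma emeasure_mvn:
  assumes "pos_def_mat m W" "S \<in> sets (lborel_vec m)"
  shows "emeasure (mvn m W) S = (\<integral>\<^sup>+z. ennreal (mvn_pdf m W z) * indicator S z \<partial>lborel_vec m)"
  unfolding mvn_def by (rule emeasure_density[OF measurable_ennreal_mvn_pdf[OF assms(1)] assms(2)])

lemma prob_space_mvn:
  assumes "pos_def_mat m W"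
  shows "prob_space (mvn m W)"
proof
  have "carrier_vec m \<in> sets (lborel_vec m)" using sets.top[of "lborel_vec m"] by simp
  then have "emeasure (mvn m W) (carrier_vec m) = (\<integral>\<^sup>+z. ennreal (mvn_pdf m W z) * indicator (carrier_vec m) z \<partial>lborel_vec m)"
    by (rule emeasure_mvn[OF assms])
  also have "\<dots> = (\<integral>\<^sup>+z. ennreal (mvn_pdf m W z) \<partial>lborel_vec m)"
    by (intro nn_integral_cong) simp
  finally show "emeasure (mvn m W) (space (mvn m W)) = 1"
    using nn_integral_mvn_pdf[OF assms] by simp
qed

text \<open>
  The columns of \<open>N\<close> span the kernel of \<open>A\<close>. The Jacobian of the change of coordinates need not be
  computed, because both sides have total mass 1.
\<close>

lemma distr_mvn_mult_mat:
  assumes W: "pos_def_mat m W" and A: "A \<in> carrier_mat k m" and N: "N \<in> carrier_mat m r" and m: "m = k + r"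
    and AN: "A * N = 0\<^sub>m k r"
    and injA: "\<And>v. v \<in> carrier_vec k \<Longrightarrow> transpose_mat A *\<^sub>v v = 0\<^sub>v m \<Longrightarrow> v = 0\<^sub>v k"
    and injN: "\<And>v. v \<in> carrier_vec r \<Longrightarrow> N *\<^sub>v v = 0\<^sub>v m \<Longrightarrow> v = 0\<^sub>v r"
  shows "distr (mvn m W) (lborel_vec k) (\<lambda>z. A *\<^sub>v z) = mvn k (A * W * transpose_mat A)"
proof -
  note Wc = pos_def_carrier[OF W] and Wi = pos_def_minv[OF W]
  define D where "D = A * W * transpose_mat A"
  have D: "pos_def_mat k D" unfolding D_def by (rule pos_def_congruence[OF W A injA])
  define E where "E = transpose_mat N * minv W * N"
  have E: "pos_def_mat r E"
    using pos_def_congruence[OF pos_def_minv_pos_def[OF W], of "transpose_mat N" r] N injN by (simp add: E_def)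
  \<comment> \<open>\<open>E\<close> is the precision matrix of the coordinates \<open>t\<close>
    along the kernel; \<open>mvn_pdf\<close> expects a covariance, hence \<open>G\<close>.\<close>
  define G where "G = minv E"
  have G: "pos_def_mat r G" unfolding G_def by (rule pos_def_minv_pos_def[OF E])
  have minvG: "minv G = E" unfolding G_def by (rule minv_minv[OF E])
  define B where "B = W * transpose_mat A * minv D"
  have B: "B \<in> carrier_mat m k" using Wc A pos_def_minv(1)[OF D] by (simp add: B_def)
  define J where "J = four_block_mat B N (0\<^sub>m 0 k) (0\<^sub>m 0 r)"
  have J: "J \<in> carrier_mat m m" 
    using four_block_carrier_mat[OF B zero_carrier_mat[of 0 r], of N "0\<^sub>m 0 k"] by (simp add: J_def m)
  have Jut: "J *\<^sub>v (u @\<^sub>v t) = B *\<^sub>v u + N *\<^sub>v t" if "u \<in> carrier_vec k" "t \<in> carrier_vec r" for u t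
    unfolding J_def by (rule four_block_mult_append[OF B N that])
  have AJ: "A *\<^sub>v (J *\<^sub>v (u @\<^sub>v t)) = u"
    and quad: "(J *\<^sub>v (u @\<^sub>v t)) \<bullet> (minv W *\<^sub>v (J *\<^sub>v (u @\<^sub>v t))) = u \<bullet> (minv D *\<^sub>v u) + t \<bullet> (minv G *\<^sub>v t)"
    if "u \<in> carrier_vec k" "t \<in> carrier_vec r" for u t
    using quadratic_form_split[OF W A N AN D[unfolded D_def] that]
    by (simp_all add: Jut[OF that] B_def D_def minvG E_def)
  define c where "c = sqrt (det D * det G / det W)"
  have c: "c > 0" using det_pos_def_pos[OF D] det_pos_def_pos[OF G] det_pos_def_pos[OF W] by (simp add: c_def)
  have pdf: "mvn_pdf m W (J *\<^sub>v (u @\<^sub>v t)) = c * (mvn_pdf k D u * mvn_pdf r G t)"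
    if "u \<in> carrier_vec k" "t \<in> carrier_vec r" for u t
    unfolding c_def using det_pos_def_pos[OF D] det_pos_def_pos[OF G] det_pos_def_pos[OF W] m quad[OF that]
    by (intro mvn_pdf_scaled_exp)
  \<comment> \<open>\<open>J\<close> is injective: applying \<open>A\<close> to
    \<open>J *\<^sub>v v\<close> recovers the \<open>u\<close> part, and once this is zero only
    \<open>N *\<^sub>v t\<close> remains.\<close>
  have "v = 0\<^sub>v m" if v: "v \<in> carrier_vec m" "J *\<^sub>v v = 0\<^sub>v m" for v
  proof -
    define u t where "u = vec_first v k" and "t = vec_last v r"
    have ut: "v = u @\<^sub>v t" "u \<in> carrier_vec k" "t \<in> carrier_vec r"
      using v(1) m by (auto simp: u_def t_def)
    have u: "u = 0\<^sub>v k" using AJ[OF ut(2,3)] v(2) mult_mat_zero_vec[OF A] by (simp add: ut(1))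
    have "N *\<^sub>v t = 0\<^sub>v m"
      using v(2) Jut[OF ut(2,3)] mult_mat_zero_vec[OF B] N ut(3) by (simp add: ut(1) u)
    then have "t = 0\<^sub>v r" by (rule injN[OF ut(3)])
    with ut(1) u m show ?thesis by (intro eq_vecI) auto
  qed
  note Ji = minv_inverse[OF J this]
  have WJ: "(\<lambda>v. ennreal (mvn_pdf m W v)) \<in> borel_measurable (lborel_vec m)"
    by (rule measurable_ennreal_mvn_pdf[OF W])
  have ind: "(\<lambda>v. indicator S (A *\<^sub>v v) :: ennreal) \<in> borel_measurable (lborel_vec m)" if "S \<in> sets (lborel_vec k)" for S
    by (rule measurable_compose[OF measurable_mult_mat_vec[OF A measurable_ident_sets[OF refl]] borel_measurable_indicator[OF that]])
  have subst: "(\<integral>\<^sup>+v. ennreal (mvn_pdf m W (J *\<^sub>v v)) * indicator S (A *\<^sub>v (J *\<^sub>v v)) \<partial>lborel_vec m) =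
      ennreal c * emeasure (mvn k D) S" if S: "S \<in> sets (lborel_vec k)" for S
  proof -
    have "(\<integral>\<^sup>+v. ennreal (mvn_pdf m W (J *\<^sub>v v)) * indicator S (A *\<^sub>v (J *\<^sub>v v)) \<partial>lborel_vec (k + r)) =
      (\<integral>\<^sup>+u. \<integral>\<^sup>+t. ennreal (mvn_pdf m W (J *\<^sub>v (u @\<^sub>v t))) * indicator S (A *\<^sub>v (J *\<^sub>v (u @\<^sub>v t))) \<partial>lborel_vec r \<partial>lborel_vec k)"
      using measurable_compose[OF measurable_mult_mat_vec[OF J measurable_ident_sets[OF refl]] WJ]
        measurable_compose[OF measurable_mult_mat_vec[OF J measurable_ident_sets[OF refl]] ind[OF S]] m
      by (intro nn_integral_lborel_vec_append borel_measurable_times_ennreal) auto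
    also have "\<dots> = (\<integral>\<^sup>+u. ennreal c * (ennreal (mvn_pdf k D u) * indicator S u) \<partial>lborel_vec k)"
    proof (rule nn_integral_cong)
      fix u assume "u \<in> space (lborel_vec k)"
      then have u: "u \<in> carrier_vec k" by simp
      have "(\<integral>\<^sup>+t. ennreal (mvn_pdf m W (J *\<^sub>v (u @\<^sub>v t))) * indicator S (A *\<^sub>v (J *\<^sub>v (u @\<^sub>v t))) \<partial>lborel_vec r) =
        (\<integral>\<^sup>+t. ennreal c * (ennreal (mvn_pdf k D u) * indicator S u) * ennreal (mvn_pdf r G t) \<partial>lborel_vec r)"
      proof (rule nn_integral_cong)
        fix t assume "t \<in> space (lborel_vec r)"
        then have t: "t \<in> carrier_vec r" by simp
        show "ennreal (mvn_pdf m W (J *\<^sub>v (u @\<^sub>v t))) * indicator S (A *\<^sub>v (J *\<^sub>v (u @\<^sub>v t))) =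
          ennreal c * (ennreal (mvn_pdf k D u) * indicator S u) * ennreal (mvn_pdf r G t)"
          using c mvn_pdf_pos_def_pos[OF D, of k u] mvn_pdf_pos_def_pos[OF G, of r t]
          by (simp add: pdf[OF u t] AJ[OF u t] ennreal_mult less_imp_le mult_ac)
      qed
      also have "\<dots> = ennreal c * (ennreal (mvn_pdf k D u) * indicator S u)"
        by (subst nn_integral_cmult[OF measurable_ennreal_mvn_pdf[OF G]]) (simp add: nn_integral_mvn_pdf[OF G])
      finally show "(\<integral>\<^sup>+t. ennreal (mvn_pdf m W (J *\<^sub>v (u @\<^sub>v t))) * indicator S (A *\<^sub>v (J *\<^sub>v (u @\<^sub>v t))) \<partial>lborel_vec r) =
        ennreal c * (ennreal (mvn_pdf k D u) * indicator S u)" .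
    qed
    also have "\<dots> = ennreal c * emeasure (mvn k D) S"
      unfolding emeasure_mvn[OF D S]
      by (intro nn_integral_cmult borel_measurable_times_ennreal measurable_ennreal_mvn_pdf[OF D] borel_measurable_indicator[OF S])
    finally show ?thesis by (simp add: m)
  qed
  \<comment> \<open>With the whole space as the set, \<open>c\<close> is seen to be the integral of
    the substituted density, the reciprocal of the Jacobian factor.\<close>
  have total: "(\<integral>\<^sup>+v. ennreal (mvn_pdf m W (J *\<^sub>v v)) \<partial>lborel_vec m) = ennreal c"
  proof -
    have "(\<integral>\<^sup>+v. ennreal (mvn_pdf m W (J *\<^sub>v v)) \<partial>lborel_vec m) =
      (\<integral>\<^sup>+v. ennreal (mvn_pdf m W (J *\<^sub>v v)) * indicator (carrier_vec k) (A *\<^sub>v (J *\<^sub>v v)) \<partial>lborel_vec m)"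
      using A J by (intro nn_integral_cong) auto
    also have "\<dots> = ennreal c * emeasure (mvn k D) (carrier_vec k)"
      using subst[of "carrier_vec k"] sets.top[of "lborel_vec k"] by simp
    also have "emeasure (mvn k D) (carrier_vec k) = 1"
      using prob_space.emeasure_space_1[OF prob_space_mvn[OF D]] by simp
    finally show ?thesis by simp
  qed
  have meas: "(\<lambda>z. A *\<^sub>v z) \<in> measurable (mvn m W) (lborel_vec k)"
    using measurable_mult_mat_vec[OF A measurable_ident_sets[OF refl]]
    by (simp add: mvn_def)
  show ?thesis unfolding D_def[symmetric]
  proof (rule measure_eqI)
    fix S assume "S \<in> sets (distr (mvn m W) (lborel_vec k) (\<lambda>z. A *\<^sub>v z))"
    then have S: "S \<in> sets (lborel_vec k)" by simp
    have "emeasure (distr (mvn m W) (lborel_vec k) (\<lambda>z. A *\<^sub>v z)) S =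
        emeasure (mvn m W) ((\<lambda>z. A *\<^sub>v z) -` S \<inter> carrier_vec m)"
      using emeasure_distr[OF meas S] by simp
    also have "\<dots> = (\<integral>\<^sup>+v. ennreal (mvn_pdf m W v) * indicator ((\<lambda>z. A *\<^sub>v z) -` S \<inter> carrier_vec m) v \<partial>lborel_vec m)"
      using measurable_sets[OF meas S] by (intro emeasure_mvn[OF W]) simp
    also have "\<dots> = (\<integral>\<^sup>+v. ennreal (mvn_pdf m W v) * indicator S (A *\<^sub>v v) \<partial>lborel_vec m)"
      by (intro nn_integral_cong) (auto simp: indicator_def)
    finally have eq: "emeasure (distr (mvn m W) (lborel_vec k) (\<lambda>z. A *\<^sub>v z)) S =
        (\<integral>\<^sup>+v. ennreal (mvn_pdf m W v) * indicator S (A *\<^sub>v v) \<partial>lborel_vec m)" .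
    \<comment> \<open>The substitution lemma compares the density times the indicator with the
      density alone, whose integral is 1; cancelling \<open>c\<close> leaves the claim.\<close>
    have "ennreal c * emeasure (mvn k D) S =
        ennreal c * (\<integral>\<^sup>+v. ennreal (mvn_pdf m W v) * indicator S (A *\<^sub>v v) \<partial>lborel_vec m)"
      using nn_integral_linear_substitution[OF J Ji(1,2) borel_measurable_times_ennreal[OF WJ ind[OF S]] WJ]
      unfolding subst[OF S] total nn_integral_mvn_pdf[OF W] mult_1_right .
    then show "emeasure (distr (mvn m W) (lborel_vec k) (\<lambda>z. A *\<^sub>v z)) S = emeasure (mvn k D) S"
      using c by (simp add: eq ennreal_mult_cancel_left)
  qed simp
qed

subsection \<open>Gaussian distribution functions\<close>

lemma mvn_pdf_four_block:
  assumes D: "pos_def_mat k D" and E: "pos_def_mat r E"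
    and u: "u \<in> carrier_vec k" and t: "t \<in> carrier_vec r"
  shows "mvn_pdf (k + r) (four_block_mat D (0\<^sub>m k r) (0\<^sub>m r k) E) (u @\<^sub>v t) = mvn_pdf k D u * mvn_pdf r E t"
proof -
  note Dc = pos_def_carrier[OF D] and Ec = pos_def_carrier[OF E] and Di = pos_def_minv[OF D] and Ei = pos_def_minv[OF E]
  let ?F = "four_block_mat D (0\<^sub>m k r) (0\<^sub>m r k) E"
  have det: "det ?F = det D * det E" by (rule det_four_block_diag[OF Dc Ec])
  have "mvn_pdf (k + r) ?F (u @\<^sub>v t) = sqrt (det D * det E / det ?F) * (mvn_pdf k D u * mvn_pdf r E t)"
  proof (rule mvn_pdf_scaled_exp)
    show "(u @\<^sub>v t) \<bullet> (minv ?F *\<^sub>v (u @\<^sub>v t)) = u \<bullet> (minv D *\<^sub>v u) + t \<bullet> (minv E *\<^sub>v t)"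
      unfolding minv_four_block[OF Dc Di(1,2) Ec Ei(1,2)]
      using u t Di(1) Ei(1)
      by (simp add: four_block_mat_mult_vec[OF Di(1) zero_carrier_mat zero_carrier_mat Ei(1) u t] zero_mat_mult_vec
          scalar_prod_append[of _ k _ r])
  qed (use det_pos_def_pos[OF D] det_pos_def_pos[OF E] det in auto)
  then show ?thesis using det_pos_def_pos[OF D] det_pos_def_pos[OF E] by (simp add: det)
qed

text \<open>Block-diagonal covariance expresses independence: inverse and determinant split along
  the blocks, so the density of the concatenation is the product of the densities.\<close>

lemma distr_append_mvn:
  assumes D: "pos_def_mat k D" and E: "pos_def_mat r E"
  shows "distr (mvn k D \<Otimes>\<^sub>M mvn r E) (lborel_vec (k + r)) (\<lambda>(u, t). u @\<^sub>v t) =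
    mvn (k + r) (four_block_mat D (0\<^sub>m k r) (0\<^sub>m r k) E)"
proof -
  interpret mE: prob_space "mvn r E" by (rule prob_space_mvn[OF E])
  let ?F = "four_block_mat D (0\<^sub>m k r) (0\<^sub>m r k) E"
  have "mvn k D \<Otimes>\<^sub>M mvn r E = density (lborel_vec k \<Otimes>\<^sub>M lborel_vec r) (\<lambda>(u, t). ennreal (mvn_pdf k D u) * ennreal (mvn_pdf r E t))"
    unfolding mvn_def
    by (rule pair_measure_density[OF measurable_ennreal_mvn_pdf[OF D] measurable_ennreal_mvn_pdf[OF E] sigma_finite_lborel_vec])
      (use mE.sigma_finite_measure in \<open>simp add: mvn_def\<close>)
  also have "\<dots> = density (lborel_vec k \<Otimes>\<^sub>M lborel_vec r) (\<lambda>p. ennreal (mvn_pdf (k + r) ?F (case p of (u, t) \<Rightarrow> u @\<^sub>v t)))"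
  proof (rule density_cong)
    show "(\<lambda>(u, t). ennreal (mvn_pdf k D u) * ennreal (mvn_pdf r E t)) \<in> borel_measurable (lborel_vec k \<Otimes>\<^sub>M lborel_vec r)"
      unfolding split_beta
      by (intro borel_measurable_times_ennreal measurable_compose[OF measurable_fst measurable_ennreal_mvn_pdf[OF D]]
          measurable_compose[OF measurable_snd measurable_ennreal_mvn_pdf[OF E]])
    show "(\<lambda>p. ennreal (mvn_pdf (k + r) ?F (case p of (u, t) \<Rightarrow> u @\<^sub>v t))) \<in> borel_measurable (lborel_vec k \<Otimes>\<^sub>M lborel_vec r)"
      by (rule measurable_compose[OF measurable_append_vec_pair measurable_ennreal_mvn_pdf[OF pos_def_four_block[OF D E]]])
    show "AE p in lborel_vec k \<Otimes>\<^sub>M lborel_vec r. (case p of (u, t) \<Rightarrow> ennreal (mvn_pdf k D u) * ennreal (mvn_pdf r E t)) =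
        ennreal (mvn_pdf (k + r) ?F (case p of (u, t) \<Rightarrow> u @\<^sub>v t))"
    proof (rule AE_I2)
      fix p assume "p \<in> space (lborel_vec k \<Otimes>\<^sub>M lborel_vec r)"
      then obtain u t where "p = (u, t)" "u \<in> carrier_vec k" "t \<in> carrier_vec r" by (auto simp: space_pair_measure)
      then show "(case p of (u, t) \<Rightarrow> ennreal (mvn_pdf k D u) * ennreal (mvn_pdf r E t)) =
        ennreal (mvn_pdf (k + r) ?F (case p of (u, t) \<Rightarrow> u @\<^sub>v t))"
        by (simp add: mvn_pdf_four_block[OF D E] ennreal_mult less_imp_le mvn_pdf_pos_def_pos[OF D] mvn_pdf_pos_def_pos[OF E])
    qed
  qed
  finally have "distr (mvn k D \<Otimes>\<^sub>M mvn r E) (lborel_vec (k + r)) (\<lambda>(u, t). u @\<^sub>v t) =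
    distr (density (lborel_vec k \<Otimes>\<^sub>M lborel_vec r) (\<lambda>p. ennreal (mvn_pdf (k + r) ?F (case p of (u, t) \<Rightarrow> u @\<^sub>v t))))
      (lborel_vec (k + r)) (\<lambda>(u, t). u @\<^sub>v t)" by simp
  also have "\<dots> = density (distr (lborel_vec k \<Otimes>\<^sub>M lborel_vec r) (lborel_vec (k + r)) (\<lambda>(u, t). u @\<^sub>v t))
      (\<lambda>v. ennreal (mvn_pdf (k + r) ?F v))"
    by (rule density_distr[symmetric, OF measurable_ennreal_mvn_pdf[OF pos_def_four_block[OF D E]] measurable_append_vec_pair])
  finally show ?thesis by (simp add: distr_append_lborel_vec mvn_def)
qed

definition orthant :: "nat \<Rightarrow> real vec \<Rightarrow> real vec set" where
  "orthant m u = {z \<in> carrier_vec m. \<forall>i<m. z $ i \<le> u $ i}"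

lemma orthant_carrier: "z \<in> orthant m u \<Longrightarrow> z \<in> carrier_vec m"
  by (simp add: orthant_def)

lemma mvn_cdf_eq: "mvn_cdf m W u = measure (mvn m W) (orthant m u)"
  by (simp add: mvn_cdf_def mvn_def orthant_def)

lemma sets_orthant: "orthant m u \<in> sets (lborel_vec m)"
proof -
  have "orthant m u = {z \<in> carrier_vec m. \<forall>i<m. z $ i \<in> {..u $ i}}" by (auto simp: orthant_def)
  then show ?thesis using sets_box_lborel_vec[of m "\<lambda>i. {..u $ i}"] by (simp only: atMost_borel)
qed

lemma emeasure_mvn_orthant:
  assumes "pos_def_mat m W"
  shows "emeasure (mvn m W) (orthant m u) = ennreal (mvn_cdf m W u)"
proof -
  interpret prob_space "mvn m W" by (rule prob_space_mvn[OF assms])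
  show ?thesis by (simp add: mvn_cdf_eq emeasure_eq_measure)
qed

lemma mvn_cdf_nonneg: "mvn_cdf m W u \<ge> 0"
  by (simp add: mvn_cdf_eq)

text \<open>The box of unit side below \<open>u\<close> has Lebesgue measure 1 and lies in the
  orthant, and the density is positive everywhere. Positivity is what allows division by the
  normalizing constant of the posterior.\<close>

lemma mvn_cdf_pos:
  assumes W: "pos_def_mat m W"
  shows "mvn_cdf m W u > 0"
proof -
  interpret prob_space "mvn m W" by (rule prob_space_mvn[OF W])
  have "emeasure (lborel_vec m) {v \<in> carrier_vec m. \<forall>i<m. v $ i \<in> {u $ i - 1..u $ i}} = (\<Prod>i<m. 1)"
    by (subst emeasure_box_lborel_vec) auto
  also have "(\<Prod>i<m. 1 :: ennreal) = 1" by simp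
  finally have one: "emeasure (lborel_vec m) {v \<in> carrier_vec m. \<forall>i<m. v $ i \<in> {u $ i - 1..u $ i}} = 1" .
  have "{v \<in> carrier_vec m. \<forall>i<m. v $ i \<in> {u $ i - 1..u $ i}} \<subseteq> orthant m u"
    by (auto simp: orthant_def)
  from emeasure_mono[OF this sets_orthant] have "emeasure (lborel_vec m) (orthant m u) \<ge> 1"
    unfolding one .
  then have "orthant m u \<notin> null_sets (lborel_vec m)" by (auto simp: null_sets_def)
  moreover have "AE v in lborel_vec m. v \<notin> orthant m u" if "emeasure (mvn m W) (orthant m u) = 0"
  proof -
    have "(\<integral>\<^sup>+z. ennreal (mvn_pdf m W z) * indicator (orthant m u) z \<partial>lborel_vec m) = 0"
      using that emeasure_mvn[OF W sets_orthant] by simp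
    then have "AE z in lborel_vec m. ennreal (mvn_pdf m W z) * indicator (orthant m u) z = 0"
      by (subst (asm) nn_integral_0_iff_AE)
        (intro borel_measurable_times_ennreal measurable_ennreal_mvn_pdf[OF W] borel_measurable_indicator[OF sets_orthant])
    then show ?thesis
    proof eventually_elim
      case (elim z)
      then show ?case using mvn_pdf_pos_def_pos[OF W, of m z]
        by (auto simp: indicator_def ennreal_eq_0_iff split: if_splits)
    qed
  qed
  ultimately have "emeasure (mvn m W) (orthant m u) \<noteq> 0"
    using AE_iff_null_sets[OF sets_orthant] by blast
  then show ?thesis
    using mvn_cdf_nonneg[of m W u] by (simp add: emeasure_mvn_orthant[OF W] less_le)
qed

lemma append_in_orthant_iff:
  assumes "u \<in> carrier_vec k" "v \<in> carrier_vec r" "a \<in> carrier_vec k" "b \<in> carrier_vec r"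
  shows "a @\<^sub>v b \<in> orthant (k + r) (u @\<^sub>v v) \<longleftrightarrow> a \<in> orthant k u \<and> b \<in> orthant r v"
proof -
  have "(\<forall>i<k + r. (a @\<^sub>v b) $ i \<le> (u @\<^sub>v v) $ i) \<longleftrightarrow> (\<forall>i<k. a $ i \<le> u $ i) \<and> (\<forall>i<r. b $ i \<le> v $ i)" (is "?l \<longleftrightarrow> ?r")
  proof
    assume ?l
    show ?r
    proof (intro conjI allI impI)
      fix i show "i < k \<Longrightarrow> a $ i \<le> u $ i" "i < r \<Longrightarrow> b $ i \<le> v $ i"
        using \<open>?l\<close>[rule_format, of i] \<open>?l\<close>[rule_format, of "k + i"] assms by auto
    qed
  next
    assume ?r
    then show ?l using assms by auto
  qed
  then show ?thesis using assms by (simp add: orthant_def)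
qed

lemma mvn_cdf_four_block:
  assumes D: "pos_def_mat k D" and E: "pos_def_mat r E"
    and u: "u \<in> carrier_vec k" and v: "v \<in> carrier_vec r"
  shows "mvn_cdf (k + r) (four_block_mat D (0\<^sub>m k r) (0\<^sub>m r k) E) (u @\<^sub>v v) = mvn_cdf k D u * mvn_cdf r E v"
proof -
  interpret D: prob_space "mvn k D" by (rule prob_space_mvn[OF D])
  interpret E: prob_space "mvn r E" by (rule prob_space_mvn[OF E])
  let ?F = "four_block_mat D (0\<^sub>m k r) (0\<^sub>m r k) E"
  have meas: "(\<lambda>(u, t). u @\<^sub>v t) \<in> measurable (mvn k D \<Otimes>\<^sub>M mvn r E) (lborel_vec (k + r))"
    by (subst measurable_cong_sets[OF sets_pair_measure_cong[OF sets_mvn[of k D] sets_mvn[of r E]] refl])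
      (rule measurable_append_vec_pair)
  have "ennreal (mvn_cdf (k + r) ?F (u @\<^sub>v v)) = emeasure (mvn (k + r) ?F) (orthant (k + r) (u @\<^sub>v v))"
    by (rule emeasure_mvn_orthant[OF pos_def_four_block[OF D E], symmetric])
  also have "\<dots> = emeasure (mvn k D \<Otimes>\<^sub>M mvn r E) ((\<lambda>(u, t). u @\<^sub>v t) -` orthant (k + r) (u @\<^sub>v v) \<inter> space (mvn k D \<Otimes>\<^sub>M mvn r E))"
    unfolding distr_append_mvn[OF D E, symmetric] by (rule emeasure_distr[OF meas sets_orthant])
  also have "(\<lambda>(u, t). u @\<^sub>v t) -` orthant (k + r) (u @\<^sub>v v) \<inter> space (mvn k D \<Otimes>\<^sub>M mvn r E) = orthant k u \<times> orthant r v"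
    using append_in_orthant_iff[OF u v] orthant_carrier[of _ k u] orthant_carrier[of _ r v]
    by (auto simp: space_pair_measure)
  also have "emeasure (mvn k D \<Otimes>\<^sub>M mvn r E) \<dots> = ennreal (mvn_cdf k D u) * ennreal (mvn_cdf r E v)"
    by (subst E.emeasure_pair_measure_Times) (simp_all add: sets_orthant emeasure_mvn_orthant[OF D] emeasure_mvn_orthant[OF E])
  finally show ?thesis by (simp add: mvn_cdf_nonneg flip: ennreal_mult)
qed

lemma mvn_cdf_mult_mat:
  assumes W: "pos_def_mat m W" and A: "A \<in> carrier_mat k m" and N: "N \<in> carrier_mat m r" and m: "m = k + r"
    and AN: "A * N = 0\<^sub>m k r"
    and injA: "\<And>v. v \<in> carrier_vec k \<Longrightarrow> transpose_mat A *\<^sub>v v = 0\<^sub>v m \<Longrightarrow> v = 0\<^sub>v k"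
    and injN: "\<And>v. v \<in> carrier_vec r \<Longrightarrow> N *\<^sub>v v = 0\<^sub>v m \<Longrightarrow> v = 0\<^sub>v r"
  shows "mvn_cdf k (A * W * transpose_mat A) u = measure (mvn m W) {z \<in> carrier_vec m. A *\<^sub>v z \<in> orthant k u}"
proof -
  have meas: "(\<lambda>z. A *\<^sub>v z) \<in> measurable (mvn m W) (lborel_vec k)"
    using measurable_mult_mat_vec[OF A measurable_ident_sets[OF refl]]
    by (simp add: mvn_def)
  have "mvn_cdf k (A * W * transpose_mat A) u = measure (mvn m W) ((\<lambda>z. A *\<^sub>v z) -` orthant k u \<inter> space (mvn m W))"
    using measure_distr[OF meas sets_orthant] by (simp add: mvn_cdf_eq distr_mvn_mult_mat[OF assms])
  also have "(\<lambda>z. A *\<^sub>v z) -` orthant k u \<inter> space (mvn m W) = {z \<in> carrier_vec m. A *\<^sub>v z \<in> orthant k u}" by auto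
  finally show ?thesis .
qed

text \<open>
  Both sides are the probability that \<open>z - X b \<le> 0\<close> for independent \<open>b \<sim> N(0, W)\<close> and \<open>z \<sim> N(0, \<Lambda>)\<close>.
\<close>

lemma mvn_cdf_marginalize:
  assumes W: "pos_def_mat q W" and \<Lambda>: "pos_def_mat h \<Lambda>" and X: "X \<in> carrier_mat h q"
  shows "pos_def_mat h (X * W * transpose_mat X + \<Lambda>)"
    and "(\<lambda>b. ennreal (mvn_cdf h \<Lambda> (X *\<^sub>v b))) \<in> borel_measurable (lborel_vec q)"
    and "(\<integral>\<^sup>+b. ennreal (mvn_pdf q W b) * ennreal (mvn_cdf h \<Lambda> (X *\<^sub>v b)) \<partial>lborel_vec q) =
      ennreal (mvn_cdf h (X * W * transpose_mat X + \<Lambda>) (0\<^sub>v h))"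
proof -
  note Wc = pos_def_carrier[OF W] and \<Lambda>c = pos_def_carrier[OF \<Lambda>]
  have X': "- transpose_mat X \<in> carrier_mat q h" and XT: "transpose_mat X \<in> carrier_mat q h" using X by auto
  define F where "F = four_block_mat W (0\<^sub>m q h) (0\<^sub>m h q) \<Lambda>"
  have F: "pos_def_mat (q + h) F" unfolding F_def by (rule pos_def_four_block[OF W \<Lambda>])
  have Fc: "F \<in> carrier_mat (q + h) (q + h)" by (rule pos_def_carrier[OF F])
  \<comment> \<open>\<open>A\<close> maps the concatenation of \<open>b\<close> and \<open>z\<close>
    to \<open>z - X b\<close>. Its kernel is the graph of \<open>X\<close>, spanned by the columns
    of \<open>N\<close>. As \<open>@\<^sub>r\<close> stacks vertically, the horizontal
    \<open>A\<close> is written as a transpose.\<close>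
  define A where "A = transpose_mat (- transpose_mat X @\<^sub>r 1\<^sub>m h)"
  define N where "N = 1\<^sub>m q @\<^sub>r X"
  have AT: "transpose_mat A = - transpose_mat X @\<^sub>r 1\<^sub>m h" by (simp add: A_def)
  have ATc: "- transpose_mat X @\<^sub>r 1\<^sub>m h \<in> carrier_mat (q + h) h" by (rule carrier_append_rows[OF X' one_carrier_mat])
  have A: "A \<in> carrier_mat h (q + h)" unfolding A_def using ATc by (rule transpose_carrier_mat[THEN iffD2])
  have N: "N \<in> carrier_mat (q + h) q" unfolding N_def by (rule carrier_append_rows[OF one_carrier_mat X])
  have uXT: "- transpose_mat X *\<^sub>v v = - (transpose_mat X *\<^sub>v v)" if "v \<in> carrier_vec h" for v
    using that X by (intro eq_vecI) auto
  have ATv: "transpose_mat A *\<^sub>v v = - (transpose_mat X *\<^sub>v v) @\<^sub>v v" if "v \<in> carrier_vec h" for v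
    unfolding AT using mat_mult_append[OF X' one_carrier_mat that] that by (simp add: uXT)
  have Nv: "N *\<^sub>v v = v @\<^sub>v (X *\<^sub>v v)" if "v \<in> carrier_vec q" for v
    unfolding N_def using mat_mult_append[OF one_carrier_mat X that] that by simp
  have Aut: "A *\<^sub>v (u @\<^sub>v t) = t - X *\<^sub>v u" if "u \<in> carrier_vec q" "t \<in> carrier_vec h" for u t
  proof -
    have "transpose_mat (- transpose_mat X) *\<^sub>v u = - (X *\<^sub>v u)"
      using that X by (intro eq_vecI) auto
    then have "A *\<^sub>v (u @\<^sub>v t) = - (X *\<^sub>v u) + t"
      unfolding A_def using transpose_append_rows_mult_vec[OF X' one_carrier_mat that] that by simp
    also have "\<dots> = t - X *\<^sub>v u" using that X by (intro eq_vecI) auto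
    finally show ?thesis .
  qed
  have AN: "A * N = 0\<^sub>m h q"
  proof (rule mat_eq_mult_vecI)
    fix v :: "real vec" assume v: "v \<in> carrier_vec q"
    have "A * N *\<^sub>v v = A *\<^sub>v (N *\<^sub>v v)" by (rule assoc_mult_mat_vec[OF A N v])
    also have "\<dots> = X *\<^sub>v v - X *\<^sub>v v" using v X by (simp add: Nv Aut)
    finally show "A * N *\<^sub>v v = 0\<^sub>m h q *\<^sub>v v" using v X by (simp add: zero_mat_mult_vec)
  qed (use A N in auto)
  have injA: "v = 0\<^sub>v h" if v: "v \<in> carrier_vec h" "transpose_mat A *\<^sub>v v = 0\<^sub>v (q + h)" for v
  proof -
    have "v $ i = 0" if "i < h" for i
    proof -
      have "v $ i = (- (transpose_mat X *\<^sub>v v) @\<^sub>v v) $ (q + i)" using that v(1) X by simp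
      also have "\<dots> = 0" using v(2) that unfolding ATv[OF v(1)] by simp
      finally show ?thesis .
    qed
    then show ?thesis using v(1) by (intro eq_vecI) auto
  qed
  have injN: "v = 0\<^sub>v q" if v: "v \<in> carrier_vec q" "N *\<^sub>v v = 0\<^sub>v (q + h)" for v
  proof -
    have "v $ i = 0" if "i < q" for i
    proof -
      have "v $ i = (v @\<^sub>v (X *\<^sub>v v)) $ i" using that v(1) X by simp
      also have "\<dots> = 0" using v(2) that unfolding Nv[OF v(1)] by simp
      finally show ?thesis .
    qed
    then show ?thesis using v(1) by (intro eq_vecI) auto
  qed
  have cov: "A * F * transpose_mat A = X * W * transpose_mat X + \<Lambda>"
  proof (rule mat_eq_mult_vecI)
    fix v :: "real vec" assume v: "v \<in> carrier_vec h"
    define w where "w = transpose_mat X *\<^sub>v v"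
    have w: "w \<in> carrier_vec q" using X v by (simp add: w_def)
    have ATvc: "transpose_mat A *\<^sub>v v \<in> carrier_vec (q + h)" using A v by simp
    have "A * F * transpose_mat A *\<^sub>v v = A *\<^sub>v (F *\<^sub>v (transpose_mat A *\<^sub>v v))"
      using assoc_mult_mat_vec[OF mult_carrier_mat[OF A Fc] _ v, of "transpose_mat A"] assoc_mult_mat_vec[OF A Fc ATvc] A
      by simp
    also have "F *\<^sub>v (transpose_mat A *\<^sub>v v) = (W *\<^sub>v (- w)) @\<^sub>v (\<Lambda> *\<^sub>v v)"
      unfolding ATv[OF v] w_def[symmetric] F_def using w v Wc \<Lambda>c
      by (simp add: four_block_mat_mult_vec[OF Wc zero_carrier_mat zero_carrier_mat \<Lambda>c] zero_mat_mult_vec)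
    also have "A *\<^sub>v \<dots> = \<Lambda> *\<^sub>v v - X *\<^sub>v (W *\<^sub>v (- w))" using Wc \<Lambda>c w v by (intro Aut) auto
    also have "\<dots> = \<Lambda> *\<^sub>v v + X *\<^sub>v (W *\<^sub>v w)"
    proof -
      have "X *\<^sub>v (W *\<^sub>v (- w)) = - (X *\<^sub>v (W *\<^sub>v w))"
        using mult_mat_uminus_vec[OF Wc w] mult_mat_uminus_vec[OF X, of "W *\<^sub>v w"] Wc w by simp
      then show ?thesis using X Wc \<Lambda>c w v by (intro eq_vecI) auto
    qed
    also have "\<dots> = (X * W * transpose_mat X + \<Lambda>) *\<^sub>v v"
    proof -
      have "(X * W * transpose_mat X) *\<^sub>v v = X *\<^sub>v (W *\<^sub>v w)"
        using assoc_mult_mat_vec[OF mult_carrier_mat[OF X Wc] XT v] assoc_mult_mat_vec[OF X Wc w] by (simp add: w_def)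
      moreover have "(X * W * transpose_mat X + \<Lambda>) *\<^sub>v v = (X * W * transpose_mat X) *\<^sub>v v + \<Lambda> *\<^sub>v v"
        by (rule add_mult_distrib_mat_vec[of _ h h]) (use X Wc \<Lambda>c v in auto)
      ultimately show ?thesis
        using X Wc \<Lambda>c w v by (simp add: comm_add_vec[of "\<Lambda> *\<^sub>v v" h "X *\<^sub>v (W *\<^sub>v w)"])
    qed
    finally show "A * F * transpose_mat A *\<^sub>v v = (X * W * transpose_mat X + \<Lambda>) *\<^sub>v v" .
  qed (use A Fc X Wc \<Lambda>c in auto)
  show "pos_def_mat h (X * W * transpose_mat X + \<Lambda>)"
    using pos_def_congruence[OF F A injA] by (simp add: cov)
  interpret mvn\<Lambda>: prob_space "mvn h \<Lambda>" by (rule prob_space_mvn[OF \<Lambda>])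
  interpret mvnW: prob_space "mvn q W" by (rule prob_space_mvn[OF W])
  interpret mvnF: prob_space "mvn (q + h) F" by (rule prob_space_mvn[OF F])
  let ?S = "{z \<in> carrier_vec (q + h). A *\<^sub>v z \<in> orthant h (0\<^sub>v h)}"
  have S: "?S \<in> sets (lborel_vec (q + h))"
  proof -
    have "(\<lambda>z. A *\<^sub>v z) -` orthant h (0\<^sub>v h) \<inter> space (lborel_vec (q + h)) \<in> sets (lborel_vec (q + h))"
      by (rule measurable_sets[OF measurable_mult_mat_vec[OF A measurable_ident_sets[OF refl]] sets_orthant])
    also have "(\<lambda>z. A *\<^sub>v z) -` orthant h (0\<^sub>v h) \<inter> space (lborel_vec (q + h)) = ?S" by auto
    finally show ?thesis .
  qed
  have meas: "(\<lambda>(u, t). u @\<^sub>v t) \<in> measurable (mvn q W \<Otimes>\<^sub>M mvn h \<Lambda>) (lborel_vec (q + h))"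
    by (subst measurable_cong_sets[OF sets_pair_measure_cong[OF sets_mvn[of q W] sets_mvn[of h \<Lambda>]] refl])
      (rule measurable_append_vec_pair)
  have T: "(\<lambda>(u, t). u @\<^sub>v t) -` ?S \<inter> space (mvn q W \<Otimes>\<^sub>M mvn h \<Lambda>) \<in> sets (mvn q W \<Otimes>\<^sub>M mvn h \<Lambda>)"
    by (rule measurable_sets[OF meas S])
  have slice: "Pair b -` ((\<lambda>(u, t). u @\<^sub>v t) -` ?S \<inter> space (mvn q W \<Otimes>\<^sub>M mvn h \<Lambda>)) = orthant h (X *\<^sub>v b)"
    if b: "b \<in> carrier_vec q" for b
  proof -
    have "A *\<^sub>v (b @\<^sub>v t) \<in> orthant h (0\<^sub>v h) \<longleftrightarrow> t \<in> orthant h (X *\<^sub>v b)" if "t \<in> carrier_vec h" for t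
      unfolding Aut[OF b that] using that X b by (auto simp: orthant_def)
    then show ?thesis using b by (auto simp: space_pair_measure dest: orthant_carrier)
  qed
  \<comment> \<open>For fixed \<open>b\<close> the section of the event is the orthant below
    \<open>X *\<^sub>v b\<close>, so measurability in \<open>b\<close> is that of section
    measures.\<close>
  have cdf_meas: "(\<lambda>b. ennreal (mvn_cdf h \<Lambda> (X *\<^sub>v b))) \<in> borel_measurable (lborel_vec q)"
  proof -
    have "(\<lambda>b. emeasure (mvn h \<Lambda>) (Pair b -` ((\<lambda>(u, t). u @\<^sub>v t) -` ?S \<inter> space (mvn q W \<Otimes>\<^sub>M mvn h \<Lambda>)))) \<in> borel_measurable (mvn q W)"
      by (rule mvn\<Lambda>.measurable_emeasure_Pair[OF T])
    then have "(\<lambda>b. emeasure (mvn h \<Lambda>) (Pair b -` ((\<lambda>(u, t). u @\<^sub>v t) -` ?S \<inter> space (mvn q W \<Otimes>\<^sub>M mvn h \<Lambda>)))) \<in> borel_measurable (lborel_vec q)"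
      by (simp add: mvn_def)
    then show ?thesis
      by (rule measurable_cong[THEN iffD1, rotated]) (simp only: space_lborel_vec slice emeasure_mvn_orthant[OF \<Lambda>])
  qed
  show "(\<lambda>b. ennreal (mvn_cdf h \<Lambda> (X *\<^sub>v b))) \<in> borel_measurable (lborel_vec q)"
    by (rule cdf_meas)
  have "ennreal (mvn_cdf h (X * W * transpose_mat X + \<Lambda>) (0\<^sub>v h)) = emeasure (mvn (q + h) F) ?S"
    unfolding mvnF.emeasure_eq_measure
    using mvn_cdf_mult_mat[OF F A N add.commute AN injA injN, of "0\<^sub>v h"] unfolding cov by (rule arg_cong)
  also have "\<dots> = emeasure (mvn q W \<Otimes>\<^sub>M mvn h \<Lambda>) ((\<lambda>(u, t). u @\<^sub>v t) -` ?S \<inter> space (mvn q W \<Otimes>\<^sub>M mvn h \<Lambda>))"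
    unfolding F_def distr_append_mvn[OF W \<Lambda>, symmetric] by (rule emeasure_distr[OF meas S])
  also have "\<dots> = (\<integral>\<^sup>+b. emeasure (mvn h \<Lambda>) (Pair b -` ((\<lambda>(u, t). u @\<^sub>v t) -` ?S \<inter> space (mvn q W \<Otimes>\<^sub>M mvn h \<Lambda>))) \<partial>mvn q W)"
    by (rule mvn\<Lambda>.emeasure_pair_measure_alt[OF T])
  also have "\<dots> = (\<integral>\<^sup>+b. ennreal (mvn_cdf h \<Lambda> (X *\<^sub>v b)) \<partial>mvn q W)"
    by (intro nn_integral_cong) (simp only: space_mvn slice emeasure_mvn_orthant[OF \<Lambda>])
  also have "\<dots> = (\<integral>\<^sup>+b. ennreal (mvn_pdf q W b) * ennreal (mvn_cdf h \<Lambda> (X *\<^sub>v b)) \<partial>lborel_vec q)"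
    unfolding mvn_def by (rule nn_integral_density[OF measurable_ennreal_mvn_pdf[OF W] cdf_meas])
  finally show "(\<integral>\<^sup>+b. ennreal (mvn_pdf q W b) * ennreal (mvn_cdf h \<Lambda> (X *\<^sub>v b)) \<partial>lborel_vec q) =
      ennreal (mvn_cdf h (X * W * transpose_mat X + \<Lambda>) (0\<^sub>v h))" ..
qed

text \<open>Scaling by positive factors preserves the componentwise order, so the rescaled orthant
  pulls back to the original one.\<close>

lemma mvn_cdf_diag_scale:
  assumes W: "pos_def_mat h W" and r: "\<And>i. i < h \<Longrightarrow> r i > 0" and u: "u \<in> carrier_vec h"
  shows "mvn_cdf h (diag_of h r * W * diag_of h r) (diag_of h r *\<^sub>v u) = mvn_cdf h W u"
proof -
  have inj: "v = 0\<^sub>v h" if "v \<in> carrier_vec h" "diag_of h r *\<^sub>v v = 0\<^sub>v h" for v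
  proof (rule diag_of_mult_vec_inj[OF _ that])
    show "r i \<noteq> 0" if "i < h" for i using r[OF that] by simp
  qed
  \<comment> \<open>An invertible map leaves no complementary coordinates: the matrix spanning its
    kernel has zero columns.\<close>
  have "mvn_cdf h (diag_of h r * W * transpose_mat (diag_of h r)) (diag_of h r *\<^sub>v u) =
      measure (mvn h W) {z \<in> carrier_vec h. diag_of h r *\<^sub>v z \<in> orthant h (diag_of h r *\<^sub>v u)}"
  proof (rule mvn_cdf_mult_mat[OF W diag_of_carrier zero_carrier_mat[of h 0]])
    show "diag_of h r * 0\<^sub>m h 0 = 0\<^sub>m h 0" by (intro eq_matI) auto
    show "v = 0\<^sub>v 0" if "v \<in> carrier_vec 0" for v :: "real vec" using that by (intro eq_vecI) auto
  qed (use inj in auto)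
  also have "{z \<in> carrier_vec h. diag_of h r *\<^sub>v z \<in> orthant h (diag_of h r *\<^sub>v u)} = orthant h u"
  proof -
    have "diag_of h r *\<^sub>v z \<in> orthant h (diag_of h r *\<^sub>v u) \<longleftrightarrow> z \<in> orthant h u" if z: "z \<in> carrier_vec h" for z
      using z mult_mat_vec_carrier[OF diag_of_carrier z, of r] diag_of_mult_vec[OF z, of _ r] diag_of_mult_vec[OF u, of _ r] r
      by (simp add: orthant_def del: index_mult_mat_vec)
    then show ?thesis using orthant_carrier by blast
  qed
  finally show ?thesis by (simp add: mvn_cdf_eq)
qed

text \<open>Utilities are compared strictly, which leads to open orthants, whereas
  \<open>mvn_cdf\<close> measures closed ones. They differ only inside finitely many hyperplanes,
  which are null.\<close>

lemma measure_mvn_strict_orthant: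
  assumes W: "pos_def_mat m W"
  shows "{z \<in> carrier_vec m. \<forall>i<m. z $ i < u $ i} \<in> sets (lborel_vec m)"
    and "measure (mvn m W) {z \<in> carrier_vec m. \<forall>i<m. z $ i < u $ i} = mvn_cdf m W u"
proof -
  let ?S = "{z \<in> carrier_vec m. \<forall>i<m. z $ i < u $ i}"
  have "?S = {z \<in> carrier_vec m. \<forall>i<m. z $ i \<in> {..<u $ i}}" by auto
  then show S: "?S \<in> sets (lborel_vec m)"
    using sets_box_lborel_vec[of m "\<lambda>i. {..<u $ i}"] by (simp only: lessThan_borel)
  have "AE z in lborel_vec m. z $ i \<noteq> u $ i" if i: "i < m" for i
  proof -
    \<comment> \<open>The hyperplane is a box with one side reduced to a point, so the product of
      side lengths has a zero factor.\<close>
    define A where "A j = (if j = i then {u $ i} else UNIV)" for j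
    have A: "A j \<in> sets borel" for j by (simp add: A_def)
    have "{z \<in> carrier_vec m. z $ i = u $ i} = {z \<in> carrier_vec m. \<forall>j<m. z $ j \<in> A j}"
      using i by (auto simp: A_def)
    moreover have "(\<Prod>j<m. emeasure lborel (A j)) = 0"
      using i by (intro prod_zero) (auto simp: A_def)
    ultimately have "{z \<in> carrier_vec m. z $ i = u $ i} \<in> null_sets (lborel_vec m)"
      using emeasure_box_lborel_vec[of m A, OF A] sets_box_lborel_vec[of m A, OF A] by (simp only: null_setsI)
    from AE_not_in[OF this] show ?thesis
      by (rule AE_mp) (rule AE_I2, simp)
  qed
  then have "AE z in lborel_vec m. \<forall>i\<in>{..<m}. z $ i \<noteq> u $ i"
    by (intro AE_finite_allI) auto
  then have "AE z in mvn m W. \<forall>i\<in>{..<m}. z $ i \<noteq> u $ i"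
    unfolding mvn_def AE_density[OF measurable_ennreal_mvn_pdf[OF W]] by eventually_elim simp
  then have "measure (mvn m W) ?S = measure (mvn m W) (orthant m u)"
  proof (rule measure_eq_AE[OF AE_mp _ _])
    show "AE z in mvn m W. (\<forall>i\<in>{..<m}. z $ i \<noteq> u $ i) \<longrightarrow> (z \<in> ?S) = (z \<in> orthant m u)"
      by (rule AE_I2) (auto simp: orthant_def less_le)
    show "?S \<in> sets (mvn m W)" unfolding sets_mvn by (rule S)
    show "orthant m u \<in> sets (mvn m W)" unfolding sets_mvn by (rule sets_orthant)
  qed
  then show "measure (mvn m W) ?S = mvn_cdf m W u" by (simp only: mvn_cdf_eq)
qed

subsection \<open>The matrices of the multinomial probit model\<close>

text \<open>\<open>insert_index l\<close> enumerates increasingly the categories other than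
  \<open>l\<close>: it fixes the indices below \<open>l\<close> and raises the others by one. Row
  \<open>r\<close> of \<open>V_mat L l\<close> thus compares category
  \<open>insert_index l r\<close> with \<open>l\<close>.\<close>

lemma filter_neq_upt:
  assumes "l < L"
  shows "filter (\<lambda>k. k \<noteq> l) [0..<L] = map (insert_index l) [0..<L - 1]"
proof -
  have "[0..<L] = [0..<l] @ l # [Suc l..<L]"
    using assms by (metis append_Cons le_add_diff_inverse less_imp_le upt_add_eq_append upt_conv_Cons zero_le add.left_neutral)
  then have "filter (\<lambda>k. k \<noteq> l) [0..<L] = [0..<l] @ [Suc l..<L]"
    by (simp add: filter_id_conv)
  also have "\<dots> = map (insert_index l) [0..<L - 1]"
  proof (rule nth_equalityI)
    fix i assume "i < length ([0..<l] @ [Suc l..<L])"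
    then show "([0..<l] @ [Suc l..<L]) ! i = map (insert_index l) [0..<L - 1] ! i"
      using assms by (auto simp: nth_append insert_index_def)
  qed (use assms in auto)
  finally show ?thesis .
qed

lemma V_mat_carrier:
  assumes "l < L" shows "V_mat L l \<in> carrier_mat (L - 1) L"
  using assms by (simp add: V_mat_def filter_neq_upt mat_of_rows_def)

lemma V_mat_index:
  assumes "l < L" "r < L - 1" "j < L"
  shows "V_mat L l $$ (r, j) = (if j = insert_index l r then 1 else 0) - (if j = l then 1 else 0)"
  using assms by (auto simp: V_mat_def filter_neq_upt mat_of_rows_index unit_vec_def)

lemma insert_index_less: "l < L \<Longrightarrow> r < L - 1 \<Longrightarrow> insert_index l r < L"
  by (auto simp: insert_index_def)

lemma insert_index_neq: "insert_index l r \<noteq> l"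
  by (auto simp: insert_index_def)

lemma all_insert_index_iff:
  assumes "l < L"
  shows "(\<forall>k<L. k \<noteq> l \<longrightarrow> P k) \<longleftrightarrow> (\<forall>r<L - 1. P (insert_index l r))"
proof
  assume "\<forall>r<L - 1. P (insert_index l r)"
  moreover have "\<exists>r<L - 1. insert_index l r = k" if "k < L" "k \<noteq> l" for k
    using that assms by (intro exI[of _ "if k < l then k else k - 1"]) (auto simp: insert_index_def)
  ultimately show "\<forall>k<L. k \<noteq> l \<longrightarrow> P k" by metis
qed (use assms insert_index_less insert_index_neq in blast)

lemma V_mat_mult_vec:
  assumes "l < L" "e \<in> carrier_vec L" "r < L - 1"
  shows "(V_mat L l *\<^sub>v e) $ r = e $ insert_index l r - e $ l"
proof -
  have "(V_mat L l *\<^sub>v e) $ r = (\<Sum>j\<in>{0..<L}. V_mat L l $$ (r, j) * e $ j)"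
    using assms V_mat_carrier[OF assms(1)] by (simp add: scalar_prod_def)
  also have "\<dots> = (\<Sum>j\<in>{0..<L}. (if j = insert_index l r then e $ j else 0) - (if j = l then e $ j else 0))"
    using assms by (intro sum.cong) (auto simp: V_mat_index)
  also have "\<dots> = e $ insert_index l r - e $ l"
    using assms insert_index_less[of l L r] by (simp add: sum_subtractf)
  finally show ?thesis .
qed

text \<open>A shift common to all utilities leaves their differences unchanged. The column of ones
  serves as the complementary matrix \<open>N\<close> of \<open>distr_mvn_mult_mat\<close>.\<close>

lemma V_mat_ones:
  assumes "l < L"
  shows "V_mat L l * mat L 1 (\<lambda>_. 1) = 0\<^sub>m (L - 1) 1"
proof (rule eq_matI)
  fix i j assume "i < dim_row (0\<^sub>m (L - 1) 1 :: real mat)" "j < dim_col (0\<^sub>m (L - 1) 1 :: real mat)"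
  then have ij: "i < L - 1" "j = 0" by auto
  have "(V_mat L l * mat L 1 (\<lambda>_. 1)) $$ (i, j) = (V_mat L l *\<^sub>v col (mat L 1 (\<lambda>_. 1)) 0) $ i"
    using ij V_mat_carrier[OF assms] by simp
  also have "col (mat L 1 (\<lambda>_. 1)) 0 = vec L (\<lambda>_. 1 :: real)" by (intro eq_vecI) auto
  also have "(V_mat L l *\<^sub>v vec L (\<lambda>_. 1)) $ i = 0"
    using assms ij insert_index_less[OF assms ij(1)] by (subst V_mat_mult_vec[OF assms]) auto
  finally show "(V_mat L l * mat L 1 (\<lambda>_. 1)) $$ (i, j) = 0\<^sub>m (L - 1) 1 $$ (i, j)" using ij by simp
qed (use V_mat_carrier[OF assms] in auto)

text \<open>Column \<open>insert_index l r\<close> of \<open>V_mat L l\<close> is the unit vector at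
  \<open>r\<close>, because this category is not the base \<open>l\<close> and occurs in a single
  comparison. The transpose therefore exhibits every entry of \<open>v\<close>.\<close>

lemma transpose_V_mat_inj:
  assumes l: "l < L" and v: "v \<in> carrier_vec (L - 1)" "transpose_mat (V_mat L l) *\<^sub>v v = 0\<^sub>v L"
  shows "v = 0\<^sub>v (L - 1)"
proof (rule eq_vecI)
  fix r assume "r < dim_vec (0\<^sub>v (L - 1) :: real vec)"
  then have r: "r < L - 1" by simp
  have k: "insert_index l r < L" by (rule insert_index_less[OF l r])
  have inj: "insert_index l i = insert_index l r \<longleftrightarrow> i = r" for i by (auto simp: insert_index_def split: if_splits)
  have "0 = (transpose_mat (V_mat L l) *\<^sub>v v) $ insert_index l r" using k by (simp add: v(2))
  also have "\<dots> = (\<Sum>i\<in>{0..<L - 1}. V_mat L l $$ (i, insert_index l r) * v $ i)"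
    using k v(1) V_mat_carrier[OF l] by (simp add: scalar_prod_def)
  also have "\<dots> = (\<Sum>i\<in>{0..<L - 1}. if i = r then v $ i else 0)"
  proof (rule sum.cong)
    fix i assume "i \<in> {0..<L - 1}"
    then have "V_mat L l $$ (i, insert_index l r) = (if i = r then 1 else 0)"
      using V_mat_index[OF l _ k, of i] insert_index_neq[of l r] inj[of i] by (cases "i = r") simp_all
    then show "V_mat L l $$ (i, insert_index l r) * v $ i = (if i = r then v $ i else 0)" by simp
  qed simp
  also have "\<dots> = v $ r" using r by simp
  finally show "v $ r = 0\<^sub>v (L - 1) $ r" using r by simp
qed (use v in simp)

lemma mvn_V_mat:
  assumes \<Sigma>: "pos_def_mat L \<Sigma>" and l: "l < L"
  shows "pos_def_mat (L - 1) (V_mat L l * \<Sigma> * transpose_mat (V_mat L l))"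
    and "distr (mvn L \<Sigma>) (lborel_vec (L - 1)) (\<lambda>e. V_mat L l *\<^sub>v e) = mvn (L - 1) (V_mat L l * \<Sigma> * transpose_mat (V_mat L l))"
proof -
  note V = V_mat_carrier[OF l]
  show "pos_def_mat (L - 1) (V_mat L l * \<Sigma> * transpose_mat (V_mat L l))"
    by (rule pos_def_congruence[OF \<Sigma> V transpose_V_mat_inj[OF l]])
  show "distr (mvn L \<Sigma>) (lborel_vec (L - 1)) (\<lambda>e. V_mat L l *\<^sub>v e) = mvn (L - 1) (V_mat L l * \<Sigma> * transpose_mat (V_mat L l))"
  proof (rule distr_mvn_mult_mat[OF \<Sigma> V])
    show "mat L 1 (\<lambda>_. 1) \<in> carrier_mat L 1" by simp
    show "L = L - 1 + 1" using l by simp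
    show "V_mat L l * mat L 1 (\<lambda>_. 1) = 0\<^sub>m (L - 1) 1" by (rule V_mat_ones[OF l])
    fix v :: "real vec"
    show "v \<in> carrier_vec (L - 1) \<Longrightarrow> transpose_mat (V_mat L l) *\<^sub>v v = 0\<^sub>v L \<Longrightarrow> v = 0\<^sub>v (L - 1)"
      by (rule transpose_V_mat_inj[OF l])
    assume v: "v \<in> carrier_vec 1" "mat L 1 (\<lambda>_. 1) *\<^sub>v v = 0\<^sub>v L"
    have "(mat L 1 (\<lambda>_. 1) *\<^sub>v v) $ 0 = v $ 0" using v(1) l by (simp add: scalar_prod_def)
    then have "v $ 0 = 0" using l by (simp only: v(2) index_zero_vec)
    then show "v = 0\<^sub>v 1" using v(1) by (intro eq_vecI) auto
  qed
qed

lemma X_block_carrier: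
  assumes "x \<in> carrier_vec p" "l < L"
  shows "X_block L x l \<in> carrier_mat (L - 1) (p * (L - 1))"
  using assms by (auto simp: X_block_def kronecker_mat_def Vbar_mat_def mult.commute intro!: carrier_matI)

text \<open>The columns kept in \<open>Vbar_mat\<close> belong to the non-reference categories.
  Dropping the last one matches the zero block of \<open>coef_block\<close> for category
  \<open>L - 1\<close>, so the formula also holds when \<open>l\<close> or
  \<open>insert_index l r\<close> is that category.\<close>

lemma X_block_mult_vec:
  assumes x: "x \<in> carrier_vec p" and b: "b \<in> carrier_vec (p * (L - 1))" and l: "l < L" and r: "r < L - 1"
  shows "(X_block L x l *\<^sub>v b) $ r = x \<bullet> coef_block p L b l - x \<bullet> coef_block p L b (insert_index l r)"
proof -
  define f where "f c = (\<Sum>j<p. x $ j * b $ (c * p + j))" for c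
  have blk: "x \<bullet> coef_block p L b k = (if k < L - 1 then f k else 0)" for k
    using x by (auto simp: coef_block_def scalar_prod_def f_def atLeast0LessThan)
  have idx: "X_block L x l $$ (r, j) = - V_mat L l $$ (r, j div p) * x $ (j mod p)" if "j < (L - 1) * p" for j
  proof -
    have "j div p < L - 1" using that by (simp add: less_mult_imp_div_less)
    \<comment> \<open>Here \<open>p\<close> is positive, because otherwise no \<open>j\<close> would
      be below \<open>(L - 1) * p\<close>.\<close>
    moreover have "j mod p < p" using that by (metis mod_less_divisor mult_0_right not_less_zero neq0_conv)
    ultimately show ?thesis
      using that r x by (simp add: X_block_def kronecker_mat_def Vbar_mat_def mat_of_rows_index)
  qed
  have "(X_block L x l *\<^sub>v b) $ r = (\<Sum>j<(L - 1) * p. X_block L x l $$ (r, j) * b $ j)"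
    using b r X_block_carrier[OF x l] by (simp add: scalar_prod_def atLeast0LessThan mult.commute)
  also have "\<dots> = (\<Sum>j<(L - 1) * p. - V_mat L l $$ (r, j div p) * x $ (j mod p) * b $ j)"
    by (intro sum.cong) (auto simp: idx)
  \<comment> \<open>Columns are grouped by category: column \<open>c * p + j\<close> carries
    covariate \<open>j\<close> of category \<open>c\<close>.\<close>
  also have "\<dots> = (\<Sum>c<L - 1. \<Sum>j\<in>{c * p..<c * p + p}. - V_mat L l $$ (r, j div p) * x $ (j mod p) * b $ j)"
    by (rule sum.nat_group[symmetric])
  also have "\<dots> = (\<Sum>c<L - 1. - V_mat L l $$ (r, c) * f c)"
  proof (rule sum.cong)
    fix c assume "c \<in> {..<L - 1}"
    have "(\<Sum>j\<in>{c * p..<c * p + p}. g j) = (\<Sum>j<p. g (c * p + j))" for g :: "nat \<Rightarrow> real"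
      by (rule sum.reindex_bij_witness[of _ "\<lambda>j. c * p + j" "\<lambda>j. j - c * p"]) auto
    then have "(\<Sum>j\<in>{c * p..<c * p + p}. - V_mat L l $$ (r, j div p) * x $ (j mod p) * b $ j) =
      (\<Sum>j<p. - V_mat L l $$ (r, (c * p + j) div p) * x $ ((c * p + j) mod p) * b $ (c * p + j))" .
    also have "\<dots> = (\<Sum>j<p. - V_mat L l $$ (r, c) * (x $ j * b $ (c * p + j)))"
      by (intro sum.cong) auto
    finally have "(\<Sum>j\<in>{c * p..<c * p + p}. - V_mat L l $$ (r, j div p) * x $ (j mod p) * b $ j) =
      (\<Sum>j<p. - V_mat L l $$ (r, c) * (x $ j * b $ (c * p + j)))" .
    then show "(\<Sum>j\<in>{c * p..<c * p + p}. - V_mat L l $$ (r, j div p) * x $ (j mod p) * b $ j) = - V_mat L l $$ (r, c) * f c"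
      by (simp add: f_def sum_distrib_left sum_negf)
  qed simp
  also have "\<dots> = (\<Sum>c<L - 1. (if c = l then f c else 0) - (if c = insert_index l r then f c else 0))"
    using l r by (intro sum.cong) (auto simp: V_mat_index)
  \<comment> \<open>A delta at the reference category \<open>L - 1\<close> falls outside the range
    of summation, whence the case distinctions.\<close>
  also have "\<dots> = (if l < L - 1 then f l else 0) - (if insert_index l r < L - 1 then f (insert_index l r) else 0)"
    by (simp add: sum_subtractf)
  finally show ?thesis by (simp add: blk)
qed

lemma utility_greater_iff:
  assumes x: "x \<in> carrier_vec p" and b: "b \<in> carrier_vec (p * (L - 1))" and l: "l < L" and e: "e \<in> carrier_vec L"
  shows "(\<forall>k<L. k \<noteq> l \<longrightarrow> utility p L x b e l > utility p L x b e k) \<longleftrightarrow>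
    V_mat L l *\<^sub>v e \<in> {z \<in> carrier_vec (L - 1). \<forall>i<L - 1. z $ i < (X_block L x l *\<^sub>v b) $ i}"
proof -
  have "V_mat L l *\<^sub>v e \<in> carrier_vec (L - 1)" using V_mat_carrier[OF l] e by simp
  then show ?thesis
    unfolding all_insert_index_iff[OF l]
    by (simp add: utility_def V_mat_mult_vec[OF l e] X_block_mult_vec[OF x b l] algebra_simps del: index_mult_mat_vec)
qed

lemma pos_def_diag_block_mat:
  assumes "\<And>i. i \<in> set is \<Longrightarrow> pos_def_mat d (f i)"
  shows "pos_def_mat (length is * d) (diag_block_mat (map f is))"
  using assms
proof (induction "is")
  case Nil
  then show ?case by (auto simp: pos_def_mat_def)
next
  case (Cons i "is")
  have "pos_def_mat d (f i)" "pos_def_mat (length is * d) (diag_block_mat (map f is))" using Cons by auto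
  note pd = this
  show ?case
    using pos_def_four_block[OF pd] pos_def_carrier[OF pd(1)] pos_def_carrier[OF pd(2)] by (simp add: Let_def)
qed

text \<open>The dimension of the concatenated argument is part of the induction, since
  \<open>mvn_cdf_four_block\<close> requires it for the tail. The empty case is a point of mass
  1.\<close>

lemma mvn_cdf_diag_block_mat:
  assumes "\<And>i. i \<in> set is \<Longrightarrow> pos_def_mat d (f i)" "\<And>i. i \<in> set is \<Longrightarrow> u i \<in> carrier_vec d"
  shows "mvn_cdf (length is * d) (diag_block_mat (map f is)) (foldr (@\<^sub>v) (map u is) vNil) = (\<Prod>i\<leftarrow>is. mvn_cdf d (f i) (u i))
    \<and> foldr (@\<^sub>v) (map u is) vNil \<in> carrier_vec (length is * d)"
  using assms
proof (induction "is")
  case Nil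
  have pd: "pos_def_mat 0 (0\<^sub>m 0 0)" by (auto simp: pos_def_mat_def)
  interpret prob_space "mvn 0 (0\<^sub>m 0 0)" by (rule prob_space_mvn[OF pd])
  have "orthant 0 vNil = space (mvn 0 (0\<^sub>m 0 0))" by (auto simp: orthant_def)
  then show ?case using prob_space by (simp add: mvn_cdf_eq)
next
  case (Cons i "is")
  have i: "pos_def_mat d (f i)" "u i \<in> carrier_vec d" using Cons by auto
  have "is": "pos_def_mat (length is * d) (diag_block_mat (map f is))"
    by (rule pos_def_diag_block_mat) (use Cons in auto)
  show ?case
    using mvn_cdf_four_block[OF i(1) "is" i(2)] Cons pos_def_carrier[OF i(1)] pos_def_carrier[OF "is"]
    by (simp add: Let_def)
qed

text \<open>Brings the stacked design matrix into the form of the argument in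
  \<open>mvn_cdf_diag_block_mat\<close>.\<close>

lemma mat_of_rows_concat_mult_vec:
  assumes "\<And>i. i \<in> set is \<Longrightarrow> A i \<in> carrier_mat d q" and b: "b \<in> carrier_vec q"
  shows "mat_of_rows q (concat (map (\<lambda>i. rows (A i)) is)) *\<^sub>v b = foldr (@\<^sub>v) (map (\<lambda>i. A i *\<^sub>v b) is) vNil"
  using assms(1)
proof (induction "is")
  case Nil
  then show ?case by (intro eq_vecI) auto
next
  case (Cons i "is")
  let ?R = "concat (map (\<lambda>i. rows (A i)) is)"
  have A: "A i \<in> carrier_mat d q" using Cons by simp
  have "mat_of_rows q (rows (A i) @ ?R) *\<^sub>v b = (A i *\<^sub>v b) @\<^sub>v (mat_of_rows q ?R *\<^sub>v b)"
  proof (rule eq_vecI)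
    fix j assume "j < dim_vec ((A i *\<^sub>v b) @\<^sub>v (mat_of_rows q ?R *\<^sub>v b))"
    then have j: "j < d + length ?R" using A by simp
    have carr: "(rows (A i) @ ?R) ! j \<in> carrier_vec q"
    proof -
      have "set (rows (A i) @ ?R) \<subseteq> carrier_vec q"
      proof -
        have "set (rows (A j)) \<subseteq> carrier_vec q" if "j \<in> set (i # is)" for j
          using carrier_matD(2)[OF Cons.prems[OF that]] by (auto simp: rows_def)
        moreover have "set (rows (A i) @ ?R) = (\<Union>j\<in>set (i # is). set (rows (A j)))" by simp
        ultimately show ?thesis by blast
      qed
      moreover have "(rows (A i) @ ?R) ! j \<in> set (rows (A i) @ ?R)" using j A by (intro nth_mem) simp
      ultimately show ?thesis by blast
    qed
    then show "(mat_of_rows q (rows (A i) @ ?R) *\<^sub>v b) $ j = ((A i *\<^sub>v b) @\<^sub>v (mat_of_rows q ?R *\<^sub>v b)) $ j"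
      using j A by (simp add: nth_append split: if_splits)
  qed (use A in simp)
  then show ?case using Cons by simp
qed

lemma Xbar_mat_carrier:
  assumes "\<And>i. i < n \<Longrightarrow> x i \<in> carrier_vec p" "\<And>i. i < n \<Longrightarrow> y i < L"
  shows "Xbar_mat n p L x y \<in> carrier_mat (n * (L - 1)) (p * (L - 1))"
proof -
  have "length (concat (map (\<lambda>i. rows (X_block L (x i) (y i))) [0..<k])) = k * (L - 1)" if "k \<le> n" for k
    using that
  proof (induction k)
    case (Suc k)
    then show ?case using carrier_matD(1)[OF X_block_carrier[of "x k" p "y k" L]] assms by simp
  qed simp
  then show ?thesis unfolding Xbar_mat_def by auto
qed

lemma mvn_cdf_Lambda_mat:
  assumes \<Sigma>: "pos_def_mat L \<Sigma>" and x: "\<And>i. i < n \<Longrightarrow> x i \<in> carrier_vec p" and y: "\<And>i. i < n \<Longrightarrow> y i < L"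
  shows "pos_def_mat (n * (L - 1)) (Lambda_mat n L \<Sigma> y)"
    and "b \<in> carrier_vec (p * (L - 1)) \<Longrightarrow>
      mvn_cdf (n * (L - 1)) (Lambda_mat n L \<Sigma> y) (Xbar_mat n p L x y *\<^sub>v b) =
      (\<Prod>i<n. mvn_cdf (L - 1) (V_mat L (y i) * \<Sigma> * transpose_mat (V_mat L (y i))) (X_block L (x i) (y i) *\<^sub>v b))"
proof -
  have pd: "pos_def_mat (L - 1) (V_mat L (y i) * \<Sigma> * transpose_mat (V_mat L (y i)))" if "i \<in> set [0..<n]" for i
    using that y by (intro mvn_V_mat(1)[OF \<Sigma>]) auto
  show "pos_def_mat (n * (L - 1)) (Lambda_mat n L \<Sigma> y)"
    using pos_def_diag_block_mat[of "[0..<n]", OF pd] by (simp add: Lambda_mat_def)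
  assume b: "b \<in> carrier_vec (p * (L - 1))"
  have X: "X_block L (x i) (y i) \<in> carrier_mat (L - 1) (p * (L - 1))" if "i \<in> set [0..<n]" for i
    using that x y by (intro X_block_carrier) auto
  have Xb: "X_block L (x i) (y i) *\<^sub>v b \<in> carrier_vec (L - 1)" if "i \<in> set [0..<n]" for i
    using X[OF that] b by simp
  have X_eq: "Xbar_mat n p L x y *\<^sub>v b = foldr (@\<^sub>v) (map (\<lambda>i. X_block L (x i) (y i) *\<^sub>v b) [0..<n]) vNil"
    unfolding Xbar_mat_def by (rule mat_of_rows_concat_mult_vec[OF X b])
  show "mvn_cdf (n * (L - 1)) (Lambda_mat n L \<Sigma> y) (Xbar_mat n p L x y *\<^sub>v b) =
      (\<Prod>i<n. mvn_cdf (L - 1) (V_mat L (y i) * \<Sigma> * transpose_mat (V_mat L (y i))) (X_block L (x i) (y i) *\<^sub>v b))"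
    unfolding X_eq Lambda_mat_def
    using mvn_cdf_diag_block_mat[of "[0..<n]" "L - 1" "\<lambda>i. V_mat L (y i) * \<Sigma> * transpose_mat (V_mat L (y i))"
        "\<lambda>i. X_block L (x i) (y i) *\<^sub>v b", OF pd Xb]
    by (simp add: prod.distinct_set_conv_list[symmetric] atLeast0LessThan)
qed

subsection \<open>Conditional probabilities given the coefficients\<close>

text \<open>For \<open>X\<close> independent of \<open>Z\<close>, conditioning on \<open>X\<close>
  freezes its value and leaves only the randomness of \<open>Z\<close>. The candidate is tested on
  preimages under \<open>X\<close>, where Fubini for the product law gives the required
  integral.\<close>

lemma cond_exp_indep_pair:
  assumes M: "prob_space M" and X[measurable]: "X \<in> measurable M N1" and Z[measurable]: "Z \<in> measurable M N2"
    and joint: "distr M N1 X \<Otimes>\<^sub>M distr M N2 Z = distr M (N1 \<Otimes>\<^sub>M N2) (\<lambda>\<omega>. (X \<omega>, Z \<omega>))"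
    and S: "S \<in> sets (N1 \<Otimes>\<^sub>M N2)"
  shows "AE \<omega> in M. real_cond_exp M (vimage_algebra (space M) X N1) (indicator {\<omega> \<in> space M. (X \<omega>, Z \<omega>) \<in> S}) \<omega> =
    measure (distr M N2 Z) (Pair (X \<omega>) -` S)"
proof -
  interpret prob_space M by (rule M)
  let ?F = "vimage_algebra (space M) X N1"
  have sub: "subalgebra M ?F"
    unfolding subalgebra_def by (auto simp: sets_vimage_algebra2[OF measurable_space[OF X, THEN Pi_I]] measurable_sets[OF X])
  interpret finite_measure_subalgebra M ?F by standard (rule sub)
  interpret PX: prob_space "distr M N1 X" by (rule prob_space_distr[OF X])
  interpret PZ: prob_space "distr M N2 Z" by (rule prob_space_distr[OF Z])
  let ?E = "{\<omega> \<in> space M. (X \<omega>, Z \<omega>) \<in> S}"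
  have XZ: "(\<lambda>\<omega>. (X \<omega>, Z \<omega>)) \<in> measurable M (N1 \<Otimes>\<^sub>M N2)" by (rule measurable_Pair[OF X Z])
  have E_eq: "?E = (\<lambda>\<omega>. (X \<omega>, Z \<omega>)) -` S \<inter> space M" by auto
  have E: "?E \<in> sets M" unfolding E_eq by (rule measurable_sets[OF XZ S])
  have S': "S \<in> sets (N1 \<Otimes>\<^sub>M distr M N2 Z)"
    using S sets_pair_measure_cong[of N1 N1 "distr M N2 Z" N2] by simp
  define g where "g b = measure (distr M N2 Z) (Pair b -` S)" for b
  have g_emeasure: "emeasure (distr M N2 Z) (Pair b -` S) = ennreal (g b)" for b
    by (simp add: g_def PZ.emeasure_eq_measure)
  have g: "g \<in> borel_measurable N1"
    unfolding g_def measure_def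
    by (intro borel_measurable_enn2real PZ.measurable_emeasure_Pair[OF S'])
  have g_nonneg: "0 \<le> g b" for b by (simp add: g_def)
  have XF: "X \<in> measurable ?F N1" by (rule measurable_vimage_algebra1) (use measurable_space[OF X] in auto)
  have "AE \<omega> in M. real_cond_exp M ?F (indicator ?E) \<omega> = g (X \<omega>)"
  proof (rule real_cond_exp_charact)
    show "(\<lambda>\<omega>. g (X \<omega>)) \<in> borel_measurable ?F" by (rule measurable_compose[OF XF g])
    show "integrable M (indicator ?E :: 'a \<Rightarrow> real)" using E by (simp add: integrable_indicator_iff emeasure_eq_measure)
    have gX: "(\<lambda>\<omega>. g (X \<omega>)) \<in> borel_measurable M" by (rule measurable_compose[OF X g])
    show "integrable M (\<lambda>\<omega>. g (X \<omega>))"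
      by (rule integrable_const_bound[of _ 1]) (auto simp: g_def gX[unfolded g_def])
    fix A assume "A \<in> sets ?F"
    then obtain B where B: "B \<in> sets N1" "A = X -` B \<inter> space M"
      using sets_vimage_algebra2[of X "space M" N1] measurable_space[OF X] by auto
    have A: "A \<in> sets M" unfolding B(2) by (rule measurable_sets[OF X B(1)])
    \<comment> \<open>The rectangle \<open>B \<times> space N2\<close> encodes the restriction to
      \<open>A\<close>, so that the intersection with the event becomes a single event about the
      pair.\<close>
    have SB: "S \<inter> B \<times> space N2 \<in> sets (N1 \<Otimes>\<^sub>M N2)" using S B(1) by auto
    have SB': "S \<inter> B \<times> space N2 \<in> sets (N1 \<Otimes>\<^sub>M distr M N2 Z)"
      using SB sets_pair_measure_cong[of N1 N1 "distr M N2 Z" N2] by simp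
    have "ennreal (measure M (A \<inter> ?E)) = emeasure M ((\<lambda>\<omega>. (X \<omega>, Z \<omega>)) -` (S \<inter> B \<times> space N2) \<inter> space M)"
      unfolding B(2) E_eq using measurable_space[OF Z]
      by (subst emeasure_eq_measure[symmetric], intro arg_cong[of _ _ "emeasure M"]) auto
    also have "\<dots> = emeasure (distr M N1 X \<Otimes>\<^sub>M distr M N2 Z) (S \<inter> B \<times> space N2)"
      unfolding joint by (rule emeasure_distr[OF XZ SB, symmetric])
    also have "\<dots> = (\<integral>\<^sup>+b. emeasure (distr M N2 Z) (Pair b -` (S \<inter> B \<times> space N2)) \<partial>distr M N1 X)"
      by (rule PZ.emeasure_pair_measure_alt) (use SB' sets_pair_measure_cong[of "distr M N1 X" N1] in simp)
    also have "\<dots> = (\<integral>\<^sup>+b. indicator B b * ennreal (g b) \<partial>distr M N1 X)"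
    proof (rule nn_integral_cong)
      fix b
      have "Pair b -` (S \<inter> B \<times> space N2) = (if b \<in> B then Pair b -` S else {})"
        using sets.sets_into_space[OF S] by (auto simp: space_pair_measure)
      then show "emeasure (distr M N2 Z) (Pair b -` (S \<inter> B \<times> space N2)) = indicator B b * ennreal (g b)"
        by (simp add: g_emeasure)
    qed
    also have "\<dots> = (\<integral>\<^sup>+\<omega>. indicator B (X \<omega>) * ennreal (g (X \<omega>)) \<partial>M)"
      by (rule nn_integral_distr[OF X])
        (subst measurable_distr_eq1, intro borel_measurable_times_ennreal borel_measurable_indicator[OF B(1)]
          measurable_compose[OF g measurable_ennreal])
    also have "\<dots> = (\<integral>\<^sup>+\<omega>. ennreal (indicator A \<omega> * g (X \<omega>)) \<partial>M)"
      by (intro nn_integral_cong) (auto simp: B(2) indicator_def g_nonneg)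
    finally have *: "ennreal (measure M (A \<inter> ?E)) = (\<integral>\<^sup>+\<omega>. ennreal (indicator A \<omega> * g (X \<omega>)) \<partial>M)" .
    have "(\<integral>\<omega>\<in>A. indicator ?E \<omega> \<partial>M) = measure M (A \<inter> ?E)"
      using A E by (simp add: set_lebesgue_integral_def flip: indicator_inter_arith)
    also have "\<dots> = enn2real (\<integral>\<^sup>+\<omega>. ennreal (indicator A \<omega> * g (X \<omega>)) \<partial>M)"
      by (simp flip: *)
    also have "\<dots> = (\<integral>\<omega>. indicator A \<omega> * g (X \<omega>) \<partial>M)"
      by (rule integral_eq_nn_integral[symmetric])
        (use A gX g_nonneg in \<open>auto intro!: borel_measurable_times\<close>)
    finally show "(\<integral>\<omega>\<in>A. indicator ?E \<omega> \<partial>M) = (\<integral>\<omega>\<in>A. g (X \<omega>) \<partial>M)"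
      by (simp add: set_lebesgue_integral_def)
  qed
  then show ?thesis by (simp add: g_def)
qed

text \<open>A product of sigma-finite measures is determined by rectangles, where the claim is
  independence of two members of the family. Their target spaces may differ, as they do for
  coefficients and errors.\<close>

lemma (in prob_space) indep_vars_pair_distr:
  assumes ind: "indep_vars N X I" and i: "i \<in> I" "j \<in> I" "i \<noteq> j"
  shows "distr M (N i) (X i) \<Otimes>\<^sub>M distr M (N j) (X j) = distr M (N i \<Otimes>\<^sub>M N j) (\<lambda>\<omega>. (X i \<omega>, X j \<omega>))"
proof (rule pair_measure_eqI)
  have X: "X i \<in> measurable M (N i)" "X j \<in> measurable M (N j)" using ind i by (auto simp: indep_vars_def)
  interpret Xi: prob_space "distr M (N i) (X i)" by (rule prob_space_distr[OF X(1)])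
  interpret Xj: prob_space "distr M (N j) (X j)" by (rule prob_space_distr[OF X(2)])
  show "sigma_finite_measure (distr M (N i) (X i))" "sigma_finite_measure (distr M (N j) (X j))" ..
  fix A B assume AB: "A \<in> sets (distr M (N i) (X i))" "B \<in> sets (distr M (N j) (X j))"
  define C where "C k = (if k = i then A else B)" for k
  have C: "C k \<in> sets (N k)" if "k \<in> {i, j}" for k using that AB i by (auto simp: C_def)
  have "prob (\<Inter>k\<in>{i, j}. X k -` C k \<inter> space M) = (\<Prod>k\<in>{i, j}. prob (X k -` C k \<inter> space M))"
    by (rule indep_varsD[OF ind _ _ _ C]) (use i in auto)
  then have *: "prob ((X i -` A \<inter> space M) \<inter> (X j -` B \<inter> space M)) = prob (X i -` A \<inter> space M) * prob (X j -` B \<inter> space M)"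
    using i by (simp add: C_def)
  have "emeasure (distr M (N i \<Otimes>\<^sub>M N j) (\<lambda>\<omega>. (X i \<omega>, X j \<omega>))) (A \<times> B) =
      emeasure M ((\<lambda>\<omega>. (X i \<omega>, X j \<omega>)) -` (A \<times> B) \<inter> space M)"
    by (rule emeasure_distr[OF measurable_Pair[OF X]]) (use AB in auto)
  also have "(\<lambda>\<omega>. (X i \<omega>, X j \<omega>)) -` (A \<times> B) \<inter> space M = (X i -` A \<inter> space M) \<inter> (X j -` B \<inter> space M)" by auto
  also have "emeasure M \<dots> = emeasure M (X i -` A \<inter> space M) * emeasure M (X j -` B \<inter> space M)"
    by (simp add: emeasure_eq_measure * ennreal_mult)
  also have "\<dots> = emeasure (distr M (N i) (X i)) A * emeasure (distr M (N j) (X j)) B"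
    using AB by (simp add: emeasure_distr[OF X(1)] emeasure_distr[OF X(2)])
  finally show "emeasure (distr M (N i) (X i)) A * emeasure (distr M (N j) (X j)) B =
      emeasure (distr M (N i \<Otimes>\<^sub>M N j) (\<lambda>\<omega>. (X i \<omega>, X j \<omega>))) (A \<times> B)" ..
qed simp

lemma normal_distributed_distr:
  assumes "normal_distributed M m X W"
  shows "X \<in> measurable M (lborel_vec m)" "distr M (lborel_vec m) X = mvn m W"
  using assms by (auto simp: normal_distributed_def distributed_def mvn_def)

text \<open>With the coefficients frozen, the event concerns only the error vector, whose image
  under \<open>V_mat L l\<close> is Gaussian.\<close>

lemma cprob_category:
  assumes M: "prob_space M" and \<Sigma>: "pos_def_mat L \<Sigma>" and x: "x \<in> carrier_vec p" and l: "l < L"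
    and \<beta>: "\<beta> \<in> measurable M (lborel_vec (p * (L - 1)))" and e: "normal_distributed M L e \<Sigma>"
    and joint: "distr M (lborel_vec (p * (L - 1))) \<beta> \<Otimes>\<^sub>M distr M (lborel_vec L) e =
      distr M (lborel_vec (p * (L - 1)) \<Otimes>\<^sub>M lborel_vec L) (\<lambda>\<omega>. (\<beta> \<omega>, e \<omega>))"
  shows "AE \<omega> in M. cprob_given M (p * (L - 1)) \<beta>
      {\<omega> \<in> space M. \<forall>k<L. k \<noteq> l \<longrightarrow> utility p L x (\<beta> \<omega>) (e \<omega>) l > utility p L x (\<beta> \<omega>) (e \<omega>) k} \<omega> =
    mvn_cdf (L - 1) (V_mat L l * \<Sigma> * transpose_mat (V_mat L l)) (X_block L x l *\<^sub>v \<beta> \<omega>)"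
proof -
  note V = V_mat_carrier[OF l] and X = X_block_carrier[OF x l]
  note e' = normal_distributed_distr[OF e]
  let ?q = "p * (L - 1)"
  let ?W = "V_mat L l * \<Sigma> * transpose_mat (V_mat L l)"
  define T where "T b = {z \<in> carrier_vec (L - 1). \<forall>i<L - 1. z $ i < (X_block L x l *\<^sub>v b) $ i}" for b
  define S where "S = {r \<in> space (lborel_vec ?q \<Otimes>\<^sub>M lborel_vec L).
    \<forall>i\<in>{..<L - 1}. (V_mat L l *\<^sub>v snd r) $ i < (X_block L x l *\<^sub>v fst r) $ i}"
  have Ve: "V_mat L l *\<^sub>v v \<in> carrier_vec (L - 1)" if "v \<in> carrier_vec L" for v using V that by simp
  have S: "S \<in> sets (lborel_vec ?q \<Otimes>\<^sub>M lborel_vec L)"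
    unfolding S_def
  proof (rule sets.sets_Collect_finite_All)
    fix i assume i: "i \<in> {..<L - 1}"
    show "{r \<in> space (lborel_vec ?q \<Otimes>\<^sub>M lborel_vec L). (V_mat L l *\<^sub>v snd r) $ i < (X_block L x l *\<^sub>v fst r) $ i}
      \<in> sets (lborel_vec ?q \<Otimes>\<^sub>M lborel_vec L)"
      using i by (intro borel_measurable_less measurable_lborel_vec_index[OF measurable_mult_mat_vec[OF V measurable_snd]]
        measurable_lborel_vec_index[OF measurable_mult_mat_vec[OF X measurable_fst]]) auto
  qed simp
  have inS: "(b, v) \<in> S \<longleftrightarrow> V_mat L l *\<^sub>v v \<in> T b" if "b \<in> carrier_vec ?q" "v \<in> carrier_vec L" for b v
    using that Ve[OF that(2)] by (auto simp: S_def T_def space_pair_measure simp del: index_mult_mat_vec)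
  have ev: "{\<omega> \<in> space M. \<forall>k<L. k \<noteq> l \<longrightarrow> utility p L x (\<beta> \<omega>) (e \<omega>) l > utility p L x (\<beta> \<omega>) (e \<omega>) k} =
    {\<omega> \<in> space M. (\<beta> \<omega>, e \<omega>) \<in> S}"
    using utility_greater_iff[OF x measurable_lborel_vec_carrier[OF \<beta>] l measurable_lborel_vec_carrier[OF e'(1)]]
      inS[OF measurable_lborel_vec_carrier[OF \<beta>] measurable_lborel_vec_carrier[OF e'(1)]]
    unfolding T_def by blast
  have cdf: "measure (mvn L \<Sigma>) (Pair b -` S) = mvn_cdf (L - 1) ?W (X_block L x l *\<^sub>v b)" if b: "b \<in> carrier_vec ?q" for b
  proof -
    have "Pair b -` S = (\<lambda>v. V_mat L l *\<^sub>v v) -` T b \<inter> space (mvn L \<Sigma>)"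
      using inS[OF b] by (auto simp: S_def space_pair_measure)
    moreover have "measure (distr (mvn L \<Sigma>) (lborel_vec (L - 1)) (\<lambda>v. V_mat L l *\<^sub>v v)) (T b) =
        measure (mvn L \<Sigma>) ((\<lambda>v. V_mat L l *\<^sub>v v) -` T b \<inter> space (mvn L \<Sigma>))"
    proof (rule measure_distr)
      show "(\<lambda>v. V_mat L l *\<^sub>v v) \<in> measurable (mvn L \<Sigma>) (lborel_vec (L - 1))"
        using measurable_mult_mat_vec[OF V measurable_ident_sets[OF refl]] by (simp add: mvn_def)
      show "T b \<in> sets (lborel_vec (L - 1))"
        unfolding T_def by (rule measure_mvn_strict_orthant(1)[OF mvn_V_mat(1)[OF \<Sigma> l]])
    qed
    ultimately show ?thesis
      using measure_mvn_strict_orthant(2)[OF mvn_V_mat(1)[OF \<Sigma> l], of "X_block L x l *\<^sub>v b"]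
      unfolding mvn_V_mat(2)[OF \<Sigma> l] T_def by (simp only:)
  qed
  have "AE \<omega> in M. real_cond_exp M (vimage_algebra (space M) \<beta> (lborel_vec ?q)) (indicator {\<omega> \<in> space M. (\<beta> \<omega>, e \<omega>) \<in> S}) \<omega> =
    measure (distr M (lborel_vec L) e) (Pair (\<beta> \<omega>) -` S)"
    by (rule cond_exp_indep_pair[OF M \<beta> e'(1) joint S])
  then show ?thesis
    unfolding cprob_given_def ev e'(2)
  proof (rule AE_mp, intro AE_I2 impI)
    fix \<omega> assume \<omega>: "\<omega> \<in> space M"
      and eq: "real_cond_exp M (vimage_algebra (space M) \<beta> (lborel_vec ?q)) (indicator {\<omega> \<in> space M. (\<beta> \<omega>, e \<omega>) \<in> S}) \<omega> =
        measure (mvn L \<Sigma>) (Pair (\<beta> \<omega>) -` S)"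
    show "real_cond_exp M (vimage_algebra (space M) \<beta> (lborel_vec ?q)) (indicator {\<omega> \<in> space M. (\<beta> \<omega>, e \<omega>) \<in> S}) \<omega> =
      mvn_cdf (L - 1) ?W (X_block L x l *\<^sub>v \<beta> \<omega>)"
      unfolding eq by (rule cdf[OF measurable_lborel_vec_carrier[OF \<beta> \<omega>]])
  qed
qed

text \<open>The defining property of conditional expectation, followed by the passage to the law of
  \<open>\<beta>\<close>, gives the numerator of Bayes' formula.\<close>

lemma emeasure_Int_vimage_cond_exp:
  assumes M: "prob_space M" and \<beta>: "normal_distributed M q \<beta> W" and W: "pos_def_mat q W" and E: "E \<in> sets M"
    and G: "(\<lambda>b. ennreal (G b)) \<in> borel_measurable (lborel_vec q)" and G_nonneg: "\<And>b. 0 \<le> G b"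
    and cond: "AE \<omega> in M. cprob_given M q \<beta> E \<omega> = G (\<beta> \<omega>)" and B: "B \<in> sets (lborel_vec q)"
  shows "emeasure M (E \<inter> (\<beta> -` B \<inter> space M)) =
    (\<integral>\<^sup>+b. ennreal (mvn_pdf q W b) * ennreal (G b) * indicator B b \<partial>lborel_vec q)"
proof -
  interpret prob_space M by (rule M)
  note \<beta>' = normal_distributed_distr[OF \<beta>]
  let ?F = "vimage_algebra (space M) \<beta> (lborel_vec q)"
  have maps: "\<beta> \<in> space M \<rightarrow> space (lborel_vec q)" using measurable_space[OF \<beta>'(1)] by blast
  have sub: "subalgebra M ?F"
    unfolding subalgebra_def using measurable_sets[OF \<beta>'(1)] by (auto simp: sets_vimage_algebra2[OF maps])
  interpret finite_measure_subalgebra M ?F by standard (rule sub)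
  let ?A = "\<beta> -` B \<inter> space M"
  have AF: "?A \<in> sets ?F" using B by (auto simp: sets_vimage_algebra2[OF maps])
  have A: "?A \<in> sets M" by (rule measurable_sets[OF \<beta>'(1) B])
  \<comment> \<open>Measurability of \<open>G\<close> is assumed in \<open>ennreal\<close>;
    nonnegativity brings it back to the reals.\<close>
  have "(\<lambda>b. enn2real (ennreal (G b))) \<in> borel_measurable (lborel_vec q)"
    by (rule borel_measurable_enn2real[OF G])
  then have "G \<in> borel_measurable (lborel_vec q)" using G_nonneg by simp
  then have G\<beta>: "(\<lambda>\<omega>. G (\<beta> \<omega>)) \<in> borel_measurable M" by (rule measurable_compose[OF \<beta>'(1)])
  have meas: "(\<lambda>b. ennreal (G b) * indicator B b) \<in> borel_measurable (lborel_vec q)"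
    by (intro borel_measurable_times_ennreal G borel_measurable_indicator B)
  have iE: "integrable M (indicator E :: 'a \<Rightarrow> real)" using E by (simp add: integrable_indicator_iff emeasure_eq_measure)
  have "measure M (E \<inter> ?A) = (\<integral>\<omega>\<in>?A. indicator E \<omega> \<partial>M)"
    using A E by (simp add: set_lebesgue_integral_def Int_commute flip: indicator_inter_arith)
  also have "\<dots> = (\<integral>\<omega>\<in>?A. real_cond_exp M ?F (indicator E) \<omega> \<partial>M)" by (rule real_cond_exp_intA[OF iE AF])
  also have "\<dots> = (\<integral>\<omega>. indicator ?A \<omega> * G (\<beta> \<omega>) \<partial>M)"
    unfolding set_lebesgue_integral_def
  proof (rule integral_cong_AE)
    show "(\<lambda>\<omega>. indicator ?A \<omega> *\<^sub>R real_cond_exp M ?F (indicator E) \<omega>) \<in> borel_measurable M"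
      using A by (intro borel_measurable_scaleR borel_measurable_indicator borel_measurable_cond_exp2)
    show "(\<lambda>\<omega>. indicator ?A \<omega> * G (\<beta> \<omega>)) \<in> borel_measurable M"
      using A by (intro borel_measurable_times borel_measurable_indicator G\<beta>)
    show "AE \<omega> in M. indicator ?A \<omega> *\<^sub>R real_cond_exp M ?F (indicator E) \<omega> = indicator ?A \<omega> * G (\<beta> \<omega>)"
      using cond unfolding cprob_given_def by eventually_elim simp
  qed
  also have "\<dots> = enn2real (\<integral>\<^sup>+\<omega>. ennreal (indicator ?A \<omega> * G (\<beta> \<omega>)) \<partial>M)"
    by (rule integral_eq_nn_integral) (use A G\<beta> G_nonneg in \<open>auto intro!: borel_measurable_times\<close>)
  finally have 1: "measure M (E \<inter> ?A) = enn2real (\<integral>\<^sup>+\<omega>. ennreal (indicator ?A \<omega> * G (\<beta> \<omega>)) \<partial>M)" .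
  \<comment> \<open>A conditional probability is at most 1 almost everywhere. This makes the
    integral finite, so that the real equation just obtained lifts to
    \<open>ennreal\<close>.\<close>
  have "AE \<omega> in M. G (\<beta> \<omega>) \<le> 1"
  proof -
    have "AE \<omega> in M. real_cond_exp M ?F (indicator E) \<omega> \<le> 1"
      by (rule real_cond_exp_le_c) (use iE in \<open>auto simp: indicator_def\<close>)
    with cond show ?thesis unfolding cprob_given_def by eventually_elim simp
  qed
  then have "(\<integral>\<^sup>+\<omega>. ennreal (indicator ?A \<omega> * G (\<beta> \<omega>)) \<partial>M) \<le> (\<integral>\<^sup>+\<omega>. 1 \<partial>M)"
    by (intro nn_integral_mono_AE) (auto elim!: eventually_mono simp: indicator_def)
  then have "(\<integral>\<^sup>+\<omega>. ennreal (indicator ?A \<omega> * G (\<beta> \<omega>)) \<partial>M) < \<infinity>"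
    by (simp add: emeasure_space_1 le_less_trans)
  with 1 have "emeasure M (E \<inter> ?A) = (\<integral>\<^sup>+\<omega>. ennreal (indicator ?A \<omega> * G (\<beta> \<omega>)) \<partial>M)"
    by (simp add: emeasure_eq_measure)
  also have "\<dots> = (\<integral>\<^sup>+\<omega>. ennreal (G (\<beta> \<omega>)) * indicator B (\<beta> \<omega>) \<partial>M)"
    by (intro nn_integral_cong) (auto simp: indicator_def)
  also have "\<dots> = (\<integral>\<^sup>+b. ennreal (G b) * indicator B b \<partial>distr M (lborel_vec q) \<beta>)"
    by (rule nn_integral_distr[OF \<beta>'(1), symmetric]) (simp add: meas)
  also have "\<dots> = (\<integral>\<^sup>+b. ennreal (mvn_pdf q W b) * (ennreal (G b) * indicator B b) \<partial>lborel_vec q)"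
    unfolding \<beta>'(2) mvn_def by (rule nn_integral_density[OF measurable_ennreal_mvn_pdf[OF W] meas])
  finally show ?thesis by (simp add: mult.assoc)
qed

subsection \<open>The posterior distribution\<close>

text \<open>All factors of \<open>R\<close>, the inverse of \<open>scale_mat S\<close>, cancel: the
  numerator has covariance \<open>R * \<Lambda> * R\<close> at
  \<open>R *\<^sub>v (X *\<^sub>v b)\<close>, the denominator \<open>R * S * R\<close> at zero, and
  a positive diagonal scaling of covariance and argument together leaves a distribution function
  unchanged.\<close>

lemma sun_pdf_posterior:
  assumes \<nu>: "\<nu> > 0" and X: "X \<in> carrier_mat h q" and \<Lambda>: "pos_def_mat h \<Lambda>" and b: "b \<in> carrier_vec q"
  defines "S \<equiv> \<nu>\<^sup>2 \<cdot>\<^sub>m (X * transpose_mat X) + \<Lambda>"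
  shows "pos_def_mat h S"
    and "correlation_mat h (minv (scale_mat S) * S * minv (scale_mat S))"
    and "sun_pdf q h (0\<^sub>v q) (\<nu>\<^sup>2 \<cdot>\<^sub>m 1\<^sub>m q) (\<nu> \<cdot>\<^sub>m (transpose_mat X * minv (scale_mat S)))
        (0\<^sub>v h) (minv (scale_mat S) * S * minv (scale_mat S)) b =
      mvn_pdf q (\<nu>\<^sup>2 \<cdot>\<^sub>m 1\<^sub>m q) b * mvn_cdf h \<Lambda> (X *\<^sub>v b) / mvn_cdf h S (0\<^sub>v h)"
proof -
  note \<Lambda>c = pos_def_carrier[OF \<Lambda>]
  have XT: "transpose_mat X \<in> carrier_mat q h" using X by simp
  have prior: "pos_def_mat q (\<nu>\<^sup>2 \<cdot>\<^sub>m 1\<^sub>m q)" using \<nu> by (intro pos_def_smult pos_def_one) simp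
  have "X * (\<nu>\<^sup>2 \<cdot>\<^sub>m 1\<^sub>m q) * transpose_mat X = \<nu>\<^sup>2 \<cdot>\<^sub>m (X * transpose_mat X)"
    using X mult_smult_distrib[OF X one_carrier_mat] mult_smult_assoc_mat[OF X XT] by simp
  with mvn_cdf_marginalize(1)[OF prior \<Lambda> X] show S: "pos_def_mat h S" by (simp add: S_def)
  note Sc = pos_def_carrier[OF S]
  \<comment> \<open>The quadratic form at unit vectors shows that the diagonal is positive, so
    \<open>scale_mat S\<close> is invertible.\<close>
  have S_diag: "S $$ (i, i) > 0" if i: "i < h" for i
  proof -
    have "unit_vec h i \<bullet> (S *\<^sub>v unit_vec h i) = (S *\<^sub>v unit_vec h i) $ i"
      by (rule scalar_prod_left_unit[OF mult_mat_vec_carrier[OF Sc] i]) simp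
    also have "\<dots> = S $$ (i, i)" using Sc i by simp
    finally have "unit_vec h i \<bullet> (S *\<^sub>v unit_vec h i) = S $$ (i, i)" .
    moreover have "unit_vec h i \<noteq> (0\<^sub>v h :: real vec)" using i by (simp add: unit_vec_nonzero)
    ultimately show ?thesis using S unfolding pos_def_mat_def by (metis unit_vec_carrier)
  qed
  define r where "r i = 1 / sqrt (S $$ (i, i))" for i
  have r: "r i > 0" if "i < h" for i using S_diag[OF that] by (simp add: r_def)
  define R where "R = diag_of h r"
  have s_inv: "minv (scale_mat S) = R"
    unfolding scale_mat_eq_diag_of[OF Sc] R_def r_def using S_diag by (intro diag_of_inverse(2)) fastforce
  have R: "R \<in> carrier_mat h h" "transpose_mat R = R" by (simp_all add: R_def)
  \<comment> \<open>Two-sided diagonal scaling acts entrywise, which reduces the unit diagonal and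
    the covariance identity below to real arithmetic.\<close>
  have RAR: "(R * A * R) $$ (i, j) = r i * A $$ (i, j) * r j" if "A \<in> carrier_mat h h" "i < h" "j < h" for A i j
    unfolding R_def diag_of_mult_right[OF mult_carrier_mat[OF diag_of_carrier that(1)] that(2,3)]
      diag_of_mult_left[OF that] ..
  show "correlation_mat h (minv (scale_mat S) * S * minv (scale_mat S))"
    unfolding correlation_mat_def s_inv
  proof (intro conjI allI impI)
    have "v = 0\<^sub>v h" if "v \<in> carrier_vec h" "transpose_mat R *\<^sub>v v = 0\<^sub>v h" for v
    proof (rule diag_of_mult_vec_inj[OF _ that(1)])
      show "r i \<noteq> 0" if "i < h" for i using r[OF that] by simp
      show "diag_of h r *\<^sub>v v = 0\<^sub>v h" using that(2) by (simp add: R_def)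
    qed
    from pos_def_congruence[OF S R(1) this] show "pos_def_mat h (R * S * R)" by (simp add: R(2))
    fix i assume i: "i < h"
    have "r i * S $$ (i, i) * r i = 1" using S_diag[OF i] by (simp add: r_def)
    then show "(R * S * R) $$ (i, i) = 1" using RAR[OF Sc i i] by simp
  qed
  define \<Delta> where "\<Delta> = \<nu> \<cdot>\<^sub>m (transpose_mat X * R)"
  have \<Delta>T: "transpose_mat \<Delta> = \<nu> \<cdot>\<^sub>m (R * X)"
    using transpose_mult[OF XT R(1)] by (simp add: \<Delta>_def transpose_mat_smult R(2))
  have RX: "R * X \<in> carrier_mat h q" and XTR: "transpose_mat X * R \<in> carrier_mat q h"
    using R(1) X XT by (auto intro: mult_carrier_mat)
  have \<Omega>: "\<nu>\<^sup>2 \<cdot>\<^sub>m 1\<^sub>m q = diag_of q (\<lambda>_. \<nu>\<^sup>2)" by (intro eq_matI) (auto simp: diag_of_def)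
  have scale: "scale_mat (\<nu>\<^sup>2 \<cdot>\<^sub>m 1\<^sub>m q) = diag_of q (\<lambda>_. \<nu>)"
    using \<nu> by (subst scale_mat_eq_diag_of[of _ q]) (auto simp: diag_of_def intro!: eq_matI)
  have scale_inv: "minv (scale_mat (\<nu>\<^sup>2 \<cdot>\<^sub>m 1\<^sub>m q)) = diag_of q (\<lambda>_. 1 / \<nu>)"
    unfolding scale using \<nu> by (intro diag_of_inverse(2)) simp
  have corr: "corr_of_mat (\<nu>\<^sup>2 \<cdot>\<^sub>m 1\<^sub>m q) = 1\<^sub>m q"
    unfolding corr_of_mat_def scale_inv unfolding \<Omega>
  proof (rule eq_matI)
    fix i j assume "i < dim_row (1\<^sub>m q :: real mat)" "j < dim_col (1\<^sub>m q :: real mat)"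
    then have ij: "i < q" "j < q" by auto
    let ?D = "diag_of q (\<lambda>_. 1 / \<nu>) * diag_of q (\<lambda>_. \<nu>\<^sup>2)"
    have "(?D * diag_of q (\<lambda>_. 1 / \<nu>)) $$ (i, j) = ?D $$ (i, j) * (1 / \<nu>)"
      by (rule diag_of_mult_right[OF mult_carrier_mat[OF diag_of_carrier diag_of_carrier] ij])
    also have "?D $$ (i, j) = 1 / \<nu> * diag_of q (\<lambda>_. \<nu>\<^sup>2) $$ (i, j)"
      by (rule diag_of_mult_left[OF diag_of_carrier ij])
    finally show "(?D * diag_of q (\<lambda>_. 1 / \<nu>)) $$ (i, j) = 1\<^sub>m q $$ (i, j)"
      using ij \<nu> by (simp add: diag_of_def power2_eq_square)
  qed simp_all
  have minv1: "minv (1\<^sub>m q) = 1\<^sub>m q" by (intro minv_eqI[of _ q]) simp_all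
  have R0: "R *\<^sub>v 0\<^sub>v h = 0\<^sub>v h" by (rule mult_mat_zero_vec[OF R(1)])
  \<comment> \<open>The \<open>\<nu>\<close> in \<open>\<Delta>\<close> cancels the reciprocal scale
    \<open>1 / \<nu>\<close> of the prior, whose correlation matrix is the identity.\<close>
  have arg: "0\<^sub>v h + (transpose_mat \<Delta> * minv (corr_of_mat (\<nu>\<^sup>2 \<cdot>\<^sub>m 1\<^sub>m q)) * minv (scale_mat (\<nu>\<^sup>2 \<cdot>\<^sub>m 1\<^sub>m q))) *\<^sub>v (b - 0\<^sub>v q) =
      R *\<^sub>v (X *\<^sub>v b)"
  proof -
    have D: "diag_of q (\<lambda>_. 1 / \<nu>) *\<^sub>v b = (1 / \<nu>) \<cdot>\<^sub>v b"
      using b by (intro eq_vecI) (simp_all add: diag_of_mult_vec del: index_mult_mat_vec)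
    have \<nu>RX: "\<nu> \<cdot>\<^sub>m (R * X) \<in> carrier_mat h q" using RX by simp
    have "(transpose_mat \<Delta> * minv (corr_of_mat (\<nu>\<^sup>2 \<cdot>\<^sub>m 1\<^sub>m q)) * minv (scale_mat (\<nu>\<^sup>2 \<cdot>\<^sub>m 1\<^sub>m q))) *\<^sub>v b =
        (\<nu> \<cdot>\<^sub>m (R * X) * diag_of q (\<lambda>_. 1 / \<nu>)) *\<^sub>v b"
      unfolding \<Delta>T corr minv1 scale_inv right_mult_one_mat[OF \<nu>RX] ..
    also have "\<dots> = (\<nu> \<cdot>\<^sub>m (R * X)) *\<^sub>v ((1 / \<nu>) \<cdot>\<^sub>v b)"
      using assoc_mult_mat_vec[OF \<nu>RX diag_of_carrier b] by (simp only: D)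
    also have "\<dots> = \<nu> \<cdot>\<^sub>v ((R * X) *\<^sub>v ((1 / \<nu>) \<cdot>\<^sub>v b))"
      by (rule smult_mat_mult_vec[OF RX]) (use b in simp)
    also have "\<dots> = (R * X) *\<^sub>v b"
      unfolding mult_mat_vec[OF RX b] using \<nu> by (simp add: smult_smult_assoc)
    also have "\<dots> = R *\<^sub>v (X *\<^sub>v b)" by (rule assoc_mult_mat_vec[OF R(1) X b])
    finally show ?thesis using b R(1) X by simp
  qed
  \<comment> \<open>The subtracted term is \<open>\<nu>\<^sup>2 R X X\<^sup>T R\<close>, exactly the
    part of \<open>R * S * R\<close> that does not come from \<open>\<Lambda>\<close>.\<close>
  have cov: "R * S * R - transpose_mat \<Delta> * minv (corr_of_mat (\<nu>\<^sup>2 \<cdot>\<^sub>m 1\<^sub>m q)) * \<Delta> = R * \<Lambda> * R"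
  proof -
    have "transpose_mat \<Delta> * minv (corr_of_mat (\<nu>\<^sup>2 \<cdot>\<^sub>m 1\<^sub>m q)) * \<Delta> = (\<nu> \<cdot>\<^sub>m (R * X)) * \<Delta>"
      unfolding corr minv1 \<Delta>T right_mult_one_mat[OF smult_carrier_mat[OF RX]] ..
    also have "\<dots> = \<nu> \<cdot>\<^sub>m (\<nu> \<cdot>\<^sub>m ((R * X) * (transpose_mat X * R)))"
      unfolding \<Delta>_def using mult_smult_assoc_mat[OF RX, of "\<nu> \<cdot>\<^sub>m (transpose_mat X * R)" h \<nu>] mult_smult_distrib[OF RX XTR, of \<nu>] XTR
      by simp
    also have "(R * X) * (transpose_mat X * R) = R * (X * transpose_mat X) * R"
      using assoc_mult_mat[OF RX XT R(1)] assoc_mult_mat[OF R(1) X XT] by simp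
    finally have eq: "transpose_mat \<Delta> * minv (corr_of_mat (\<nu>\<^sup>2 \<cdot>\<^sub>m 1\<^sub>m q)) * \<Delta> =
      \<nu> \<cdot>\<^sub>m (\<nu> \<cdot>\<^sub>m (R * (X * transpose_mat X) * R))" .
    have XX: "X * transpose_mat X \<in> carrier_mat h h" using X XT by (rule mult_carrier_mat)
    have carr: "R * A * R \<in> carrier_mat h h" if "A \<in> carrier_mat h h" for A
      using R(1) that by (intro mult_carrier_mat)
    show ?thesis unfolding eq
    proof (rule eq_matI)
      fix i j assume "i < dim_row (R * \<Lambda> * R)" "j < dim_col (R * \<Lambda> * R)"
      then have ij: "i < h" "j < h" using R(1) by auto
      have "(R * S * R - \<nu> \<cdot>\<^sub>m (\<nu> \<cdot>\<^sub>m (R * (X * transpose_mat X) * R))) $$ (i, j) =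
          (R * S * R) $$ (i, j) - \<nu> * (\<nu> * (R * (X * transpose_mat X) * R) $$ (i, j))"
        using ij carrier_matD[OF carr[OF XX]] carrier_matD[OF carr[OF Sc]]
        by (simp del: index_mult_mat(1) assoc_mult_mat)
      also have "\<dots> = r i * S $$ (i, j) * r j - \<nu> * (\<nu> * (r i * (X * transpose_mat X) $$ (i, j) * r j))"
        by (simp only: RAR[OF Sc ij] RAR[OF XX ij])
      also have "S $$ (i, j) = \<nu>\<^sup>2 * (X * transpose_mat X) $$ (i, j) + \<Lambda> $$ (i, j)"
        unfolding S_def using ij \<Lambda>c carrier_matD[OF XX] by (simp del: index_mult_mat(1))
      also have "r i * (\<nu>\<^sup>2 * (X * transpose_mat X) $$ (i, j) + \<Lambda> $$ (i, j)) * r j -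
          \<nu> * (\<nu> * (r i * (X * transpose_mat X) $$ (i, j) * r j)) = r i * \<Lambda> $$ (i, j) * r j"
        by (simp add: algebra_simps power2_eq_square del: index_mult_mat(1))
      finally show "(R * S * R - \<nu> \<cdot>\<^sub>m (\<nu> \<cdot>\<^sub>m (R * (X * transpose_mat X) * R))) $$ (i, j) = (R * \<Lambda> * R) $$ (i, j)"
        by (simp only: RAR[OF \<Lambda>c ij])
    qed (use R(1) in auto)
  qed
  have "mvn_cdf h (R * \<Lambda> * R) (R *\<^sub>v (X *\<^sub>v b)) = mvn_cdf h \<Lambda> (X *\<^sub>v b)"
    unfolding R_def by (rule mvn_cdf_diag_scale[OF \<Lambda> r]) (use X b in simp_all)
  moreover have "mvn_cdf h (R * S * R) (0\<^sub>v h) = mvn_cdf h S (0\<^sub>v h)"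
    using mvn_cdf_diag_scale[where r = r, OF S r zero_carrier_vec] R0 unfolding R_def[symmetric] by simp
  ultimately show "sun_pdf q h (0\<^sub>v q) (\<nu>\<^sup>2 \<cdot>\<^sub>m 1\<^sub>m q) (\<nu> \<cdot>\<^sub>m (transpose_mat X * minv (scale_mat S)))
        (0\<^sub>v h) (minv (scale_mat S) * S * minv (scale_mat S)) b =
      mvn_pdf q (\<nu>\<^sup>2 \<cdot>\<^sub>m 1\<^sub>m q) b * mvn_cdf h \<Lambda> (X *\<^sub>v b) / mvn_cdf h S (0\<^sub>v h)"
    unfolding sun_pdf_def s_inv \<Delta>_def[symmetric] arg cov using b by simp
qed

theorem theorem1:
  fixes M :: "'a measure"
    and n p L :: nat
    and \<nu> :: real
    and x :: "nat \<Rightarrow> real vec"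
    and \<Sigma> :: "real mat"
    and \<beta> :: "'a \<Rightarrow> real vec"
    and \<epsilon> :: "nat \<Rightarrow> 'a \<Rightarrow> real vec"
    and Y :: "nat \<Rightarrow> 'a \<Rightarrow> nat"
    and y :: "nat \<Rightarrow> nat"
  defines "q \<equiv> p * (L - 1)"
    and "h \<equiv> n * (L - 1)"
  defines "Xb \<equiv> Xbar_mat n p L x y"
    and "\<Lambda> \<equiv> Lambda_mat n L \<Sigma> y"
  defines "S \<equiv> \<nu>\<^sup>2 \<cdot>\<^sub>m (Xb * transpose_mat Xb) + \<Lambda>"
  defines "s \<equiv> scale_mat S"
  defines "\<Omega>pst \<equiv> \<nu>\<^sup>2 \<cdot>\<^sub>m 1\<^sub>m q"
    and "\<Delta>pst \<equiv> \<nu> \<cdot>\<^sub>m (transpose_mat Xb * minv s)"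
    and "\<Gamma>pst \<equiv> minv s * S * minv s"
  defines "obs \<equiv> {\<omega> \<in> space M. \<forall>i<n. Y i \<omega> = y i}"
  assumes "n \<ge> 1" and "p \<ge> 1" and "L \<ge> 2" and "\<nu> > 0"
    and covariates: "\<And>i. i < n \<Longrightarrow> x i \<in> carrier_vec p"
    and Sigma: "pos_def_mat L \<Sigma>"
    and prob: "prob_space M"
    and prior: "normal_distributed M q \<beta> (\<nu>\<^sup>2 \<cdot>\<^sub>m 1\<^sub>m q)"
    and errors: "\<And>i. i < n \<Longrightarrow> normal_distributed M L (\<epsilon> i) \<Sigma>"
    and errors_indep: "prob_space.indep_vars M
          (case_option (lborel_vec q) (\<lambda>i. lborel_vec L)) (case_option \<beta> \<epsilon>)
          (insert None (Some ` {..<n}))"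
    and responses: "\<And>i. i < n \<Longrightarrow> Y i \<in> measurable M (count_space {..<L})"
    and responses_indep: "\<And>z. (\<And>i. i < n \<Longrightarrow> z i < L) \<Longrightarrow>
          AE \<omega> in M. cprob_given M q \<beta> {\<omega>' \<in> space M. \<forall>i<n. Y i \<omega>' = z i} \<omega> =
            (\<Prod>i<n. cprob_given M q \<beta> {\<omega>' \<in> space M. Y i \<omega>' = z i} \<omega>)"
    and responses_prob: "\<And>i l. i < n \<Longrightarrow> l < L \<Longrightarrow>
          AE \<omega> in M. cprob_given M q \<beta> {\<omega>' \<in> space M. Y i \<omega>' = l} \<omega> =
            cprob_given M q \<beta> {\<omega>' \<in> space M. \<forall>k<L. k \<noteq> l \<longrightarrow>
              utility p L (x i) (\<beta> \<omega>') (\<epsilon> i \<omega>') l > utility p L (x i) (\<beta> \<omega>') (\<epsilon> i \<omega>') k} \<omega>"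
    and observed: "\<And>i. i < n \<Longrightarrow> y i < L"
  shows "measure M obs > 0 \<and> correlation_mat h \<Gamma>pst \<and>
    sun_distributed (uniform_measure M obs) q h \<beta> (0\<^sub>v q) \<Omega>pst \<Delta>pst (0\<^sub>v h) \<Gamma>pst"
proof -
  interpret prob_space M by (rule prob)
  have obs: "obs \<in> events"
  proof -
    have "{\<omega> \<in> space M. \<forall>i\<in>{..<n}. Y i \<omega> = y i} \<in> events"
    proof (rule sets.sets_Collect_finite_All)
      fix i assume "i \<in> {..<n}"
      then have i: "i < n" by simp
      have "Y i -` {y i} \<inter> space M \<in> events"
        by (rule measurable_sets[OF responses[OF i]]) (use observed[OF i] in simp)
      moreover have "Y i -` {y i} \<inter> space M = {\<omega> \<in> space M. Y i \<omega> = y i}" by auto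
      ultimately show "{\<omega> \<in> space M. Y i \<omega> = y i} \<in> events" by (simp only:)
    qed simp
    moreover have "obs = {\<omega> \<in> space M. \<forall>i\<in>{..<n}. Y i \<omega> = y i}" by (auto simp: obs_def)
    ultimately show ?thesis by (simp only:)
  qed
  have Xb: "Xb \<in> carrier_mat h q"
    unfolding Xb_def h_def q_def by (rule Xbar_mat_carrier[OF covariates observed])
  have \<Lambda>: "pos_def_mat h \<Lambda>"
    unfolding \<Lambda>_def h_def by (rule mvn_cdf_Lambda_mat(1)[OF Sigma covariates observed])
  have prior_pd: "pos_def_mat q \<Omega>pst"
    unfolding \<Omega>pst_def using \<open>\<nu> > 0\<close> by (intro pos_def_smult pos_def_one) simp
  note \<beta> = normal_distributed_distr[OF prior]
  note post = sun_pdf_posterior[OF \<open>\<nu> > 0\<close> Xb \<Lambda>, folded S_def, folded s_def, folded \<Omega>pst_def \<Delta>pst_def \<Gamma>pst_def]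
  have S: "pos_def_mat h S" by (rule post(1)[OF zero_carrier_vec])
  \<comment> \<open>In the independent family, \<open>None\<close> indexes the coefficients and
    \<open>Some i\<close> the error vector of observation \<open>i\<close>.\<close>
  have joint: "distr M (lborel_vec q) \<beta> \<Otimes>\<^sub>M distr M (lborel_vec L) (\<epsilon> i) =
      distr M (lborel_vec q \<Otimes>\<^sub>M lborel_vec L) (\<lambda>\<omega>. (\<beta> \<omega>, \<epsilon> i \<omega>))" if "i < n" for i
    using indep_vars_pair_distr[OF errors_indep, of None "Some i"] that by simp
  \<comment> \<open>\<open>G\<close> is the likelihood of the observed responses as a function of
    the coefficients.\<close>
  define G where "G b = mvn_cdf h \<Lambda> (Xb *\<^sub>v b)" for b
  have cond: "AE \<omega> in M. cprob_given M q \<beta> obs \<omega> = G (\<beta> \<omega>)"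
  proof -
    have "AE \<omega> in M. cprob_given M q \<beta> {\<omega>' \<in> space M. Y i \<omega>' = y i} \<omega> =
        mvn_cdf (L - 1) (V_mat L (y i) * \<Sigma> * transpose_mat (V_mat L (y i))) (X_block L (x i) (y i) *\<^sub>v \<beta> \<omega>)"
      if i: "i \<in> {..<n}" for i
    proof -
      have "i < n" using i by simp
      show ?thesis
        using responses_prob[OF \<open>i < n\<close> observed[OF \<open>i < n\<close>]]
          cprob_category[OF prob Sigma covariates[OF \<open>i < n\<close>] observed[OF \<open>i < n\<close>], folded q_def,
            OF \<beta>(1) errors[OF \<open>i < n\<close>] joint[OF \<open>i < n\<close>]]
        by eventually_elim simp
    qed
    \<comment> \<open>One exceptional null set per observation: finitely many can be discarded
      together.\<close>
    then have "AE \<omega> in M. \<forall>i\<in>{..<n}. cprob_given M q \<beta> {\<omega>' \<in> space M. Y i \<omega>' = y i} \<omega> =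
        mvn_cdf (L - 1) (V_mat L (y i) * \<Sigma> * transpose_mat (V_mat L (y i))) (X_block L (x i) (y i) *\<^sub>v \<beta> \<omega>)"
      by (intro AE_finite_allI) auto
    moreover have "AE \<omega> in M. \<beta> \<omega> \<in> carrier_vec q"
      by (rule AE_I2) (rule measurable_lborel_vec_carrier[OF \<beta>(1)])
    moreover have "AE \<omega> in M. cprob_given M q \<beta> obs \<omega> = (\<Prod>i<n. cprob_given M q \<beta> {\<omega>' \<in> space M. Y i \<omega>' = y i} \<omega>)"
      unfolding obs_def by (rule responses_indep[OF observed])
    ultimately show ?thesis
    proof eventually_elim
      case (elim \<omega>)
      have "G (\<beta> \<omega>) =
          (\<Prod>i<n. mvn_cdf (L - 1) (V_mat L (y i) * \<Sigma> * transpose_mat (V_mat L (y i))) (X_block L (x i) (y i) *\<^sub>v \<beta> \<omega>))"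
        unfolding G_def h_def \<Lambda>_def Xb_def
        by (rule mvn_cdf_Lambda_mat(2)[OF Sigma covariates observed]) (use elim(2) in \<open>simp_all add: q_def\<close>)
      moreover have "(\<Prod>i<n. cprob_given M q \<beta> {\<omega>' \<in> space M. Y i \<omega>' = y i} \<omega>) =
          (\<Prod>i<n. mvn_cdf (L - 1) (V_mat L (y i) * \<Sigma> * transpose_mat (V_mat L (y i))) (X_block L (x i) (y i) *\<^sub>v \<beta> \<omega>))"
        by (rule prod.cong[OF refl]) (rule bspec[OF elim(1)])
      ultimately show ?case by (simp only: elim(3))
    qed
  qed
  have "Xb * \<Omega>pst * transpose_mat Xb = \<nu>\<^sup>2 \<cdot>\<^sub>m (Xb * transpose_mat Xb)"
    using Xb mult_smult_distrib[OF Xb one_carrier_mat] mult_smult_assoc_mat[of Xb h q "transpose_mat Xb" h]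
    by (simp add: \<Omega>pst_def)
  then have S_eq: "Xb * \<Omega>pst * transpose_mat Xb + \<Lambda> = S" by (simp add: S_def)
  have G_meas: "(\<lambda>b. ennreal (G b)) \<in> borel_measurable (lborel_vec q)"
    unfolding G_def by (rule mvn_cdf_marginalize(2)[OF prior_pd \<Lambda> Xb])
  have G_nonneg: "0 \<le> G b" for b by (simp add: G_def mvn_cdf_nonneg)
  have post_mass: "emeasure M (obs \<inter> (\<beta> -` B \<inter> space M)) =
      (\<integral>\<^sup>+b. ennreal (mvn_pdf q \<Omega>pst b) * ennreal (G b) * indicator B b \<partial>lborel_vec q)"
    if "B \<in> sets (lborel_vec q)" for B
    by (rule emeasure_Int_vimage_cond_exp[OF prob prior[folded \<Omega>pst_def] prior_pd obs G_meas G_nonneg cond that])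
  \<comment> \<open>By \<open>mvn_cdf_marginalize\<close> this is the integral of prior times
    likelihood; it is also the factor that the denominator of the SUN density reduces to.\<close>
  define c where "c = mvn_cdf h S (0\<^sub>v h)"
  have c: "c > 0" unfolding c_def by (rule mvn_cdf_pos[OF S])
  have mass: "emeasure M obs = ennreal c"
  proof -
    \<comment> \<open>Leaving the coefficients unrestricted turns the joint probability into that of
      \<open>obs\<close>.\<close>
    have "obs \<inter> (\<beta> -` carrier_vec q \<inter> space M) = obs"
      using sets.sets_into_space[OF obs] measurable_lborel_vec_carrier[OF \<beta>(1)] by auto
    then have "emeasure M obs = emeasure M (obs \<inter> (\<beta> -` carrier_vec q \<inter> space M))" by simp
    also have "\<dots> = (\<integral>\<^sup>+b. ennreal (mvn_pdf q \<Omega>pst b) * ennreal (G b) * indicator (carrier_vec q) b \<partial>lborel_vec q)"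
      by (rule post_mass) (use sets.top[of "lborel_vec q"] in simp)
    also have "\<dots> = (\<integral>\<^sup>+b. ennreal (mvn_pdf q \<Omega>pst b) * ennreal (G b) \<partial>lborel_vec q)"
      by (intro nn_integral_cong) simp
    also have "\<dots> = ennreal c"
      unfolding G_def c_def using mvn_cdf_marginalize(3)[OF prior_pd \<Lambda> Xb] by (simp only: S_eq)
    finally show ?thesis .
  qed
  have "prob obs > 0" using mass c by (simp add: emeasure_eq_measure)
  moreover have "correlation_mat h \<Gamma>pst" by (rule post(2)[OF zero_carrier_vec])
  moreover have "sun_distributed (uniform_measure M obs) q h \<beta> (0\<^sub>v q) \<Omega>pst \<Delta>pst (0\<^sub>v h) \<Gamma>pst"
    unfolding sun_distributed_def distributed_def
  proof (intro conjI)
    \<comment> \<open>The posterior density in Bayes form; division in \<open>ennreal\<close> agrees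
      with real division because \<open>c > 0\<close>.\<close>
    let ?f = "\<lambda>b. ennreal (mvn_pdf q \<Omega>pst b) * ennreal (G b) / ennreal c"
    have pdf: "ennreal (sun_pdf q h (0\<^sub>v q) \<Omega>pst \<Delta>pst (0\<^sub>v h) \<Gamma>pst b) = ?f b"
      if b: "b \<in> space (lborel_vec q)" for b
    proof -
      have "sun_pdf q h (0\<^sub>v q) \<Omega>pst \<Delta>pst (0\<^sub>v h) \<Gamma>pst b = mvn_pdf q \<Omega>pst b * G b / c"
        using post(3)[of b] b by (simp add: G_def c_def)
      then show ?thesis
        using c G_nonneg[of b] mvn_pdf_pos_def_pos[OF prior_pd, of q b]
        by (simp add: less_imp_le ennreal_mult flip: divide_ennreal)
    qed
    have num: "(\<lambda>b. ennreal (mvn_pdf q \<Omega>pst b) * ennreal (G b)) \<in> borel_measurable (lborel_vec q)"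
      by (intro borel_measurable_times_ennreal measurable_ennreal_mvn_pdf[OF prior_pd] G_meas)
    then have f: "?f \<in> borel_measurable (lborel_vec q)" by (intro borel_measurable_divide_ennreal) simp_all
    then show pdf_meas: "(\<lambda>b. ennreal (sun_pdf q h (0\<^sub>v q) \<Omega>pst \<Delta>pst (0\<^sub>v h) \<Gamma>pst b)) \<in> borel_measurable (lborel_vec q)"
      by (rule measurable_cong[THEN iffD2, rotated]) (rule pdf)
    show \<beta>u: "\<beta> \<in> measurable (uniform_measure M obs) (lborel_vec q)"
      using \<beta>(1) measurable_cong_sets[OF sets_uniform_measure refl] by blast
    show "distr (uniform_measure M obs) (lborel_vec q) \<beta> =
        density (lborel_vec q) (\<lambda>b. ennreal (sun_pdf q h (0\<^sub>v q) \<Omega>pst \<Delta>pst (0\<^sub>v h) \<Gamma>pst b))"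
    proof (rule measure_eqI)
      fix B assume "B \<in> sets (distr (uniform_measure M obs) (lborel_vec q) \<beta>)"
      then have B: "B \<in> sets (lborel_vec q)" by simp
      have "emeasure (distr (uniform_measure M obs) (lborel_vec q) \<beta>) B =
          emeasure (uniform_measure M obs) (\<beta> -` B \<inter> space M)"
        using emeasure_distr[OF \<beta>u B] by simp
      also have "\<dots> = emeasure M (obs \<inter> (\<beta> -` B \<inter> space M)) / emeasure M obs"
        by (rule emeasure_uniform_measure[OF obs measurable_sets[OF \<beta>(1) B]])
      also have "\<dots> = (\<integral>\<^sup>+b. ennreal (mvn_pdf q \<Omega>pst b) * ennreal (G b) * indicator B b \<partial>lborel_vec q) / ennreal c"
        by (simp only: post_mass[OF B] mass)
      also have "\<dots> = (\<integral>\<^sup>+b. ennreal (mvn_pdf q \<Omega>pst b) * ennreal (G b) * indicator B b / ennreal c \<partial>lborel_vec q)"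
        by (rule nn_integral_divide[symmetric]) (intro borel_measurable_times_ennreal[OF num] borel_measurable_indicator B)
      also have "\<dots> = (\<integral>\<^sup>+b. ennreal (sun_pdf q h (0\<^sub>v q) \<Omega>pst \<Delta>pst (0\<^sub>v h) \<Gamma>pst b) * indicator B b \<partial>lborel_vec q)"
        by (intro nn_integral_cong) (simp only: pdf, simp split: split_indicator)
      also have "\<dots> = emeasure (density (lborel_vec q) (\<lambda>b. ennreal (sun_pdf q h (0\<^sub>v q) \<Omega>pst \<Delta>pst (0\<^sub>v h) \<Gamma>pst b))) B"
        by (rule emeasure_density[OF pdf_meas B, symmetric])
      finally show "emeasure (distr (uniform_measure M obs) (lborel_vec q) \<beta>) B =
          emeasure (density (lborel_vec q) (\<lambda>b. ennreal (sun_pdf q h (0\<^sub>v q) \<Omega>pst \<Delta>pst (0\<^sub>v h) \<Gamma>pst b))) B" .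
    qed simp
  qed
  ultimately show ?thesis by blast
qed

end
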